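(* Let $n,k$ be integers with $k\geq 1$ and $n>2k+1$. The maximum value of the geodesic subpath number among all cactus graphs from $\mathcal{C}_{n,k}$ is attained only by balanced square chains; that is, if $G\in\mathcal{C}_{n,k}$ satisfies $\mathrm{gpn}(G)\geq\mathrm{gpn}(G')$ for all $G'\in\mathcal{C}_{n,k}$, then $G$ is a balanced square chain.
   Context: All graphs are finite, simple and connected. For distinct $u,v\in V(G)$, $\mathrm{gpn}_G(u,v)$ denotes the number of shortest $u$–$v$ paths in $G$, and for a graph $G$ on $n$ vertices $\mathrm{gpn}(G)=\sum_{\{u,v\}\subseteq V(G),\,u\neq v}\mathrm{gpn}_G(u,v)+n$ (sum over unordered pairs of distinct vertices). A cactus graph is a (connected, simple) graph in which all cycles are pairwise edge disjoint. $\mathcal{C}_{n,k}$ is the class of all cactus graphs on $n$ vertices with exactly $k$ cycles. A triangle is a $3$-cycle, a square is a $4$-cycle. A cactus graph is girth restricted if every cycle in it is a triangle or a square. A vertex belonging to a cycle is active if its degree in $G$ is at least $3$. A square is multiactive if it contains at least two active vertices; a square is antipodal if it contains precisely two active vertices and these two are opposite (non-adjacent) on the square. An antipodal cactus graph is a girth restricted cactus graph in which every multiactive square is antipodal. Let $G$ be an antipodal cactus graph and let $E_S$ be the set of all edges of $G$ belonging to squares. A unipath structure of $G$ is any non-trivial connected component (i.e. one with more than one vertex) of $G-E_S$. A unipath structure is good if it contains at most one vertex that belongs to a square, and, if there is such a vertex, it belongs to precisely one square. A unipath resolved graph is an antipodal cactus graph in which every unipath structure is good. A squared chain (also called square chain)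 is a unipath resolved cactus graph in which every vertex that belongs to at least two squares belongs to precisely two squares. A square chain $G\in\mathcal{C}_{n,k}$ is maximal if it contains the maximum possible number of squares for a graph in $\mathcal{C}_{n,k}$, i.e. $k$ squares if $n\geq 3k+1$ and $n-2k-1$ squares if $n<3k+1$. For a maximal square chain $G\in\mathcal{C}_{n,k}$, with $E_S$ the set of edges of $G$ belonging to squares, let $K_1$ and $K_2$ be the two largest connected components (by number of vertices; possibly single vertices) of $G-E_S$, with $|V(K_1)|\geq|V(K_2)|$. A balanced square chain $G\in\mathcal{C}_{n,k}$ is a maximal square chain such that $|V(K_1)|-|V(K_2)|\leq 1$ in the case $n\geq 3k+1$, and $|V(K_1)|-|V(K_2)|\leq 2$ in the case $2k+1<n<3k+1$. *)

theory Defs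
  imports "Graph_Theory.Graph_Theory"
begin

text \<open>
  Finite simple graphs are symmetric loop-free pair digraphs (locale \<^locale>\<open>pair_graph\<close>):
  an undirected edge \<open>uv\<close> is the pair of arcs \<open>(u,v)\<close>, \<open>(v,u)\<close>. Accordingly, sets of undirected
  edges are represented by symmetric sets of arcs.
\<close>

subsection \<open>Geodesic subpath number\<close>

definition geodesic :: "'a pair_pre_digraph \<Rightarrow> 'a \<Rightarrow> ('a \<times> 'a) awalk \<Rightarrow> 'a \<Rightarrow> bool" where
  "geodesic G u p v \<longleftrightarrow> pre_digraph.apath (with_proj G) u p v \<and>
     (\<forall>q. pre_digraph.apath (with_proj G) u q v \<longrightarrow> length p \<le> length q)"

definition gpn_pair :: "'a pair_pre_digraph \<Rightarrow> 'a \<Rightarrow> 'a \<Rightarrow> nat" where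
  "gpn_pair G u v = card {p. geodesic G u p v}"

text \<open>
  The double sum ranges over ordered pairs and so counts every unordered pair twice;
  the lemma \<open>gpn_unordered\<close> below gives the form with unordered pairs.
\<close>

definition gpn :: "'a pair_pre_digraph \<Rightarrow> nat" where
  "gpn G = (\<Sum>u\<in>pverts G. \<Sum>v\<in>pverts G - {u}. gpn_pair G u v) div 2 + card (pverts G)"

lemma length_rev_path [simp]: "length (rev_path p) = length p"
  by (induct p) auto

lemma gpn_pair_commute:
  assumes "pair_graph G"
  shows "gpn_pair G u v = gpn_pair G v u"
proof -
  interpret pair_graph G by fact
  have *: "geodesic G y (rev_path p) x" if "geodesic G x p y" for x y p
    using that unfolding geodesic_def by (metis apath_rev_path length_rev_path)
  have "bij_betw rev_path {p. geodesic G u p v} {p. geodesic G v p u}"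
    by (rule bij_betw_byWitness[where f' = rev_path]) (auto intro: *)
  then show ?thesis
    unfolding gpn_pair_def by (rule bij_betw_same_card)
qed

lemma gpn_unordered:
  assumes G: "pair_graph G"
    and f: "\<And>u v. u \<in> pverts G \<Longrightarrow> v \<in> pverts G \<Longrightarrow> u \<noteq> v \<Longrightarrow> f {u, v} = gpn_pair G u v"
  shows "gpn G = (\<Sum>e | e \<subseteq> pverts G \<and> card e = 2. f e) + card (pverts G)"
proof -
  interpret pair_graph G by fact
  let ?V = "pverts G"
  let ?E = "{e. e \<subseteq> ?V \<and> card e = 2}"
  let ?S = "SIGMA u:?V. ?V - {u}"
  let ?h = "\<lambda>(u, v). {u, v}"
  have fin: "finite ?V" by (rule pair_finite_verts)
  have "(\<Sum>u\<in>?V. \<Sum>v\<in>?V - {u}. gpn_pair G u v) = (\<Sum>(u, v)\<in>?S. gpn_pair G u v)"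
    using fin by (simp add: sum.Sigma)
  also have "\<dots> = (\<Sum>x\<in>?S. f (?h x))"
    by (rule sum.cong) (auto intro: f[symmetric])
  also have "\<dots> = (\<Sum>e\<in>?E. \<Sum>x\<in>{x \<in> ?S. ?h x = e}. f (?h x))"
    using fin by (intro sum.group[symmetric]) auto
  also have "\<dots> = (\<Sum>e\<in>?E. 2 * f e)"
  proof (rule sum.cong [OF refl])
    fix e assume "e \<in> ?E"
    then obtain a b where e: "e = {a, b}" "a \<noteq> b" "a \<in> ?V" "b \<in> ?V"
      by (auto simp: card_2_iff)
    have "{x \<in> ?S. ?h x = e} = {(a, b), (b, a)}"
      using e by (auto simp: doubleton_eq_iff)
    then show "(\<Sum>x\<in>{x \<in> ?S. ?h x = e}. f (?h x)) = 2 * f e"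
      using e by (simp add: insert_commute)
  qed
  finally show ?thesis
    unfolding gpn_def by (simp flip: sum_distrib_left)
qed


subsection \<open>Cycles and cactus graphs\<close>

text \<open>
  A cycle is identified with its edge set, so that rotations and reversals of a closed walk
  yield the same cycle. The bound on the length excludes the closed walks \<open>u, v, u\<close>, which are
  cycles in the sense of digraphs.
\<close>

definition cycles :: "'a pair_pre_digraph \<Rightarrow> 'a rel set" where
  "cycles G = {symcl (set p) | p. pre_digraph.cycle (with_proj G) p \<and> 3 \<le> length p}"

definition cactus :: "'a pair_pre_digraph \<Rightarrow> bool" where
  "cactus G \<longleftrightarrow> pair_graph G \<and> connected (with_proj G) \<and>
     (\<forall>C\<in>cycles G. \<forall>D\<in>cycles G. C \<noteq> D \<longrightarrow> C \<inter> D = {})"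

definition cactus_class :: "nat \<Rightarrow> nat \<Rightarrow> 'a pair_pre_digraph set" where
  "cactus_class n k = {G. cactus G \<and> card (pverts G) = n \<and> card (cycles G) = k}"

definition triangles :: "'a pair_pre_digraph \<Rightarrow> 'a rel set" where
  "triangles G = {C \<in> cycles G. card (Field C) = 3}"

definition squares :: "'a pair_pre_digraph \<Rightarrow> 'a rel set" where
  "squares G = {C \<in> cycles G. card (Field C) = 4}"

definition girth_restricted :: "'a pair_pre_digraph \<Rightarrow> bool" where
  "girth_restricted G \<longleftrightarrow> cactus G \<and> cycles G \<subseteq> triangles G \<union> squares G"


subsection \<open>Antipodal cactus graphs\<close>

definition active :: "'a pair_pre_digraph \<Rightarrow> 'a \<Rightarrow> bool" where
  "active G v \<longleftrightarrow> (\<exists>C\<in>cycles G. v \<in> Field C) \<and> 3 \<le> out_degree (with_proj G) v"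

definition multiactive_square :: "'a pair_pre_digraph \<Rightarrow> 'a rel \<Rightarrow> bool" where
  "multiactive_square G S \<longleftrightarrow> S \<in> squares G \<and> 2 \<le> card {v \<in> Field S. active G v}"

definition antipodal_square :: "'a pair_pre_digraph \<Rightarrow> 'a rel \<Rightarrow> bool" where
  "antipodal_square G S \<longleftrightarrow> S \<in> squares G \<and>
     (\<exists>u v. u \<noteq> v \<and> {w \<in> Field S. active G w} = {u, v} \<and> (u, v) \<notin> S)"

definition antipodal_cactus :: "'a pair_pre_digraph \<Rightarrow> bool" where
  "antipodal_cactus G \<longleftrightarrow> girth_restricted G \<and>
     (\<forall>S. multiactive_square G S \<longrightarrow> antipodal_square G S)"


subsection \<open>Square chains\<close>

definition squares_at :: "'a pair_pre_digraph \<Rightarrow> 'a \<Rightarrow> 'a rel set" where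
  "squares_at G v = {S \<in> squares G. v \<in> Field S}"

definition del_square_edges :: "'a pair_pre_digraph \<Rightarrow> 'a pair_pre_digraph" where
  "del_square_edges G = G\<lparr>parcs := parcs G - \<Union>(squares G)\<rparr>"

text \<open>
  The vertex sets of the connected components of \<open>G - E\<^sub>S\<close>; as the graph is symmetric, these are
  its strongly connected components.
\<close>

definition components_wo_squares :: "'a pair_pre_digraph \<Rightarrow> 'a set set" where
  "components_wo_squares G = pre_digraph.sccs_verts (with_proj (del_square_edges G))"

definition unipath_structures :: "'a pair_pre_digraph \<Rightarrow> 'a set set" where
  "unipath_structures G = {K \<in> components_wo_squares G. 1 < card K}"

definition good_unipath_structure :: "'a pair_pre_digraph \<Rightarrow> 'a set \<Rightarrow> bool" where
  "good_unipath_structure G K \<longleftrightarrow> K \<in> unipath_structures G \<and>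
     card {v \<in> K. squares_at G v \<noteq> {}} \<le> 1 \<and>
     (\<forall>v\<in>K. squares_at G v \<noteq> {} \<longrightarrow> card (squares_at G v) = 1)"

definition unipath_resolved :: "'a pair_pre_digraph \<Rightarrow> bool" where
  "unipath_resolved G \<longleftrightarrow> antipodal_cactus G \<and>
     (\<forall>K\<in>unipath_structures G. good_unipath_structure G K)"

definition square_chain :: "'a pair_pre_digraph \<Rightarrow> bool" where
  "square_chain G \<longleftrightarrow> unipath_resolved G \<and>
     (\<forall>v\<in>pverts G. 2 \<le> card (squares_at G v) \<longrightarrow> card (squares_at G v) = 2)"

text \<open>
  The last conjunct records the value of the maximum. The subtraction does not truncate:
  a connected graph with \<open>k\<close> edge-disjoint cycles has at least \<open>2k + 1\<close> vertices.
\<close>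

definition maximal_square_chain :: "nat \<Rightarrow> nat \<Rightarrow> 'a pair_pre_digraph \<Rightarrow> bool" where
  "maximal_square_chain n k G \<longleftrightarrow> square_chain G \<and> G \<in> cactus_class n k \<and>
     (\<forall>H \<in> cactus_class n k. card (squares (H :: 'a pair_pre_digraph)) \<le> card (squares G)) \<and>
     card (squares G) = (if n \<ge> 3 * k + 1 then k else n - 2 * k - 1)"

definition two_largest_components :: "'a pair_pre_digraph \<Rightarrow> 'a set \<Rightarrow> 'a set \<Rightarrow> bool" where
  "two_largest_components G K\<^sub>1 K\<^sub>2 \<longleftrightarrow>
     K\<^sub>1 \<in> components_wo_squares G \<and> K\<^sub>2 \<in> components_wo_squares G \<and> K\<^sub>1 \<noteq> K\<^sub>2 \<and>
     card K\<^sub>2 \<le> card K\<^sub>1 \<and>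
     (\<forall>K \<in> components_wo_squares G - {K\<^sub>1, K\<^sub>2}. card K \<le> card K\<^sub>2)"

definition balanced_square_chain :: "nat \<Rightarrow> nat \<Rightarrow> 'a pair_pre_digraph \<Rightarrow> bool" where
  "balanced_square_chain n k G \<longleftrightarrow> maximal_square_chain n k G \<and>
     (\<exists>K\<^sub>1 K\<^sub>2. two_largest_components G K\<^sub>1 K\<^sub>2 \<and>
        (n \<ge> 3 * k + 1 \<longrightarrow> card K\<^sub>1 - card K\<^sub>2 \<le> 1) \<and>
        (2 * k + 1 < n \<and> n < 3 * k + 1 \<longrightarrow> card K\<^sub>1 - card K\<^sub>2 \<le> 2))"

end

theory Submission
  imports Defs
begin

text \<open>
  Everything follows from one exchange principle. If a maximiser is glued from \<open>H\<close> and a non-trivial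
  \<open>B\<close> at \<open>v\<close>, then \<open>v\<close> maximises, over the vertices of \<open>H\<close>, the sum of the numbers of shortest
  paths to all vertices of \<open>H\<close>; otherwise moving \<open>B\<close> to a better vertex gives a cactus of the same
  class with more shortest paths. Moreover, if another vertex is equally good, the relocated graph is
  again a maximiser. Long cycles are excluded by replacing them with a square and pendant vertices,
  relocating two branches at once shows that no two adjacent vertices of a square carry branches, and
  a vertex with three branches has at most one branch containing a square. A triangle and a bridge
  cannot coexist, since after gathering branches they could be merged into a square. Hence a maximiser
  consists of a linear chain of squares with a square-free cactus at either end, and relocating a leaf
  block from the larger end to the smaller one shows that the ends are balanced.
\<close>

subsection \<open>Shortest paths as vertex lists\<close>

text \<open>What makes the exchange principle computable: counts of shortest paths multiply at a cut
  vertex. In the total of two graphs glued at \<open>v\<close>, the only term that depends on the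
  place of gluing is \<open>2 * (gsum H v - 1) * (gsum B v - 1)\<close>, and its second factor is
  unchanged when the branch is moved. Comparing two places means comparing two values of
  \<open>gsum H\<close>. Strict gains alone do not suffice. A bridge or a triangle has unique
  shortest paths inside, so all its vertices are equally good for a branch and nothing is gained by
  leaving one of them. Ties turn this into freedom: branches slide across such blocks until several
  of them meet at one vertex, where a strict gain becomes available. Competitors must live on the
  same vertex type, which may have exactly \<open>n\<close> elements. So every modification reuses
  the vertices at hand: a branch is moved by exchanging two vertex names, a long cycle is rebuilt on
  its own vertex set, and the square replacing a triangle and a bridge is made from their
  vertices.\<close>

fun larcs :: "'a list \<Rightarrow> 'a rel" where
  "larcs (x # y # zs) = insert (x, y) (larcs (y # zs))"
| "larcs _ = {}"

text \<open>Vertex lists are used instead of arc lists because cutting at a vertex, reversing and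
  concatenating are then plain list operations, and \<open>distinct\<close> alone expresses that no
  vertex repeats.\<close>

definition paths :: "'a rel \<Rightarrow> 'a \<Rightarrow> 'a \<Rightarrow> 'a list set" where
  "paths E u v = {xs. xs \<noteq> [] \<and> hd xs = u \<and> last xs = v \<and> distinct xs \<and> larcs xs \<subseteq> E}"

definition geos :: "'a rel \<Rightarrow> 'a \<Rightarrow> 'a \<Rightarrow> 'a list set" where
  "geos E u v = {xs \<in> paths E u v. \<forall>ys\<in>paths E u v. length xs \<le> length ys}"

definition ngeo :: "'a rel \<Rightarrow> 'a \<Rightarrow> 'a \<Rightarrow> nat" where
  "ngeo E u v = card (geos E u v)"

text \<open>The standing notion of graph, written as conditions on sets so that it passes easily
  through unions and renamings; \<open>cgraph_iff\<close> matches it with \<open>pair_graph\<close>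
  and \<open>connected\<close>.\<close>

definition cgraph :: "'a pair_pre_digraph \<Rightarrow> bool" where
  "cgraph G \<longleftrightarrow> finite (pverts G) \<and> pverts G \<noteq> {} \<and> parcs G \<subseteq> pverts G \<times> pverts G \<and>
     sym (parcs G) \<and> irrefl (parcs G) \<and> (\<forall>u\<in>pverts G. \<forall>v\<in>pverts G. (u, v) \<in> (parcs G)\<^sup>*)"

lemma larcs_Cons: "xs \<noteq> [] \<Longrightarrow> larcs (x # xs) = insert (x, hd xs) (larcs xs)"
  by (cases xs) auto

lemma larcs_append:
  "xs \<noteq> [] \<Longrightarrow> ys \<noteq> [] \<Longrightarrow> larcs (xs @ ys) = insert (last xs, hd ys) (larcs xs \<union> larcs ys)"
  by (induct xs rule: larcs.induct) (auto simp: larcs_Cons)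

lemma larcs_append_mid: "larcs (xs @ v # ys) = larcs (xs @ [v]) \<union> larcs (v # ys)"
  by (cases "xs = []"; cases "ys = []") (auto simp: larcs_append larcs_Cons)

lemma larcs_subset: "larcs xs \<subseteq> set xs \<times> set xs"
  by (induct xs rule: larcs.induct) auto

lemma larcs_rev: "larcs (rev xs) = (larcs xs)\<inverse>"
proof (induct xs)
  case (Cons x xs)
  then show ?case
    by (cases "xs = []") (auto simp: larcs_append larcs_Cons last_rev)
qed simp

lemma larcs_map: "larcs (map f xs) = map_prod f f ` larcs xs"
  by (induct xs rule: larcs.induct) auto

lemma larcs_nth: "larcs xs = {(xs ! i, xs ! Suc i) | i. Suc i < length xs}"
proof (induct xs rule: larcs.induct)
  case (1 x y zs)
  have "{((x # y # zs) ! i, (x # y # zs) ! Suc i) | i. Suc i < length (x # y # zs)}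
      = insert (x, y) {((y # zs) ! i, (y # zs) ! Suc i) | i. Suc i < length (y # zs)}"
    (is "?L = ?R")
  proof (intro equalityI subsetI)
    fix e assume "e \<in> ?L"
    then obtain i where "e = ((x # y # zs) ! i, (x # y # zs) ! Suc i)" "Suc i < length (x # y # zs)"
      by auto
    then show "e \<in> ?R" by (cases i) auto
  next
    fix e assume "e \<in> ?R"
    then consider "e = (x, y)"
      | i where "e = ((y # zs) ! i, (y # zs) ! Suc i)" "Suc i < length (y # zs)" by auto
    then show "e \<in> ?L"
    proof cases
      case 1 then show ?thesis by (auto intro!: exI[of _ 0])
    next
      case 2 then show ?thesis by (auto intro!: exI[of _ "Suc i"])
    qed
  qed
  with 1 show ?case by simp
qed auto

lemma paths_mono: "E \<subseteq> E' \<Longrightarrow> paths E u v \<subseteq> paths E' u v"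
  by (auto simp: paths_def)

lemma paths_rev: "sym E \<Longrightarrow> xs \<in> paths E u v \<Longrightarrow> rev xs \<in> paths E v u"
  by (auto simp: paths_def hd_rev last_rev larcs_rev sym_conv_converse_eq)

lemma paths_ref: "paths E u u = {[u]}"
proof -
  have "xs = [u]" if "xs \<noteq> []" "hd xs = u" "last xs = u" "distinct xs" for xs
    using that by (cases xs) (auto split: if_splits)
  then show ?thesis by (auto simp: paths_def)
qed

lemma rtrancl_imp_paths: "(u, v) \<in> E\<^sup>* \<Longrightarrow> paths E u v \<noteq> {}"
proof (induct rule: rtrancl_induct)
  case base
  then show ?case by (simp add: paths_ref)
next
  case (step y z)
  then obtain xs where xs: "xs \<noteq> []" "hd xs = u" "last xs = y" "distinct xs" "larcs xs \<subseteq> E"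
    by (auto simp: paths_def)
  show ?case
  proof (cases "z \<in> set xs")
    case True
    then obtain as bs where "xs = as @ z # bs" by (meson split_list)
    with xs have "as @ [z] \<in> paths E u z"
      by (auto simp: paths_def larcs_append_mid[of as z bs] hd_append)
    then show ?thesis by blast
  next
    case False
    with xs step have "xs @ [z] \<in> paths E u z"
      by (auto simp: paths_def larcs_append)
    then show ?thesis by blast
  qed
qed

lemma larcs_imp_rtrancl_mem:
  "larcs (x # xs) \<subseteq> E \<Longrightarrow> y \<in> set (x # xs) \<Longrightarrow> (x, y) \<in> E\<^sup>*"
proof (induct xs arbitrary: x)
  case (Cons z xs)
  then show ?case by (auto intro: converse_rtrancl_into_rtrancl)
qed auto

lemma paths_in_field: "xs \<in> paths E u v \<Longrightarrow> E \<subseteq> V \<times> V \<Longrightarrow> u \<in> V \<Longrightarrow> set xs \<subseteq> V"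
proof (induct xs arbitrary: u)
  case (Cons x xs)
  show ?case
  proof (cases "xs = []")
    case True then show ?thesis using Cons by (auto simp: paths_def)
  next
    case False
    with Cons have "xs \<in> paths E (hd xs) v" "hd xs \<in> V" by (auto simp: paths_def larcs_Cons)
    with Cons show ?thesis by (auto simp: paths_def)
  qed
qed (auto simp: paths_def)

lemma geos_ne: "(u, v) \<in> E\<^sup>* \<Longrightarrow> geos E u v \<noteq> {}"
proof -
  assume "(u, v) \<in> E\<^sup>*"
  then have "paths E u v \<noteq> {}" by (rule rtrancl_imp_paths)
  then obtain xs where xs: "xs \<in> paths E u v" by (meson ex_in_conv)
  from ex_has_least_nat[of "\<lambda>xs. xs \<in> paths E u v" xs length, OF this]
  obtain ys where "ys \<in> paths E u v" "\<forall>zs. zs \<in> paths E u v \<longrightarrow> length ys \<le> length zs" by blast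
  then have "ys \<in> geos E u v" by (simp add: geos_def)
  then show ?thesis by blast
qed

lemma geos_sub: "geos E u v \<subseteq> paths E u v"
  by (auto simp: geos_def)

lemma geos_length: "xs \<in> geos E u v \<Longrightarrow> ys \<in> geos E u v \<Longrightarrow> length xs = length ys"
  by (auto simp: geos_def intro: le_antisym)

lemma ngeo_ref [simp]: "ngeo E u u = 1"
proof -
  have "geos E u u = {[u]}" by (auto simp: geos_def paths_ref)
  then show ?thesis by (simp add: ngeo_def)
qed

lemma ngeo_sym: assumes "sym E" shows "ngeo E u v = ngeo E v u"
proof -
  have *: "rev xs \<in> geos E v u" if "xs \<in> geos E u v" for xs u v
  proof -
    have "length (rev xs) \<le> length ys" if "ys \<in> paths E v u" for ys
      using paths_rev[OF assms that] \<open>xs \<in> geos E u v\<close> by (force simp: geos_def)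
    then show ?thesis using paths_rev[OF assms] that by (auto simp: geos_def)
  qed
  have "bij_betw rev (geos E u v) (geos E v u)"
    by (rule bij_betw_byWitness[where f' = rev]) (auto intro: *)
  then show ?thesis unfolding ngeo_def by (rule bij_betw_same_card)
qed

lemma finite_paths: assumes "finite V" "E \<subseteq> V \<times> V" "u \<in> V" shows "finite (paths E u v)"
proof (rule finite_subset)
  show "paths E u v \<subseteq> {xs. set xs \<subseteq> V \<and> length xs \<le> card V}"
    using paths_in_field[OF _ assms(2,3)] assms(1)
    by (auto simp: paths_def) (metis card_mono distinct_card)
  show "finite {xs. set xs \<subseteq> V \<and> length xs \<le> card V}"
    using assms(1) by (rule finite_lists_length_le)
qed

lemma finite_geos: "finite V \<Longrightarrow> E \<subseteq> V \<times> V \<Longrightarrow> u \<in> V \<Longrightarrow> finite (geos E u v)"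
  by (rule finite_subset[OF geos_sub finite_paths])

lemma cgraphD:
  assumes "cgraph G"
  shows "finite (pverts G)" "pverts G \<noteq> {}" "parcs G \<subseteq> pverts G \<times> pverts G"
    "sym (parcs G)" "irrefl (parcs G)"
    "\<And>u v. u \<in> pverts G \<Longrightarrow> v \<in> pverts G \<Longrightarrow> (u, v) \<in> (parcs G)\<^sup>*"
  using assms by (auto simp: cgraph_def)

lemma ngeo_pos: assumes "cgraph G" "u \<in> pverts G" "v \<in> pverts G" shows "1 \<le> ngeo (parcs G) u v"
proof -
  have "finite (geos (parcs G) u v)" using assms by (metis cgraphD(1,3) finite_geos)
  moreover have "geos (parcs G) u v \<noteq> {}" using assms cgraphD(6) geos_ne by fast
  ultimately have "0 < ngeo (parcs G) u v" unfolding ngeo_def by (meson card_gt_0_iff)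
  then show ?thesis by linarith
qed

lemma paths_two: assumes "u \<noteq> v" "xs \<in> paths E u v" shows "2 \<le> length xs"
proof (cases xs)
  case Nil
  then show ?thesis using assms by (simp add: paths_def)
next
  case (Cons x ys)
  then show ?thesis using assms by (cases ys) (auto simp: paths_def)
qed

lemma paths_length_two: "u \<noteq> v \<Longrightarrow> xs \<in> paths E u v \<Longrightarrow> length xs = 2 \<Longrightarrow> xs = [u, v]"
proof -
  assume a: "u \<noteq> v" "xs \<in> paths E u v" "length xs = 2"
  from a(3) obtain x y where "xs = [x, y]" by (metis One_nat_def Suc_1 length_0_conv length_Suc_conv)
  with a(2) show ?thesis by (simp add: paths_def)
qed

lemma ngeo_adj: assumes "(u, v) \<in> E" "u \<noteq> v" shows "ngeo E u v = 1"
proof -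
  have uv: "[u, v] \<in> paths E u v" using assms by (auto simp: paths_def)
  have "geos E u v = {[u, v]}"
  proof (intro equalityI subsetI)
    fix xs assume "xs \<in> geos E u v"
    with uv have "xs \<in> paths E u v" "length xs \<le> 2" by (auto simp: geos_def)
    with assms(2) paths_two[of u v xs E] have "length xs = 2" by linarith
    with assms(2) \<open>xs \<in> paths E u v\<close> show "xs \<in> {[u, v]}" using paths_length_two by fast
  next
    fix xs assume "xs \<in> {[u, v]}"
    with uv assms(2) show "xs \<in> geos E u v" by (auto simp: geos_def dest: paths_two)
  qed
  then show ?thesis by (simp add: ngeo_def)
qed

text \<open>Without an arc but with a common neighbour, the shortest paths have exactly three
  vertices, so they correspond to their middle vertices.\<close>

lemma ngeo_common:
  assumes "(u, v) \<notin> E" "u \<noteq> v" "irrefl E" and ne: "{z. (u, z) \<in> E \<and> (z, v) \<in> E} \<noteq> {}"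
  shows "ngeo E u v = card {z. (u, z) \<in> E \<and> (z, v) \<in> E}"
proof -
  let ?Z = "{z. (u, z) \<in> E \<and> (z, v) \<in> E}"
  have irr: "(x, x) \<notin> E" for x using assms(3) by (auto simp: irrefl_def)
  have mem: "[u, z, v] \<in> paths E u v" if "z \<in> ?Z" for z
    using that assms(2) irr by (auto simp: paths_def)
  have len: "3 \<le> length xs" if "xs \<in> paths E u v" for xs
  proof -
    have "length xs \<noteq> 2"
    proof
      assume "length xs = 2"
      with that assms(2) have "xs = [u, v]" using paths_length_two by fast
      with that assms(1) show False by (auto simp: paths_def)
    qed
    with paths_two[OF assms(2) that] show ?thesis by simp
  qed
  have "geos E u v = (\<lambda>z. [u, z, v]) ` ?Z"
  proof (intro equalityI subsetI)
    fix xs assume xs: "xs \<in> geos E u v"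
    from ne obtain z where "z \<in> ?Z" by blast
    with xs mem have "length xs \<le> 3" by (force simp: geos_def)
    with xs len have "length xs = 3" by (force simp: geos_def)
    then obtain a b c where "xs = [a, b, c]" by (auto simp: length_Suc_conv numeral_3_eq_3)
    with xs show "xs \<in> (\<lambda>z. [u, z, v]) ` ?Z" by (auto simp: geos_def paths_def)
  next
    fix xs assume "xs \<in> (\<lambda>z. [u, z, v]) ` ?Z"
    then obtain z where z: "z \<in> ?Z" "xs = [u, z, v]" by blast
    then have "xs \<in> paths E u v" "length xs = 3" using mem by auto
    then show "xs \<in> geos E u v" using len by (simp add: geos_def)
  qed
  moreover have "inj_on (\<lambda>z. [u, z, v]) ?Z" by (auto simp: inj_on_def)
  ultimately show ?thesis by (simp add: ngeo_def card_image)
qed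

subsection \<open>Gluing two graphs at a vertex\<close>

text \<open>A plain union, so that commutativity and associativity are equalities of graphs. The
  condition that turns it into an amalgamation at one vertex is \<open>joint\<close>.\<close>

definition glue :: "'a pair_pre_digraph \<Rightarrow> 'a pair_pre_digraph \<Rightarrow> 'a pair_pre_digraph" where
  "glue H B = \<lparr>pverts = pverts H \<union> pverts B, parcs = parcs H \<union> parcs B\<rparr>"

definition joint :: "'a pair_pre_digraph \<Rightarrow> 'a pair_pre_digraph \<Rightarrow> 'a \<Rightarrow> bool" where
  "joint H B v \<longleftrightarrow> cgraph H \<and> cgraph B \<and> pverts H \<inter> pverts B = {v}"

lemma pverts_glue [simp]: "pverts (glue H B) = pverts H \<union> pverts B"
  by (simp add: glue_def)

lemma parcs_glue: "parcs (glue H B) = parcs H \<union> parcs B"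
  by (simp add: glue_def)

lemma glue_comm: "glue H B = glue B H"
  by (auto simp: glue_def)

lemma glue_assoc: "glue (glue A B) C = glue A (glue B C)"
  by (auto simp: glue_def)

lemma joint_sym: "joint H B v \<longleftrightarrow> joint B H v"
  by (auto simp: joint_def)

lemma jointD:
  assumes "joint H B v"
  shows "cgraph H" "cgraph B" "v \<in> pverts H" "v \<in> pverts B"
  using assms by (auto simp: joint_def)

lemma joint_unique: "joint H B v \<Longrightarrow> x \<in> pverts H \<Longrightarrow> x \<in> pverts B \<Longrightarrow> x = v"
  by (auto simp: joint_def)

text \<open>The two graphs share only \<open>v\<close>, so an arc that starts in \<open>H\<close>
  away from \<open>v\<close> belongs to \<open>H\<close>: a walk can change sides only at
  \<open>v\<close>.\<close>

lemma larcs_side: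
  assumes "joint H B v"
  shows "larcs xs \<subseteq> parcs (glue H B) \<Longrightarrow> xs \<noteq> [] \<Longrightarrow> v \<notin> set xs \<Longrightarrow> hd xs \<in> pverts H
    \<Longrightarrow> set xs \<subseteq> pverts H"
proof (induct xs rule: larcs.induct)
  case (1 x y zs)
  then have "x \<noteq> v" "y \<noteq> v" "x \<in> pverts H" "(x, y) \<in> parcs H \<union> parcs B"
    by (auto simp: parcs_glue)
  with jointD[OF assms] joint_unique[OF assms] cgraphD(3) have "y \<in> pverts H" by blast
  with 1 show ?case by auto
qed auto

text \<open>An arc of \<open>B\<close> with both ends in \<open>H\<close> would be a loop at
  \<open>v\<close>.\<close>

lemma larcs_within:
  assumes "joint H B v" "larcs xs \<subseteq> parcs (glue H B)" "set xs \<subseteq> pverts H"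
  shows "larcs xs \<subseteq> parcs H"
proof
  fix e assume e: "e \<in> larcs xs"
  with larcs_subset[of xs] assms(3) obtain a b where ab: "e = (a, b)" "a \<in> pverts H" "b \<in> pverts H"
    by blast
  show "e \<in> parcs H"
  proof (rule ccontr)
    assume "e \<notin> parcs H"
    with assms(2) e have "(a, b) \<in> parcs B" by (auto simp: ab parcs_glue)
    moreover from this have "a = v" "b = v"
      using jointD[OF assms(1)] joint_unique[OF assms(1)] cgraphD(3) ab by blast+
    ultimately show False using cgraphD(5)[OF jointD(2)[OF assms(1)]] by (auto simp: irrefl_def)
  qed
qed

text \<open>An excursion into \<open>B\<close> would have to leave and return through
  \<open>v\<close>, but a path visits \<open>v\<close> at most once.\<close>

lemma paths_glue_same:
  assumes at: "joint H B v" and u: "u \<in> pverts H" and w: "w \<in> pverts H"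
  shows "paths (parcs (glue H B)) u w = paths (parcs H) u w"
proof
  show "paths (parcs H) u w \<subseteq> paths (parcs (glue H B)) u w"
    by (rule paths_mono) (auto simp: parcs_glue)
  show "paths (parcs (glue H B)) u w \<subseteq> paths (parcs H) u w"
  proof
    fix xs assume "xs \<in> paths (parcs (glue H B)) u w"
    then have xs: "xs \<noteq> []" "hd xs = u" "last xs = w" "distinct xs"
      "larcs xs \<subseteq> parcs (glue H B)"
      by (auto simp: paths_def)
    have "set xs \<subseteq> pverts H"
    proof (cases "v \<in> set xs")
      case False
      then show ?thesis using larcs_side[OF at] xs u by blast
    next
      case True
      then obtain as bs where s: "xs = as @ v # bs" by (meson split_list)
      with xs have v: "v \<notin> set as" "v \<notin> set bs" by auto
      have "set as \<subseteq> pverts H"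
      proof (cases "as = []")
        case False
        with s xs have "larcs as \<subseteq> parcs (glue H B)" "hd as = u" by (auto simp: larcs_append)
        with False v u show ?thesis using larcs_side[OF at] by blast
      qed auto
      \<comment> \<open>The part behind \<open>v\<close> is read backwards, so that it starts at
        \<open>w\<close>, which is known to lie in \<open>H\<close>.\<close>
      moreover have "set bs \<subseteq> pverts H"
      proof (cases "bs = []")
        case False
        have "sym (parcs (glue H B))"
          using at by (auto simp: joint_def cgraph_def sym_def parcs_glue)
        moreover have "larcs bs \<subseteq> parcs (glue H B)"
          using s xs False by (auto simp: larcs_append_mid[of as v bs] larcs_Cons)
        ultimately have "larcs (rev bs) \<subseteq> parcs (glue H B)" "hd (rev bs) = w"
          using s xs False by (auto simp: larcs_rev hd_rev dest: symD)
        with False v w show ?thesis using larcs_side[OF at, of "rev bs"] by auto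
      qed auto
      ultimately show ?thesis using s jointD(3)[OF at] by auto
    qed
    with larcs_within[OF at xs(5)] xs show "xs \<in> paths (parcs H) u w" by (simp add: paths_def)
  qed
qed

lemma ngeo_glue_same:
  assumes "joint H B v" "u \<in> pverts H" "w \<in> pverts H"
  shows "ngeo (parcs (glue H B)) u w = ngeo (parcs H) u w"
  unfolding ngeo_def geos_def using paths_glue_same[OF assms] by simp

text \<open>The cut vertex \<open>v\<close> lies on every such path and splits it into a part in
  \<open>H\<close> and a part in \<open>B\<close>; \<open>tl\<close> removes the second copy of
  \<open>v\<close>.\<close>

lemma paths_glue_cross:
  assumes at: "joint H B v" and u: "u \<in> pverts H" and w: "w \<in> pverts B"
  shows "paths (parcs (glue H B)) u w = (\<lambda>(p, q). p @ tl q) ` (paths (parcs H) u v \<times> paths (parcs B) v w)"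
    (is "?L = ?f ` ?R")
proof (intro equalityI subsetI)
  fix xs assume xsL: "xs \<in> ?L"
  then have xs: "xs \<noteq> []" "hd xs = u" "last xs = w" "distinct xs" "larcs xs \<subseteq> parcs (glue H B)"
    by (auto simp: paths_def)
  have "v \<in> set xs"
  proof (rule ccontr)
    assume v: "v \<notin> set xs"
    with larcs_side[OF at] xs u have "set xs \<subseteq> pverts H" by blast
    with xs have "w \<in> pverts H" "w \<in> set xs" by auto
    with w joint_unique[OF at] v show False by blast
  qed
  then obtain as bs where s: "xs = as @ v # bs" by (meson split_list)
  have v: "v \<in> pverts H" "v \<in> pverts B" using jointD[OF at] by auto
  have "as @ [v] \<in> paths (parcs (glue H B)) u v"
    using xs s by (auto simp: paths_def larcs_append_mid[of as v bs] hd_append)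
  moreover have "v # bs \<in> paths (parcs (glue B H)) v w"
    using xs s by (auto simp: paths_def larcs_append_mid[of as v bs] hd_append glue_comm[of B H])
  ultimately have "(as @ [v], v # bs) \<in> ?R"
    using paths_glue_same[OF at u v(1)] paths_glue_same[OF at[unfolded joint_sym[of H]] v(2) w] by auto
  moreover have "xs = ?f (as @ [v], v # bs)" using s by simp
  ultimately show "xs \<in> ?f ` ?R" by (rule rev_image_eqI)
next
  fix xs assume "xs \<in> ?f ` ?R"
  then obtain p q where xs: "xs = p @ tl q" and p: "p \<in> paths (parcs H) u v" and q: "q \<in> paths (parcs B) v w"
    by auto
  have sp: "set p \<subseteq> pverts H" "set q \<subseteq> pverts B"
    using paths_in_field[OF p] paths_in_field[OF q] jointD[OF at] cgraphD(3) u by blast+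
  obtain p' where p': "p = p' @ [v]" using p by (cases p rule: rev_cases) (auto simp: paths_def)
  obtain q' where q': "q = v # q'" using q by (cases q) (auto simp: paths_def)
  have "set p \<inter> set q' = {}"
    using sp joint_unique[OF at] q q' by (fastforce simp: paths_def)
  then show "xs \<in> ?L"
    using xs p q p' q'
    by (auto simp: paths_def larcs_append_mid[of p' v q'] hd_append parcs_glue split: if_splits)
qed

text \<open>Lengths add up and the two parts vary independently, so a path is shortest iff both
  parts are. Concatenation is injective because \<open>v\<close> occurs only once in the
  result.\<close>

lemma ngeo_glue_cross:
  assumes at: "joint H B v" and u: "u \<in> pverts H" and w: "w \<in> pverts B"
  shows "ngeo (parcs (glue H B)) u w = ngeo (parcs H) u v * ngeo (parcs B) v w"
proof -
  let ?f = "\<lambda>(p, q). p @ tl q"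
  let ?P = "paths (parcs H) u v" and ?Q = "paths (parcs B) v w"
  note X = paths_glue_cross[OF assms]
  have len: "q \<noteq> []" if "q \<in> ?Q" for q
    using that by (auto simp: paths_def)
  have geo: "geos (parcs (glue H B)) u w = ?f ` (geos (parcs H) u v \<times> geos (parcs B) v w)"
  proof (intro equalityI subsetI)
    fix xs assume xs: "xs \<in> geos (parcs (glue H B)) u w"
    then obtain p q where pq: "xs = p @ tl q" "p \<in> ?P" "q \<in> ?Q"
      unfolding geos_def X by auto
    have min: "length (p @ tl q) \<le> length (p' @ tl q')" if "p' \<in> ?P" "q' \<in> ?Q" for p' q'
    proof -
      have "p' @ tl q' \<in> paths (parcs (glue H B)) u w" unfolding X using that by force
      with xs pq show ?thesis by (auto simp: geos_def)
    qed
    have "length p \<le> length p'" if "p' \<in> ?P" for p'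
      using min[OF that pq(3)] by simp
    moreover have "length q \<le> length q'" if "q' \<in> ?Q" for q'
      using min[OF pq(2) that] len[OF that] len[OF pq(3)] by (cases q; cases q') auto
    ultimately show "xs \<in> ?f ` (geos (parcs H) u v \<times> geos (parcs B) v w)"
      using pq by (force simp: geos_def)
  next
    fix xs assume "xs \<in> ?f ` (geos (parcs H) u v \<times> geos (parcs B) v w)"
    then obtain p q where pq: "xs = p @ tl q" "p \<in> geos (parcs H) u v" "q \<in> geos (parcs B) v w" by auto
    then have mem: "p \<in> ?P" "q \<in> ?Q" by (auto simp: geos_def)
    have "length xs \<le> length ys" if ys: "ys \<in> paths (parcs (glue H B)) u w" for ys
    proof -
      obtain p' q' where pq': "ys = p' @ tl q'" "p' \<in> ?P" "q' \<in> ?Q"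
        using ys unfolding X by auto
      with pq have "length p \<le> length p'" "length q \<le> length q'" by (auto simp: geos_def)
      with pq pq' show ?thesis by simp
    qed
    with pq mem show "xs \<in> geos (parcs (glue H B)) u w" unfolding geos_def X by force
  qed
  have "inj_on ?f (?P \<times> ?Q)"
  proof (rule inj_onI, clarify)
    fix p q p' q' assume a: "p \<in> ?P" "q \<in> ?Q" "p' \<in> ?P" "q' \<in> ?Q" and eq: "p @ tl q = p' @ tl q'"
    obtain p1 p2 where p: "p = p1 @ [v]" "p' = p2 @ [v]"
      using a by (cases p rule: rev_cases; cases p' rule: rev_cases) (auto simp: paths_def)
    obtain q1 q2 where q: "q = v # q1" "q' = v # q2"
      using a by (cases q; cases q') (auto simp: paths_def)
    have "v \<notin> set p1" "v \<notin> set q1" "v \<notin> set p2" "v \<notin> set q2"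
      using a p q by (auto simp: paths_def)
    moreover have "p1 @ v # q1 = p2 @ v # q2" using eq p q by simp
    ultimately have "p1 = p2 \<and> q1 = q2" by (simp add: append_Cons_eq_iff)
    then show "p = p' \<and> q = q'" using p q by simp
  qed
  then have "inj_on ?f (geos (parcs H) u v \<times> geos (parcs B) v w)"
    by (rule inj_on_subset) (auto simp: geos_def)
  then show ?thesis
    unfolding ngeo_def geo by (simp add: card_image card_cartesian_product)
qed

lemma cgraph_glue:
  assumes at: "joint H B v" shows "cgraph (glue H B)"
proof -
  note d = jointD[OF at]
  have conn: "(u, v) \<in> (parcs H \<union> parcs B)\<^sup>*" "(v, u) \<in> (parcs H \<union> parcs B)\<^sup>*"
    if u: "u \<in> pverts H \<union> pverts B" for u
  proof -
    have "(u, v) \<in> (parcs H)\<^sup>* \<or> (u, v) \<in> (parcs B)\<^sup>*" "(v, u) \<in> (parcs H)\<^sup>* \<or> (v, u) \<in> (parcs B)\<^sup>*"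
      using u cgraphD(6)[OF d(1)] cgraphD(6)[OF d(2)] d(3,4) by blast+
    then show "(u, v) \<in> (parcs H \<union> parcs B)\<^sup>*" "(v, u) \<in> (parcs H \<union> parcs B)\<^sup>*"
      by (simp_all only: in_rtrancl_UnI)
  qed
  show ?thesis
    unfolding cgraph_def pverts_glue parcs_glue
  proof (intro conjI ballI)
    fix x y assume "x \<in> pverts H \<union> pverts B" "y \<in> pverts H \<union> pverts B"
    then show "(x, y) \<in> (parcs H \<union> parcs B)\<^sup>*" using conn by (meson rtrancl_trans)
  qed (use d(1,2) in \<open>auto simp: sym_Un cgraph_def irrefl_def\<close>)
qed

section \<open>Vertex counts and sums of path counts under gluing\<close>

lemma cgraph_card_ge_1: "cgraph G \<Longrightarrow> 1 \<le> card (pverts G)"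
  unfolding cgraph_def by (metis One_nat_def Suc_leI card_gt_0_iff)

lemma card_glue:
  assumes at: "joint H B v"
  shows "card (pverts (glue H B)) + 1 = card (pverts H) + card (pverts B)"
proof -
  have "card (pverts H \<union> pverts B) + card (pverts H \<inter> pverts B) = card (pverts H) + card (pverts B)"
    using jointD[OF at] cgraphD(1) by (metis card_Un_Int)
  moreover have "pverts H \<inter> pverts B = {v}" using at by (simp add: joint_def)
  ultimately show ?thesis by simp
qed

text \<open>Both sums include the pairs \<open>(u, u)\<close>, each counted once.\<close>

definition gsum :: "'a pair_pre_digraph \<Rightarrow> 'a \<Rightarrow> int" where
  "gsum G u = (\<Sum>x\<in>pverts G. int (ngeo (parcs G) u x))"

definition gtotal :: "'a pair_pre_digraph \<Rightarrow> int" where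
  "gtotal G = (\<Sum>u\<in>pverts G. gsum G u)"

text \<open>Vertices of \<open>B\<close> other than \<open>v\<close> are reached through
  \<open>v\<close>, which multiplies their counts by those from \<open>u\<close> to
  \<open>v\<close>. The \<open>- 1\<close> removes \<open>v\<close>, already counted in
  \<open>H\<close>.\<close>

lemma gsum_glue:
  assumes at: "joint H B v" and u: "u \<in> pverts H"
  shows "gsum (glue H B) u = gsum H u + int (ngeo (parcs H) u v) * (gsum B v - 1)"
proof -
  note d = jointD[OF at]
  have fin: "finite (pverts H)" "finite (pverts B)" using d cgraphD(1) by auto
  have split: "pverts (glue H B) = pverts H \<union> (pverts B - {v})" "pverts H \<inter> (pverts B - {v}) = {}"
    using at by (auto simp: joint_def)
  have "gsum (glue H B) u = (\<Sum>x\<in>pverts H. int (ngeo (parcs (glue H B)) u x))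
      + (\<Sum>x\<in>pverts B - {v}. int (ngeo (parcs (glue H B)) u x))"
    unfolding gsum_def split(1) by (rule sum.union_disjoint) (use fin split in auto)
  also have "\<dots> = gsum H u + (\<Sum>x\<in>pverts B - {v}. int (ngeo (parcs H) u v) * int (ngeo (parcs B) v x))"
    unfolding gsum_def
    by (intro arg_cong2[where f = "(+)"] sum.cong)
      (simp_all add: ngeo_glue_same[OF at u] ngeo_glue_cross[OF at u])
  also have "(\<Sum>x\<in>pverts B - {v}. int (ngeo (parcs H) u v) * int (ngeo (parcs B) v x))
      = int (ngeo (parcs H) u v) * (gsum B v - 1)"
    unfolding gsum_def sum_distrib_left[symmetric] using fin d(4) by (simp add: sum_diff1)
  finally show ?thesis .
qed

lemma gsum_sum_to: "cgraph G \<Longrightarrow> gsum G u = (\<Sum>x\<in>pverts G. int (ngeo (parcs G) x u))"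
  unfolding gsum_def by (rule sum.cong[OF refl]) (simp add: ngeo_sym[OF cgraphD(4), of G u])

text \<open>The identity behind all exchanges. The product counts the pairs with one vertex on
  either side of \<open>v\<close>, in both orders; the \<open>- 1\<close> corrects for the pair
  \<open>(v, v)\<close>, which occurs in both totals.\<close>

lemma gtotal_glue:
  assumes at: "joint H B v"
  shows "gtotal (glue H B) = gtotal H + gtotal B - 1 + 2 * (gsum H v - 1) * (gsum B v - 1)"
proof -
  note d = jointD[OF at]
  have fin: "finite (pverts H)" "finite (pverts B)" using d cgraphD(1) by auto
  have split: "pverts (glue H B) = pverts H \<union> (pverts B - {v})" "pverts H \<inter> (pverts B - {v}) = {}"
    using at by (auto simp: joint_def)
  have "gtotal (glue H B) = (\<Sum>x\<in>pverts H. gsum (glue H B) x) + (\<Sum>x\<in>pverts B - {v}. gsum (glue H B) x)"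
    unfolding gtotal_def split(1) by (rule sum.union_disjoint) (use fin split in auto)
  also have "(\<Sum>x\<in>pverts H. gsum (glue H B) x) = gtotal H + gsum H v * (gsum B v - 1)"
    unfolding gtotal_def gsum_sum_to[OF d(1), of v] sum_distrib_right sum.distrib[symmetric]
    using gsum_glue[OF at] by simp
  also have "(\<Sum>x\<in>pverts B - {v}. gsum (glue H B) x)
     = (\<Sum>x\<in>pverts B - {v}. gsum B x + int (ngeo (parcs B) x v) * (gsum H v - 1))"
    by (rule sum.cong) (simp_all add: gsum_glue[OF at[unfolded joint_sym[of H]]] glue_comm[of H B])
  also have "\<dots> = gtotal B - gsum B v + (gsum B v - 1) * (gsum H v - 1)"
    unfolding gtotal_def sum.distrib sum_distrib_right[symmetric] gsum_sum_to[OF d(2), of v]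
    using fin d(4) gsum_sum_to[OF d(2), of v] by (simp add: sum_diff1)
  finally show ?thesis by (simp add: algebra_simps)
qed

lemma gsum_ge: assumes "cgraph G" "u \<in> pverts G" shows "int (card (pverts G)) \<le> gsum G u"
proof -
  have "(\<Sum>x\<in>pverts G. 1) \<le> gsum G u"
    unfolding gsum_def by (rule sum_mono) (use ngeo_pos[OF assms] in force)
  then show ?thesis by simp
qed

lemma gsum_ge_1: "cgraph G \<Longrightarrow> u \<in> pverts G \<Longrightarrow> 1 \<le> gsum G u"
  using gsum_ge[of G u] cgraph_card_ge_1[of G] by linarith

text \<open>Lets a multiple of \<open>ngeo\<close> be paid for by \<open>gsum\<close>, in
  \<open>three_branches_aux\<close> and in the last inequality of
  \<open>pendant_triangle_and_edge\<close>. The \<open>- 1\<close> serves the case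
  \<open>u = v\<close>; for distinct vertices the argument yields the bound
  \<open>2 * ngeo\<close>.\<close>

lemma gsum_ge_two_ngeo:
  assumes "cgraph G" "u \<in> pverts G" "v \<in> pverts G"
  shows "2 * int (ngeo (parcs G) u v) - 1 \<le> gsum G u"
proof (cases "u = v")
  case True
  then show ?thesis using gsum_ge_1[OF assms(1,2)] by simp
next
  case False
  let ?E = "parcs G" and ?V = "pverts G"
  note c = cgraphD[OF assms(1)]
  \<comment> \<open>Deleting the last vertex turns the geodesics to \<open>v\<close> into geodesics to other vertices.\<close>
  have butl: "butlast ` geos ?E u v \<subseteq> (\<Union>z\<in>?V - {v}. geos ?E u z)"
  proof clarify
    fix xs assume xs: "xs \<in> geos ?E u v"
    then obtain p where p: "xs = p @ [v]" by (cases xs rule: rev_cases) (auto simp: geos_def paths_def)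
    with xs False have pn: "p \<noteq> []" by (auto simp: geos_def paths_def)
    let ?z = "last p"
    have pz: "p \<in> paths ?E u ?z" and v: "v \<notin> set p" and zv: "(?z, v) \<in> ?E"
      using xs p pn by (auto simp: geos_def paths_def larcs_append)
    have "length p \<le> length q" if q: "q \<in> paths ?E u ?z" for q
    proof (cases "v \<in> set q")
      case True
      then obtain as bs where s: "q = as @ v # bs" by (meson split_list)
      with q have "as @ [v] \<in> paths ?E u v"
        by (auto simp: paths_def larcs_append_mid[of as v bs] hd_append)
      then have "length (p @ [v]) \<le> length (as @ [v])" using xs p by (auto simp: geos_def)
      then show ?thesis using s by simp
    next
      case False
      with q zv have "q @ [v] \<in> paths ?E u v" by (auto simp: paths_def larcs_append)
      then have "length (p @ [v]) \<le> length (q @ [v])" using xs p unfolding geos_def by blast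
      then show ?thesis by simp
    qed
    then have "p \<in> geos ?E u ?z" using pz by (auto simp: geos_def)
    moreover have "?z \<in> ?V - {v}" using v pn zv c(3) by auto
    ultimately show "butlast xs \<in> (\<Union>z\<in>?V - {v}. geos ?E u z)" using p by auto
  qed
  have fin: "finite (geos ?E u z)" for z by (rule finite_geos[OF c(1) c(3) assms(2)])
  have "inj_on butlast (geos ?E u v)"
  proof (rule inj_onI)
    fix xs ys assume "xs \<in> geos ?E u v" "ys \<in> geos ?E u v" "butlast xs = butlast ys"
    moreover from this have "xs \<noteq> []" "ys \<noteq> []" "last xs = last ys" by (auto simp: geos_def paths_def)
    ultimately show "xs = ys" by (metis append_butlast_last_id)
  qed
  then have "ngeo ?E u v = card (butlast ` geos ?E u v)" by (simp add: ngeo_def card_image)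
  also have "\<dots> \<le> card (\<Union>z\<in>?V - {v}. geos ?E u z)"
    by (rule card_mono[OF _ butl]) (use c(1) fin in simp)
  also have "\<dots> \<le> (\<Sum>z\<in>?V - {v}. ngeo ?E u z)"
    unfolding ngeo_def by (rule card_UN_le) (use c(1) in simp)
  finally have "int (ngeo ?E u v) \<le> (\<Sum>z\<in>?V - {v}. int (ngeo ?E u z))"
    by (metis of_nat_le_iff of_nat_sum)
  moreover have "gsum G u = int (ngeo ?E u v) + (\<Sum>z\<in>?V - {v}. int (ngeo ?E u z))"
    unfolding gsum_def by (rule sum.remove[OF c(1) assms(3)])
  ultimately show ?thesis by linarith
qed

subsection \<open>Paths as arc lists and as vertex lists\<close>

fun arcwalk :: "'a list \<Rightarrow> ('a \<times> 'a) list" where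
  "arcwalk (x # y # zs) = (x, y) # arcwalk (y # zs)"
| "arcwalk _ = []"

lemma set_arcwalk: "set (arcwalk xs) = larcs xs"
  by (induct xs rule: arcwalk.induct) auto

lemma length_arcwalk: "length (arcwalk xs) = length xs - 1"
  by (induct xs rule: arcwalk.induct) auto

lemma pcas_arcwalk: "xs \<noteq> [] \<Longrightarrow> pcas (hd xs) (arcwalk xs) (last xs)"
  by (induct xs rule: arcwalk.induct) auto

lemma pawalk_verts_arcwalk: "xs \<noteq> [] \<Longrightarrow> pawalk_verts (hd xs) (arcwalk xs) = xs"
  by (induct xs rule: arcwalk.induct) auto

lemma pawalk_verts_ne [simp]: "pawalk_verts u p \<noteq> []"
  by (cases p) auto

lemma hd_pawalk_verts: "pcas u p v \<Longrightarrow> hd (pawalk_verts u p) = u"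
  by (cases p) auto

lemma last_pawalk_verts: "pcas u p v \<Longrightarrow> last (pawalk_verts u p) = v"
  by (induct p arbitrary: u) auto

lemma arcwalk_pawalk_verts: "pcas u p v \<Longrightarrow> arcwalk (pawalk_verts u p) = p"
proof (induct p arbitrary: u)
  case (Cons e p)
  then have "pcas (snd e) p v" "fst e = u" by auto
  moreover obtain y zs where y: "pawalk_verts (snd e) p = y # zs"
    by (cases "pawalk_verts (snd e) p") auto
  moreover from calculation have "y = snd e" using hd_pawalk_verts[of "snd e" p v] by simp
  ultimately show ?case using Cons(1)[of "snd e"] by (cases e) auto
qed simp

lemma length_pawalk_verts: "length (pawalk_verts u p) = Suc (length p)"
  by (induct p arbitrary: u) auto

lemma apath_pair_iff:
  "pre_digraph.apath (with_proj G) u p v \<longleftrightarrow>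
     u \<in> pverts G \<and> set p \<subseteq> parcs G \<and> pcas u p v \<and> distinct (pawalk_verts u p)"
  by (simp add: pre_digraph.apath_def pre_digraph.awalk_def cas_with_proj_eq
      awalk_verts_with_proj_eq)

lemma apath_paths:
  assumes "u \<in> pverts G"
  shows "pre_digraph.apath (with_proj G) u p v \<longleftrightarrow> (\<exists>xs\<in>paths (parcs G) u v. p = arcwalk xs)"
proof
  assume a: "pre_digraph.apath (with_proj G) u p v"
  let ?xs = "pawalk_verts u p"
  have "arcwalk ?xs = p" using a arcwalk_pawalk_verts by (auto simp: apath_pair_iff)
  moreover from this have "?xs \<in> paths (parcs G) u v"
    using a hd_pawalk_verts[of u p v] last_pawalk_verts[of u p v] set_arcwalk[of ?xs]
    by (auto simp: apath_pair_iff paths_def)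
  ultimately show "\<exists>xs\<in>paths (parcs G) u v. p = arcwalk xs" by metis
next
  assume "\<exists>xs\<in>paths (parcs G) u v. p = arcwalk xs"
  then obtain xs where xs: "xs \<noteq> []" "hd xs = u" "last xs = v" "distinct xs" "larcs xs \<subseteq> parcs G"
    "p = arcwalk xs"
    by (auto simp: paths_def)
  then show "pre_digraph.apath (with_proj G) u p v"
    using assms pcas_arcwalk[OF xs(1)] pawalk_verts_arcwalk[OF xs(1)]
    by (simp add: apath_pair_iff set_arcwalk)
qed

text \<open>Once the start is fixed, \<open>arcwalk\<close> loses no information, and it shortens
  every path by exactly one, so minimality carries over.\<close>

lemma gpn_pair_ngeo:
  assumes "u \<in> pverts G" shows "gpn_pair G u v = ngeo (parcs G) u v"
proof -
  let ?P = "paths (parcs G) u v"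
  have len: "length xs = Suc (length (arcwalk xs))" if "xs \<in> ?P" for xs
    using that by (auto simp: length_arcwalk paths_def)
  have "{p. geodesic G u p v} = arcwalk ` geos (parcs G) u v"
  proof (intro equalityI subsetI)
    fix p assume "p \<in> {p. geodesic G u p v}"
    then have p: "pre_digraph.apath (with_proj G) u p v"
      "\<And>q. pre_digraph.apath (with_proj G) u q v \<Longrightarrow> length p \<le> length q"
      by (auto simp: geodesic_def)
    from p(1) obtain xs where xs: "xs \<in> ?P" "p = arcwalk xs" unfolding apath_paths[OF assms] by blast
    have "length xs \<le> length ys" if "ys \<in> ?P" for ys
      using p(2)[of "arcwalk ys"] that len[OF that] len[OF xs(1)] xs
      unfolding apath_paths[OF assms] by auto
    with xs show "p \<in> arcwalk ` geos (parcs G) u v" by (auto simp: geos_def)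
  next
    fix p assume "p \<in> arcwalk ` geos (parcs G) u v"
    then obtain xs where xs: "xs \<in> ?P" "p = arcwalk xs" "\<And>ys. ys \<in> ?P \<Longrightarrow> length xs \<le> length ys"
      by (auto simp: geos_def)
    have "length p \<le> length q" if q: "pre_digraph.apath (with_proj G) u q v" for q
    proof -
      obtain ys where ys: "ys \<in> ?P" "q = arcwalk ys" using q unfolding apath_paths[OF assms] by blast
      from xs(3)[OF ys(1)] len[OF xs(1)] len[OF ys(1)] show ?thesis by (simp add: xs(2) ys(2))
    qed
    moreover have "pre_digraph.apath (with_proj G) u p v"
      unfolding apath_paths[OF assms] using xs(1,2) by blast
    ultimately show "p \<in> {p. geodesic G u p v}" by (simp add: geodesic_def)
  qed
  moreover have "inj_on arcwalk (geos (parcs G) u v)"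
  proof (rule inj_onI)
    fix xs ys assume a: "xs \<in> geos (parcs G) u v" "ys \<in> geos (parcs G) u v" "arcwalk xs = arcwalk ys"
    then have "xs \<noteq> []" "hd xs = u" "ys \<noteq> []" "hd ys = u" by (auto simp: geos_def paths_def)
    then show "xs = ys" using pawalk_verts_arcwalk[of xs] pawalk_verts_arcwalk[of ys] a(3) by simp
  qed
  ultimately show ?thesis by (simp add: gpn_pair_def ngeo_def card_image)
qed

lemma symcl_sym: "sym E \<Longrightarrow> symcl E = E"
  by (auto simp: symcl_def sym_def)

lemma rtrancl_on_eq:
  assumes "E \<subseteq> V \<times> V" "u \<in> V"
  shows "(u, v) \<in> rtrancl_on V E \<longleftrightarrow> (u, v) \<in> E\<^sup>*"
proof
  assume "(u, v) \<in> rtrancl_on V E"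
  then show "(u, v) \<in> E\<^sup>*" by induct auto
next
  assume "(u, v) \<in> E\<^sup>*"
  then show "(u, v) \<in> rtrancl_on V E"
  proof induct
    case (step y z)
    then show ?case using assms by (auto intro: rtrancl_on_into_rtrancl_on)
  qed (use assms in auto)
qed

lemma pair_graph_iff:
  "pair_graph G \<longleftrightarrow> finite (pverts G) \<and> parcs G \<subseteq> pverts G \<times> pverts G \<and>
     sym (parcs G) \<and> irrefl (parcs G)"
proof
  assume "pair_graph G"
  then interpret pair_graph G .
  have "sym (parcs G)" using pair_sym_arcs by (simp add: symmetric_def)
  moreover have "irrefl (parcs G)" using pair_no_loops by (fastforce simp: irrefl_def)
  moreover have "parcs G \<subseteq> pverts G \<times> pverts G" using in_arcsD1 in_arcsD2 by auto
  ultimately show "finite (pverts G) \<and> parcs G \<subseteq> pverts G \<times> pverts G \<and>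
     sym (parcs G) \<and> irrefl (parcs G)" using pair_finite_verts by blast
next
  assume a: "finite (pverts G) \<and> parcs G \<subseteq> pverts G \<times> pverts G \<and>
     sym (parcs G) \<and> irrefl (parcs G)"
  then have "finite (parcs G)" using finite_subset by blast
  with a show "pair_graph G"
    by unfold_locales (auto simp: symmetric_def irrefl_def)
qed

lemma cgraph_iff: "cgraph G \<longleftrightarrow> pair_graph G \<and> connected (with_proj G)"
proof -
  have "connected (with_proj G) \<longleftrightarrow> pverts G \<noteq> {} \<and>
      (\<forall>u\<in>pverts G. \<forall>v\<in>pverts G. (u, v) \<in> (parcs G)\<^sup>*)" if "pair_graph G"
    using that rtrancl_on_eq[of "parcs G" "pverts G"]
    by (auto simp: connected_conv pair_graph_iff symcl_sym)
  then show ?thesis unfolding cgraph_def pair_graph_iff by blast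
qed

subsection \<open>Cycles as vertex lists\<close>

definition cyc :: "'a rel \<Rightarrow> 'a list \<Rightarrow> bool" where
  "cyc E xs \<longleftrightarrow> 3 \<le> length xs \<and> distinct xs \<and> larcs xs \<subseteq> E \<and> (last xs, hd xs) \<in> E"

text \<open>The list does not repeat its first vertex, so the closing arc is added separately.
  Taking the symmetric closure makes rotation and reversal of the list irrelevant.\<close>

definition carcs :: "'a list \<Rightarrow> 'a rel" where
  "carcs xs = symcl (insert (last xs, hd xs) (larcs xs))"

lemma cycle_pair_iff:
  "pre_digraph.cycle (with_proj G) p \<longleftrightarrow>
     (\<exists>u. u \<in> pverts G \<and> set p \<subseteq> parcs G \<and> pcas u p u \<and> distinct (tl (pawalk_verts u p)) \<and> p \<noteq> [])"
  by (simp add: pre_digraph.cycle_def pre_digraph.awalk_def cas_with_proj_eq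
      awalk_verts_with_proj_eq)

text \<open>The vertex list of a closed arc walk ends with a second copy of its start. Removing this
  copy gives a list for \<open>cyc\<close>; appending it leads back.\<close>

lemma cycles_conv:
  assumes "parcs G \<subseteq> pverts G \<times> pverts G"
  shows "cycles G = carcs ` {xs. cyc (parcs G) xs}"
proof (intro equalityI subsetI)
  fix C assume "C \<in> cycles G"
  then obtain p u where C: "C = symcl (set p)" "3 \<le> length p" and p: "set p \<subseteq> parcs G" "pcas u p u"
    "distinct (tl (pawalk_verts u p))"
    unfolding cycles_def cycle_pair_iff by blast
  let ?vs = "pawalk_verts u p" and ?xs = "butlast (pawalk_verts u p)"
  have vs: "?vs = ?xs @ [u]"
    using last_pawalk_verts[OF p(2)] append_butlast_last_id[of ?vs] by simp
  have len: "length ?xs = length p" by (simp add: length_pawalk_verts)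
  then have ne: "?xs \<noteq> []" using C(2) by (metis list.size(3) not_numeral_le_zero)
  have hd: "hd ?xs = u" using vs ne hd_pawalk_verts[OF p(2)] by (metis hd_append2)
  have "set p = larcs ?vs" using arcwalk_pawalk_verts[OF p(2)] set_arcwalk by metis
  also have "\<dots> = insert (last ?xs, u) (larcs ?xs)" using vs ne larcs_append[of ?xs "[u]"] by simp
  finally have sp: "set p = insert (last ?xs, hd ?xs) (larcs ?xs)" using hd by simp
  have "tl ?vs = tl ?xs @ [u]" using vs ne by (metis tl_append2)
  then have "distinct (u # tl ?xs)" using p(3) by simp
  moreover have "u # tl ?xs = ?xs" using ne hd by (metis list.collapse)
  ultimately have "distinct ?xs" by simp
  then have "cyc (parcs G) ?xs" using sp p(1) len C(2) by (auto simp: cyc_def)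
  moreover have "C = carcs ?xs" using sp C(1) by (simp add: carcs_def)
  ultimately show "C \<in> carcs ` {xs. cyc (parcs G) xs}" by blast
next
  fix C assume "C \<in> carcs ` {xs. cyc (parcs G) xs}"
  then obtain xs where xs: "C = carcs xs" "3 \<le> length xs" "distinct xs" "larcs xs \<subseteq> parcs G"
    "(last xs, hd xs) \<in> parcs G"
    by (auto simp: cyc_def)
  then have ne: "xs \<noteq> []" by auto
  let ?vs = "xs @ [hd xs]" and ?p = "arcwalk (xs @ [hd xs])"
  have sp: "set ?p = insert (last xs, hd xs) (larcs xs)"
    using ne by (simp add: set_arcwalk larcs_append)
  have h: "hd ?vs = hd xs" "last ?vs = hd xs" using ne by auto
  have pv: "pawalk_verts (hd xs) ?p = ?vs" using pawalk_verts_arcwalk[of ?vs] h by simp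
  have "tl ?vs = tl xs @ [hd xs]" using ne by simp
  moreover have "distinct (tl xs @ [hd xs])" using xs(3) ne by (cases xs) auto
  ultimately have "distinct (tl (pawalk_verts (hd xs) ?p))" using pv by simp
  moreover have "pcas (hd xs) ?p (hd xs)" using pcas_arcwalk[of ?vs] h by simp
  moreover have "length ?p = length xs" by (simp add: length_arcwalk)
  moreover have "set ?p \<subseteq> parcs G" "hd xs \<in> pverts G" using sp xs assms by auto
  moreover have "?p \<noteq> []" using \<open>length ?p = length xs\<close> ne by auto
  ultimately have "pre_digraph.cycle (with_proj G) ?p" "3 \<le> length ?p"
    unfolding cycle_pair_iff using xs(2) by (metis, simp)
  moreover have "C = symcl (set ?p)" using sp xs(1) by (simp add: carcs_def)
  ultimately show "C \<in> cycles G" unfolding cycles_def by blast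
qed

lemma cycles_cyc: "cgraph G \<Longrightarrow> cyc (parcs G) xs \<Longrightarrow> carcs xs \<in> cycles G"
  by (simp add: cycles_conv cgraphD(3))

lemma cyclesE:
  assumes "cgraph G" "C \<in> cycles G"
  obtains xs where "cyc (parcs G) xs" "C = carcs xs"
  using assms by (auto simp: cycles_conv cgraphD(3))

lemma sym_carcs: "sym (carcs xs)"
  by (auto simp: carcs_def symcl_def sym_def)

lemma carcs_subset: "cyc E xs \<Longrightarrow> sym E \<Longrightarrow> carcs xs \<subseteq> E"
  by (auto simp: cyc_def carcs_def symcl_def sym_def)

lemma Field_carcs: assumes "2 \<le> length xs" shows "Field (carcs xs) = set xs"
proof -
  have "Field (larcs xs) = set xs"
    using assms
  proof (induct xs rule: larcs.induct)
    case (1 x y zs)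
    show ?case
    proof (cases zs)
      case Nil
      then show ?thesis by (auto simp: Field_def)
    next
      case (Cons z zs')
      then have "Field (larcs (y # zs)) = set (y # zs)" using 1 by simp
      then show ?thesis by (simp add: insert_commute)
    qed
  qed auto
  moreover have "last xs \<in> set xs" "hd xs \<in> set xs" using assms by (cases xs; simp)+
  moreover have "Field (symcl R) = Field R" for R :: "'a rel"
    by (auto simp: symcl_def Field_def)
  ultimately show ?thesis unfolding carcs_def by auto
qed

lemma cyc_lengthD: "cyc E xs \<Longrightarrow> Field (carcs xs) = set xs \<and> card (Field (carcs xs)) = length xs"
  by (auto simp: cyc_def Field_carcs distinct_card)

lemma cyclesD:
  assumes "cgraph G" "C \<in> cycles G"
  shows "C \<subseteq> parcs G" "sym C" "C \<noteq> {}" "3 \<le> card (Field C)" "Field C \<subseteq> pverts G"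
proof -
  obtain xs where xs: "cyc (parcs G) xs" "C = carcs xs" using assms by (rule cyclesE)
  then show 1: "C \<subseteq> parcs G" using carcs_subset cgraphD(4)[OF assms(1)] by blast
  show "sym C" using xs sym_carcs by blast
  show "C \<noteq> {}" using xs by (auto simp: carcs_def symcl_def)
  show "3 \<le> card (Field C)" using xs cyc_lengthD[OF xs(1)] by (auto simp: cyc_def)
  show "Field C \<subseteq> pverts G" using 1 cgraphD(3)[OF assms(1)] by (auto simp: Field_def)
qed

lemma carcs_rotate: "carcs (as @ b # bs) = carcs (b # bs @ as)"
  by (cases "as = []"; cases "bs = []") (auto simp: carcs_def symcl_def larcs_append larcs_Cons)

lemma cyc_rotate: "cyc E (as @ b # bs) \<Longrightarrow> cyc E (b # bs @ as)"
  by (cases "as = []"; cases "bs = []") (auto simp: cyc_def larcs_append larcs_Cons)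

lemma cyc_rotate_to:
  assumes "cyc E xs" "c \<in> set xs"
  obtains ys where "cyc E (c # ys)" "carcs (c # ys) = carcs xs"
proof -
  obtain as bs where "xs = as @ c # bs" using assms(2) by (meson split_list)
  then show ?thesis using that[of "bs @ as"] assms(1) cyc_rotate carcs_rotate by metis
qed

lemma finite_cycles: assumes "cgraph G" shows "finite (cycles G)"
proof (rule finite_subset)
  show "cycles G \<subseteq> Pow (parcs G)" using cyclesD(1)[OF assms] by blast
  have "finite (parcs G)" using cgraphD(1,3)[OF assms] finite_subset by blast
  then show "finite (Pow (parcs G))" by simp
qed

text \<open>A cycle through \<open>v\<close> is rotated to start there. What remains is a walk
  avoiding \<open>v\<close>, which by \<open>larcs_side\<close> stays on one side.\<close>

lemma cyc_side:
  assumes at: "joint H B v" and xs: "cyc (parcs (glue H B)) xs"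
  shows "set xs \<subseteq> pverts H \<or> set xs \<subseteq> pverts B"
proof -
  have side: "set ys \<subseteq> pverts H \<or> set ys \<subseteq> pverts B"
    if ys: "larcs ys \<subseteq> parcs (glue H B)" "ys \<noteq> []" "v \<notin> set ys" "hd ys \<in> pverts (glue H B)" for ys
    using larcs_side[OF at ys(1-3)] larcs_side[OF at[unfolded joint_sym[of H]], of ys] ys
    by (auto simp: glue_comm[of B H])
  have sub: "parcs (glue H B) \<subseteq> pverts (glue H B) \<times> pverts (glue H B)"
    using cgraphD(3)[OF cgraph_glue[OF at]] .
  show ?thesis
  proof (cases "v \<in> set xs")
    case False
    have "xs \<noteq> []" "hd xs \<in> pverts (glue H B)" using xs sub by (auto simp: cyc_def)
    then show ?thesis using side[of xs] xs False by (auto simp: cyc_def)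
  next
    case True
    then obtain ys where ys: "cyc (parcs (glue H B)) (v # ys)" "carcs (v # ys) = carcs xs"
      using cyc_rotate_to[OF xs] by metis
    have s: "set xs = set (v # ys)" using ys xs cyc_lengthD by metis
    have ne: "ys \<noteq> []" using ys(1) by (auto simp: cyc_def)
    then have "v \<notin> set ys" "larcs ys \<subseteq> parcs (glue H B)" "(v, hd ys) \<in> parcs (glue H B)"
      using ys(1) by (auto simp: cyc_def larcs_Cons)
    then have "set ys \<subseteq> pverts H \<or> set ys \<subseteq> pverts B" using side[of ys] sub ne by blast
    then show ?thesis using s jointD(3,4)[OF at] by auto
  qed
qed

lemma cyc_mono: "cyc E xs \<Longrightarrow> E \<subseteq> E' \<Longrightarrow> cyc E' xs"
  by (auto simp: cyc_def)

lemma cyc_within: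
  assumes at: "joint H B v" and xs: "cyc (parcs (glue H B)) xs" "set xs \<subseteq> pverts H"
  shows "cyc (parcs H) xs"
proof -
  have ne: "xs \<noteq> []" using xs by (auto simp: cyc_def)
  have "larcs [last xs, hd xs] \<subseteq> parcs (glue H B)" "set [last xs, hd xs] \<subseteq> pverts H"
    using xs ne by (auto simp: cyc_def)
  from larcs_within[OF at this] larcs_within[OF at _ xs(2)] xs(1) show ?thesis
    by (simp add: cyc_def)
qed

lemma cycles_glue: assumes at: "joint H B v" shows "cycles (glue H B) = cycles H \<union> cycles B"
proof -
  note c = cgraph_glue[OF at] jointD(1,2)[OF at]
  have "cyc (parcs (glue H B)) xs \<longleftrightarrow> cyc (parcs H) xs \<or> cyc (parcs B) xs" for xs
    using cyc_side[OF at, of xs] cyc_within[OF at, of xs] cyc_mono[of _ xs "parcs (glue H B)"]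
      cyc_within[OF at[unfolded joint_sym[of H]], of xs]
    by (auto simp: glue_comm[of B H] parcs_glue)
  then have "{xs. cyc (parcs (glue H B)) xs} = {xs. cyc (parcs H) xs} \<union> {xs. cyc (parcs B) xs}" by auto
  then show ?thesis
    unfolding cycles_conv[OF cgraphD(3)[OF c(1)]] cycles_conv[OF cgraphD(3)[OF c(2)]]
      cycles_conv[OF cgraphD(3)[OF c(3)]] by (simp only: image_Un)
qed

lemma parcs_disjoint: assumes at: "joint H B v" shows "parcs H \<inter> parcs B = {}"
proof -
  have "a = v \<and> b = v" if "(a, b) \<in> parcs H" "(a, b) \<in> parcs B" for a b
    using that cgraphD(3)[OF jointD(1)[OF at]] cgraphD(3)[OF jointD(2)[OF at]] joint_unique[OF at]
    by blast
  then show ?thesis using cgraphD(5)[OF jointD(1)[OF at]] by (auto simp: irrefl_def)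
qed

lemma cycles_disjoint: assumes at: "joint H B v" shows "cycles H \<inter> cycles B = {}"
proof -
  have "C = {}" if "C \<in> cycles H" "C \<in> cycles B" for C
    using cyclesD(1)[OF jointD(1)[OF at] that(1)] cyclesD(1)[OF jointD(2)[OF at] that(2)]
      parcs_disjoint[OF at] by auto
  then show ?thesis using cyclesD(3)[OF jointD(1)[OF at]] by auto
qed

section \<open>Invariants of a cactus and their behaviour under gluing\<close>

definition ncycles :: "'a pair_pre_digraph \<Rightarrow> nat" where
  "ncycles G = card (cycles G)"

definition nverts :: "'a pair_pre_digraph \<Rightarrow> nat" where
  "nverts G = card (pverts G)"

text \<open>In a cactus this is the number of bridges.\<close>

definition excess :: "'a pair_pre_digraph \<Rightarrow> int" where
  "excess G = int (nverts G) - 1 - (\<Sum>C\<in>cycles G. int (card (Field C)) - 1)"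

lemma nverts_glue: "joint H B v \<Longrightarrow> nverts (glue H B) + 1 = nverts H + nverts B"
  unfolding nverts_def by (rule card_glue)

lemma ncycles_glue: assumes at: "joint H B v" shows "ncycles (glue H B) = ncycles H + ncycles B"
  unfolding ncycles_def cycles_glue[OF at]
  using finite_cycles[OF jointD(1)[OF at]] finite_cycles[OF jointD(2)[OF at]] cycles_disjoint[OF at]
  by (rule card_Un_disjoint)

lemma excess_glue: assumes at: "joint H B v" shows "excess (glue H B) = excess H + excess B"
proof -
  have "(\<Sum>C\<in>cycles (glue H B). int (card (Field C)) - 1)
     = (\<Sum>C\<in>cycles H. int (card (Field C)) - 1) + (\<Sum>C\<in>cycles B. int (card (Field C)) - 1)"
    unfolding cycles_glue[OF at]
    using finite_cycles[OF jointD(1)[OF at]] finite_cycles[OF jointD(2)[OF at]] cycles_disjoint[OF at]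
    by (rule sum.union_disjoint)
  then show ?thesis using nverts_glue[OF at] unfolding excess_def by linarith
qed

lemma cactus_iff:
  "cactus G \<longleftrightarrow> cgraph G \<and> (\<forall>C\<in>cycles G. \<forall>C'\<in>cycles G. C \<noteq> C' \<longrightarrow> C \<inter> C' = {})"
  by (auto simp: cactus_def cgraph_iff)

lemma cactus_cgraph: "cactus G \<Longrightarrow> cgraph G"
  by (simp add: cactus_iff)

lemma cactus_glue:
  assumes at: "joint H B v"
  shows "cactus (glue H B) \<longleftrightarrow> cactus H \<and> cactus B"
proof -
  have "C \<inter> C' = {} \<and> C' \<inter> C = {}" if "C \<in> cycles H" "C' \<in> cycles B" for C C'
    using cyclesD(1)[OF jointD(1)[OF at] that(1)] cyclesD(1)[OF jointD(2)[OF at] that(2)]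
      parcs_disjoint[OF at] by auto
  then show ?thesis
    unfolding cactus_iff cycles_glue[OF at] ball_Un using cgraph_glue[OF at] jointD(1,2)[OF at]
    by meson
qed

subsection \<open>Relocating a branch\<close>

text \<open>Applied to involutions only: since \<open>f\<close> is its own inverse, each inclusion
  proved for \<open>f\<close> gives the converse one by applying \<open>f\<close> again.\<close>

definition rename_graph :: "('a \<Rightarrow> 'a) \<Rightarrow> 'a pair_pre_digraph \<Rightarrow> 'a pair_pre_digraph" where
  "rename_graph f G = \<lparr>pverts = f ` pverts G, parcs = map_prod f f ` parcs G\<rparr>"

lemma rename_graph_sel [simp]: "pverts (rename_graph f G) = f ` pverts G"
  by (simp add: rename_graph_def)

lemma parcs_rename_graph: "parcs (rename_graph f G) = map_prod f f ` parcs G"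
  by (simp add: rename_graph_def)

context
  fixes f :: "'a \<Rightarrow> 'a"
  assumes invol: "\<And>x. f (f x) = x"
begin

lemma invol_inj: "inj_on f A"
  using invol by (metis inj_onI)

lemma invol_image: "f ` f ` A = A" "map_prod f f ` map_prod f f ` E = E"
  by (simp_all add: image_image invol map_prod.compositionality comp_def)

lemma paths_rename_graph_sub: "xs \<in> paths E u v \<Longrightarrow> map f xs \<in> paths (map_prod f f ` E) (f u) (f v)"
  using invol_inj[of "set xs"]
  by (auto simp: paths_def larcs_map hd_map last_map distinct_map intro!: image_mono)

lemma paths_rename_graph: "paths (map_prod f f ` E) (f u) (f v) = map f ` paths E u v"
proof (intro equalityI subsetI)
  fix xs assume "xs \<in> paths (map_prod f f ` E) (f u) (f v)"
  from paths_rename_graph_sub[OF this] have "map f xs \<in> paths E u v" by (simp only: invol invol_image)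
  moreover have "xs = map f (map f xs)" by (simp add: comp_def invol)
  ultimately show "xs \<in> map f ` paths E u v" by blast
qed (use paths_rename_graph_sub in blast)

lemma ngeo_rename_graph: "ngeo (map_prod f f ` E) (f u) (f v) = ngeo E u v"
proof -
  have "geos (map_prod f f ` E) (f u) (f v) = map f ` geos E u v"
    unfolding geos_def paths_rename_graph by auto
  moreover have "inj_on (map f) (geos E u v)"
    using invol_inj[of UNIV] by (meson inj_mapI inj_on_subset subset_UNIV)
  ultimately show ?thesis by (simp add: ngeo_def card_image)
qed

lemma gsum_rename_graph: "gsum (rename_graph f G) (f u) = gsum G u"
proof -
  have "inj_on f (pverts G)" by (rule invol_inj)
  then show ?thesis unfolding gsum_def by (simp add: parcs_rename_graph sum.reindex ngeo_rename_graph)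
qed

lemma gtotal_rename_graph: "gtotal (rename_graph f G) = gtotal G"
proof -
  have "inj_on f (pverts G)" by (rule invol_inj)
  then show ?thesis unfolding gtotal_def by (simp add: sum.reindex gsum_rename_graph)
qed

lemma nverts_rename_graph: "nverts (rename_graph f G) = nverts G"
  unfolding nverts_def by (simp add: card_image invol_inj)

lemma rtrancl_rename_graph: "(u, v) \<in> E\<^sup>* \<Longrightarrow> (f u, f v) \<in> (map_prod f f ` E)\<^sup>*"
  by (induct rule: rtrancl_induct) (auto intro: rtrancl_into_rtrancl)

lemma cgraph_rename_graph: assumes "cgraph G" shows "cgraph (rename_graph f G)"
  unfolding cgraph_def parcs_rename_graph rename_graph_sel
proof (intro conjI)
  note c = cgraphD[OF assms]
  show "finite (f ` pverts G)" "f ` pverts G \<noteq> {}" using c(1,2) by auto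
  show "map_prod f f ` parcs G \<subseteq> f ` pverts G \<times> f ` pverts G" using c(3) by auto
  show "sym (map_prod f f ` parcs G)" using c(4) by (force simp: sym_def)
  show "irrefl (map_prod f f ` parcs G)" using c(5) invol by (auto simp: irrefl_def) metis
  show "\<forall>u\<in>f ` pverts G. \<forall>v\<in>f ` pverts G. (u, v) \<in> (map_prod f f ` parcs G)\<^sup>*"
    using c(6) rtrancl_rename_graph by blast
qed

lemma cyc_rename_graph_sub: "cyc E xs \<Longrightarrow> cyc (map_prod f f ` E) (map f xs)"
  using invol_inj[of "set xs"]
  by (cases "xs = []")
    (auto simp: cyc_def larcs_map hd_map last_map distinct_map intro!: image_mono)

lemma carcs_map: "xs \<noteq> [] \<Longrightarrow> carcs (map f xs) = map_prod f f ` carcs xs"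
  by (auto simp: carcs_def symcl_def larcs_map hd_map last_map image_Un image_image split_beta
      map_prod_def)

lemma cycles_rename_graph: assumes "cgraph G" shows "cycles (rename_graph f G) = (\<lambda>C. map_prod f f ` C) ` cycles G"
proof -
  have "{xs. cyc (map_prod f f ` parcs G) xs} = map f ` {xs. cyc (parcs G) xs}"
  proof (intro equalityI subsetI)
    fix xs assume "xs \<in> {xs. cyc (map_prod f f ` parcs G) xs}"
    then have "cyc (parcs G) (map f xs)" using cyc_rename_graph_sub invol_image(2) by fastforce
    moreover have "xs = map f (map f xs)" by (simp add: comp_def invol)
    ultimately show "xs \<in> map f ` {xs. cyc (parcs G) xs}" by blast
  qed (use cyc_rename_graph_sub in auto)
  moreover have "carcs (map f xs) = map_prod f f ` carcs xs" if "cyc (parcs G) xs" for xs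
  proof -
    have "xs \<noteq> []" using that by (auto simp: cyc_def)
    then show ?thesis by (rule carcs_map)
  qed
  ultimately have "carcs ` {xs. cyc (map_prod f f ` parcs G) xs}
     = (\<lambda>C. map_prod f f ` C) ` carcs ` {xs. cyc (parcs G) xs}"
    by (auto simp: image_image)
  then show ?thesis
    unfolding cycles_conv[OF cgraphD(3)[OF assms]]
      cycles_conv[OF cgraphD(3)[OF cgraph_rename_graph[OF assms]]] parcs_rename_graph .
qed

lemma inj_image_prod: "inj (\<lambda>C. map_prod f f ` C)"
  by (metis injI invol_image(2))

lemma ncycles_rename_graph: "cgraph G \<Longrightarrow> ncycles (rename_graph f G) = ncycles G"
  unfolding ncycles_def cycles_rename_graph by (meson card_image inj_image_prod inj_on_subset subset_UNIV)

lemma Field_rename_graph: "Field (map_prod f f ` C) = f ` Field C"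
  by (force simp: Field_def)

lemma excess_rename_graph: assumes "cgraph G" shows "excess (rename_graph f G) = excess G"
proof -
  have "card (Field (map_prod f f ` C)) = card (Field C)" for C
    unfolding Field_rename_graph by (simp add: card_image invol_inj)
  moreover have "inj_on (\<lambda>C. map_prod f f ` C) (cycles G)"
    using inj_image_prod by (rule inj_on_subset) simp
  ultimately show ?thesis unfolding excess_def nverts_rename_graph cycles_rename_graph[OF assms] by (simp add: sum.reindex)
qed

lemma cactus_rename_graph: assumes "cactus G" shows "cactus (rename_graph f G)"
  unfolding cactus_iff cycles_rename_graph[OF cactus_cgraph[OF assms]]
proof (intro conjI ballI impI)
  show "cgraph (rename_graph f G)" using assms cgraph_rename_graph by (simp add: cactus_iff)
  fix C C' assume "C \<in> (\<lambda>C. map_prod f f ` C) ` cycles G" "C' \<in> (\<lambda>C. map_prod f f ` C) ` cycles G"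
    "C \<noteq> C'"
  then obtain X Y where XY: "C = map_prod f f ` X" "C' = map_prod f f ` Y" "X \<in> cycles G" "Y \<in> cycles G"
    by (elim imageE)
  moreover have "X \<inter> Y = {}"
    using assms XY \<open>C \<noteq> C'\<close> by (simp add: cactus_iff) metis
  moreover have "inj (map_prod f f)" using invol_inj by (simp add: prod.inj_map)
  then have "map_prod f f ` X \<inter> map_prod f f ` Y = map_prod f f ` (X \<inter> Y)" for X Y
    by (simp add: image_Int)
  ultimately show "C \<inter> C' = {}" by simp
qed

end

text \<open>Only the attachment vertex is exchanged, all other vertices of the branch keep their
  names. As \<open>v\<close> and \<open>v'\<close> both lie in the graph that stays, the overall
  vertex set is the same before and after the move.\<close>

definition move :: "'a pair_pre_digraph \<Rightarrow> 'a \<Rightarrow> 'a \<Rightarrow> 'a pair_pre_digraph" where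
  "move B v v' = rename_graph (transpose v v') B"

lemma move_inv:
  assumes "cgraph B"
  shows "gsum (move B v v') v' = gsum B v" "gtotal (move B v v') = gtotal B" "nverts (move B v v') = nverts B"
    "ncycles (move B v v') = ncycles B" "excess (move B v v') = excess B" "cgraph (move B v v')"
    "cactus B \<Longrightarrow> cactus (move B v v')"
  using gsum_rename_graph[of "transpose v v'" B v] gtotal_rename_graph[of "transpose v v'" B] nverts_rename_graph[of "transpose v v'" B]
    ncycles_rename_graph[of "transpose v v'" B] excess_rename_graph[of "transpose v v'" B] cgraph_rename_graph[of "transpose v v'" B]
    cactus_rename_graph[of "transpose v v'" B] assms
  by (simp_all add: move_def)

lemma pverts_move:
  assumes "v \<in> pverts B" "v' \<in> pverts B \<Longrightarrow> v' = v"
  shows "pverts (move B v v') = insert v' (pverts B - {v})"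
proof -
  have "transpose v v' x = x" if "x \<in> pverts B - {v}" for x
    using that assms(2) by (auto simp: transpose_def)
  then have "transpose v v' ` (pverts B - {v}) = pverts B - {v}" by force
  moreover have "pverts B = insert v (pverts B - {v})" using assms(1) by blast
  ultimately show ?thesis
    unfolding move_def rename_graph_sel by (metis image_insert transpose_apply_first)
qed

lemma ngeo_move: "ngeo (parcs (move B v v')) v' (transpose v v' u) = ngeo (parcs B) v u"
  using ngeo_rename_graph[of "transpose v v'" "parcs B" v u] by (simp add: move_def parcs_rename_graph)

lemma pverts_move': "transpose v v' ` pverts B = pverts (move B v v')"
  by (simp add: move_def)

lemma joint_move_gen:
  assumes "cgraph H" "cgraph B" "v \<in> pverts B" "v' \<in> pverts H" "pverts H \<inter> pverts B \<subseteq> {v}"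
  shows "joint H (move B v v') v'"
proof -
  have "pverts (move B v v') = insert v' (pverts B - {v})"
    using assms by (intro pverts_move) auto
  then show ?thesis using assms move_inv(6)[OF assms(2), of v v'] by (auto simp: joint_def)
qed

lemma joint_move:
  assumes "joint H B v" "v' \<in> pverts H" shows "joint H (move B v v') v'"
  using assms by (intro joint_move_gen) (auto simp: joint_def)

text \<open>Formulated with \<open>gtotal\<close>, which by \<open>gpn_gtotal\<close> differs from
  twice \<open>gpn\<close> by the number of vertices only, so at fixed order both have the same
  maximisers.\<close>

definition optimal :: "'a pair_pre_digraph \<Rightarrow> bool" where
  "optimal G \<longleftrightarrow> cactus G \<and> (\<forall>N :: 'a pair_pre_digraph. cactus N \<longrightarrow> nverts N = nverts G \<longrightarrow> ncycles N = ncycles G \<longrightarrow> gtotal N \<le> gtotal G)"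

lemma opt_le:
  fixes G N :: "'a pair_pre_digraph"
  shows "optimal G \<Longrightarrow> cactus N \<Longrightarrow> nverts N = nverts G \<Longrightarrow> ncycles N = ncycles G \<Longrightarrow> gtotal N \<le> gtotal G"
  by (auto simp: optimal_def)

lemma opt_eq:
  fixes G N :: "'a pair_pre_digraph"
  shows "optimal G \<Longrightarrow> cactus N \<Longrightarrow> nverts N = nverts G \<Longrightarrow> ncycles N = ncycles G \<Longrightarrow> gtotal N = gtotal G \<Longrightarrow> optimal N"
  by (auto simp: optimal_def)

lemma opt_cactus: "optimal G \<Longrightarrow> cactus G"
  by (simp add: optimal_def)

text \<open>By \<open>gtotal_glue\<close> the move changes the total by
  \<open>2 * (gsum H v' - gsum H v) * (gsum B v - 1)\<close>. The last factor is positive as soon as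
  the branch is non-trivial, which gives the inequality; a vanishing first factor gives the
  tie.\<close>

lemma reloc:
  assumes opt: "optimal (glue H B)" and at: "joint H B v" and v': "v' \<in> pverts H"
  shows reloc_le: "2 \<le> nverts B \<Longrightarrow> gsum H v' \<le> gsum H v"
    and reloc_tie: "gsum H v' = gsum H v \<Longrightarrow> optimal (glue H (move B v v'))"
proof -
  let ?M = "move B v v'"
  note m = move_inv[OF jointD(2)[OF at], of v v'] and at' = joint_move[OF at v']
  have cH: "cactus H" "cactus B" using opt_cactus[OF opt] cactus_glue[OF at] by auto
  have N: "cactus (glue H ?M)" "nverts (glue H ?M) = nverts (glue H B)" "ncycles (glue H ?M) = ncycles (glue H B)"
    using cactus_glue[OF at'] cH m nverts_glue[OF at] nverts_glue[OF at'] ncycles_glue[OF at] ncycles_glue[OF at'] by auto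
  have diff: "gtotal (glue H ?M) - gtotal (glue H B) = 2 * ((gsum H v' - gsum H v) * (gsum B v - 1))"
    using gtotal_glue[OF at] gtotal_glue[OF at'] m(1,2) by (simp add: algebra_simps)
  show "gsum H v' = gsum H v \<Longrightarrow> optimal (glue H ?M)" using opt_eq[OF opt N] diff by simp
  show "gsum H v' \<le> gsum H v" if "2 \<le> nverts B"
  proof (rule ccontr)
    assume "\<not> ?thesis"
    moreover have "2 \<le> gsum B v" using gsum_ge[OF jointD(2,4)[OF at]] that by (simp add: nverts_def)
    ultimately have "0 < (gsum H v' - gsum H v) * (gsum B v - 1)" by (intro mult_pos_pos) auto
    then show False using opt_le[OF opt N] diff by simp
  qed
qed

text \<open>When two branches move at once, the paths between them enter as an interaction term: the
  product of both weights, times the number of shortest paths between the two attachment vertices in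
  \<open>Q\<close>.\<close>

lemma reloc2:
  assumes opt: "optimal (glue (glue Q B) B')" and at: "joint Q B x" and at2: "joint (glue Q B) B' y"
    and y: "y \<in> pverts Q" and x': "x' \<in> pverts Q" and y': "y' \<in> pverts Q"
  shows "(gsum B x - 1) * gsum Q x' + (gsum B' y - 1) * gsum Q y'
      + (gsum B x - 1) * (gsum B' y - 1) * int (ngeo (parcs Q) y' x')
    \<le> (gsum B x - 1) * gsum Q x + (gsum B' y - 1) * gsum Q y
      + (gsum B x - 1) * (gsum B' y - 1) * int (ngeo (parcs Q) y x)"
proof -
  let ?M = "move B x x'" and ?M' = "move B' y y'"
  note m = move_inv[OF jointD(2)[OF at], of x x'] and m' = move_inv[OF jointD(2)[OF at2], of y y']
  have at': "joint Q ?M x'" by (rule joint_move[OF at x'])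
  have "pverts ?M = insert x' (pverts B - {x})"
    using at x' by (intro pverts_move) (auto simp: joint_def)
  then have at2': "joint (glue Q ?M) ?M' y'"
    using at2 y y' x' cgraph_glue[OF at'] by (intro joint_move_gen) (auto simp: joint_def)
  have c: "cactus Q" "cactus B" "cactus B'"
    using opt_cactus[OF opt] cactus_glue[OF at] cactus_glue[OF at2] by auto
  let ?N = "glue (glue Q ?M) ?M'"
  have N: "cactus ?N" "nverts ?N = nverts (glue (glue Q B) B')" "ncycles ?N = ncycles (glue (glue Q B) B')"
    using cactus_glue[OF at'] cactus_glue[OF at2'] c m m' nverts_glue[OF at] nverts_glue[OF at'] nverts_glue[OF at2]
      nverts_glue[OF at2'] ncycles_glue[OF at] ncycles_glue[OF at'] ncycles_glue[OF at2] ncycles_glue[OF at2'] by auto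
  have "gtotal ?N \<le> gtotal (glue (glue Q B) B')" by (rule opt_le[OF opt N])
  moreover have "gtotal (glue (glue Q B) B') = gtotal Q + gtotal B - 1 + 2 * (gsum Q x - 1) * (gsum B x - 1) + gtotal B' - 1
      + 2 * (gsum Q y + int (ngeo (parcs Q) y x) * (gsum B x - 1) - 1) * (gsum B' y - 1)"
    using gtotal_glue[OF at2] gtotal_glue[OF at] gsum_glue[OF at y] by simp
  moreover have "gtotal ?N = gtotal Q + gtotal B - 1 + 2 * (gsum Q x' - 1) * (gsum B x - 1) + gtotal B' - 1
      + 2 * (gsum Q y' + int (ngeo (parcs Q) y' x') * (gsum B x - 1) - 1) * (gsum B' y - 1)"
    using gtotal_glue[OF at2'] gtotal_glue[OF at'] gsum_glue[OF at' y'] m(1,2) m'(1,2) by simp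
  ultimately show ?thesis by (simp add: algebra_simps)
qed

subsection \<open>A core with a branch at each of its vertices\<close>

text \<open>The parameter \<open>S\<close> names the core vertices whose branches are already
  present. It permits adding branches one by one and leaving out those that are to be
  relocated.\<close>

definition attach ::
  "'a pair_pre_digraph \<Rightarrow> ('a \<Rightarrow> 'a pair_pre_digraph) \<Rightarrow> 'a set \<Rightarrow> 'a pair_pre_digraph" where
  "attach K Bs S = \<lparr>pverts = pverts K \<union> (\<Union>c\<in>S. pverts (Bs c)), parcs = parcs K \<union> (\<Union>c\<in>S. parcs (Bs c))\<rparr>"

definition branching :: "'a pair_pre_digraph \<Rightarrow> ('a \<Rightarrow> 'a pair_pre_digraph) \<Rightarrow> bool" where
  "branching K Bs \<longleftrightarrow> cgraph K \<and> (\<forall>c\<in>pverts K. cgraph (Bs c) \<and> pverts (Bs c) \<inter> pverts K = {c}) \<and>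
     (\<forall>c\<in>pverts K. \<forall>d\<in>pverts K. c \<noteq> d \<longrightarrow> pverts (Bs c) \<inter> pverts (Bs d) = {})"

lemma attach_empty [simp]: "attach K Bs {} = K"
  by (simp add: attach_def)

lemma attach_insert: "attach K Bs (insert c S) = glue (attach K Bs S) (Bs c)"
  by (auto simp: attach_def glue_def)

lemma pverts_attach: "pverts (attach K Bs S) = pverts K \<union> (\<Union>c\<in>S. pverts (Bs c))"
  by (simp add: attach_def)

lemma branchingD:
  assumes "branching K Bs"
  shows "cgraph K" "\<And>c. c \<in> pverts K \<Longrightarrow> cgraph (Bs c)"
    "\<And>c. c \<in> pverts K \<Longrightarrow> pverts (Bs c) \<inter> pverts K = {c}"
    "\<And>c d. c \<in> pverts K \<Longrightarrow> d \<in> pverts K \<Longrightarrow> c \<noteq> d \<Longrightarrow> pverts (Bs c) \<inter> pverts (Bs d) = {}"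
  using assms by (simp_all add: branching_def)

lemma attach_meet:
  assumes "branching K Bs" "S \<subseteq> pverts K" "c \<in> pverts K" "c \<notin> S"
  shows "pverts (attach K Bs S) \<inter> pverts (Bs c) = {c}"
proof -
  have 1: "pverts (Bs c) \<inter> pverts K = {c}" by (rule branchingD(3)[OF assms(1,3)])
  have 2: "pverts (Bs d) \<inter> pverts (Bs c) = {}" if "d \<in> S" for d
    using branchingD(4)[OF assms(1) _ assms(3), of d] that assms(2,4) by blast
  show ?thesis unfolding pverts_attach using 1 2 by auto
qed

text \<open>Branches are disjoint and each meets the core once, so the next branch meets everything
  built so far in its own attachment vertex. Claims about \<open>attach\<close> thereby reduce to
  claims about a single \<open>glue\<close>.\<close>

lemma attach_induct [consumes 2, case_names empty insert]:
  assumes br: "branching K Bs" and S: "S \<subseteq> pverts K" and emp: "branching K Bs \<Longrightarrow> P {}"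
    and step: "\<And>c S. S \<subseteq> pverts K \<Longrightarrow> c \<in> pverts K \<Longrightarrow> c \<notin> S \<Longrightarrow> finite S \<Longrightarrow>
      joint (attach K Bs S) (Bs c) c \<Longrightarrow> P S \<Longrightarrow> branching K Bs \<Longrightarrow> P (insert c S)"
  shows "P S"
proof -
  have "finite S" using br S by (meson branching_def cgraphD(1) finite_subset)
  then have "P S \<and> cgraph (attach K Bs S)" using S
  proof (induct S)
    case empty
    then show ?case using emp[OF br] br by (simp add: branching_def)
  next
    case (insert c S)
    then have *: "S \<subseteq> pverts K" "c \<in> pverts K" "P S" "cgraph (attach K Bs S)" by auto
    have "joint (attach K Bs S) (Bs c) c"
      using attach_meet[OF br *(1,2) insert(2)] *(4) branchingD(2)[OF br *(2)] by (simp add: joint_def)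
    then show ?case using step[OF *(1,2) insert(2,1) _ *(3) br] cgraph_glue[of "attach K Bs S" "Bs c" c]
      unfolding attach_insert by blast
  qed
  then show ?thesis by simp
qed

lemma cgraph_attach: "branching K Bs \<Longrightarrow> S \<subseteq> pverts K \<Longrightarrow> cgraph (attach K Bs S)"
proof (induct rule: attach_induct)
  case empty then show ?case by (simp add: branching_def)
next
  case (insert c S) then show ?case unfolding attach_insert by (intro cgraph_glue)
qed

lemma joint_attach:
  assumes br: "branching K Bs" and "S \<subseteq> pverts K" "c \<in> pverts K" "c \<notin> S"
  shows "joint (attach K Bs S) (Bs c) c"
proof -
  show ?thesis using attach_meet[OF assms] cgraph_attach[OF assms(1,2)] branchingD(2)[OF assms(1,3)]
    by (simp add: joint_def)
qed

lemma ngeo_attach: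
  "branching K Bs \<Longrightarrow> S \<subseteq> pverts K \<Longrightarrow> x \<in> pverts K \<Longrightarrow> y \<in> pverts K \<Longrightarrow>
    ngeo (parcs (attach K Bs S)) x y = ngeo (parcs K) x y"
proof (induct rule: attach_induct)
  case empty then show ?case by simp
next
  case (insert c S)
  then show ?case unfolding attach_insert by (simp add: ngeo_glue_same pverts_attach)
qed

text \<open>Seen from the core, a branch is just a vertex weight; a vertex without a branch weighs
  1, as if it carried a one-vertex branch.\<close>

definition wt :: "('a \<Rightarrow> 'a pair_pre_digraph) \<Rightarrow> 'a set \<Rightarrow> 'a \<Rightarrow> int" where
  "wt Bs S d = (if d \<in> S then gsum (Bs d) d else 1)"

lemma gsum_attach:
  "branching K Bs \<Longrightarrow> S \<subseteq> pverts K \<Longrightarrow> x \<in> pverts K \<Longrightarrow>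
    gsum (attach K Bs S) x = (\<Sum>d\<in>pverts K. int (ngeo (parcs K) x d) * wt Bs S d)"
proof (induct rule: attach_induct)
  case empty then show ?case by (simp add: gsum_def wt_def)
next
  case (insert c S)
  have fin: "finite (pverts K)" using insert(7) by (simp add: branching_def cgraphD(1))
  have "gsum (attach K Bs (insert c S)) x
      = (\<Sum>d\<in>pverts K. int (ngeo (parcs K) x d) * wt Bs S d) + int (ngeo (parcs K) x c) * (gsum (Bs c) c - 1)"
    unfolding attach_insert using insert gsum_glue[OF insert(5), of x] ngeo_attach[of K Bs S x c]
    by (simp add: pverts_attach)
  also have "(\<Sum>d\<in>pverts K. int (ngeo (parcs K) x d) * wt Bs S d)
      = int (ngeo (parcs K) x c) + (\<Sum>d\<in>pverts K - {c}. int (ngeo (parcs K) x d) * wt Bs S d)"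
    using insert(2,3) fin by (simp add: sum.remove wt_def)
  also have "(\<Sum>d\<in>pverts K - {c}. int (ngeo (parcs K) x d) * wt Bs S d)
      = (\<Sum>d\<in>pverts K - {c}. int (ngeo (parcs K) x d) * wt Bs (insert c S) d)"
    by (rule sum.cong) (auto simp: wt_def)
  finally show ?case
    using insert(2) fin by (simp add: sum.remove[of "pverts K" c] wt_def[of _ "insert c S" c] algebra_simps)
qed

text \<open>A quadratic form in the weights. Its diagonal counts the pairs inside the branch at
  \<open>c\<close> as the square of its weight; the second sum replaces this by the true number.
  That correction depends on the branches only, so two cores carrying the same branches are compared
  by their quadratic forms alone.\<close>

lemma gtotal_attach:
  "branching K Bs \<Longrightarrow> S \<subseteq> pverts K \<Longrightarrow>
    gtotal (attach K Bs S) = (\<Sum>c\<in>pverts K. \<Sum>d\<in>pverts K. int (ngeo (parcs K) c d) * wt Bs S c * wt Bs S d)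
      + (\<Sum>c\<in>S. gtotal (Bs c) - (gsum (Bs c) c)\<^sup>2)"
proof (induct rule: attach_induct)
  case empty then show ?case by (simp add: gtotal_def gsum_def wt_def)
next
  case (insert c S)
  let ?V = "pverts K" and ?n = "\<lambda>x y. int (ngeo (parcs K) x y)" and ?b = "gsum (Bs c) c - 1"
  let ?w = "wt Bs S" and ?w' = "wt Bs (insert c S)"
  have K: "cgraph K" using insert(7) by (simp add: branching_def)
  then have fin: "finite ?V" by (rule cgraphD(1))
  let ?F = "\<lambda>x. \<Sum>d\<in>?V. ?n x d * ?w d"
  have w': "?w' d = ?w d + (if d = c then ?b else 0)" for d
    using insert(3) by (simp add: wt_def)
  have F': "(\<Sum>d\<in>?V. ?n x d * ?w' d) = ?F x + ?n x c * ?b" for x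
    unfolding w' using fin insert(2)
    by (simp add: algebra_simps sum.distrib if_distrib[of "\<lambda>z. _ * z"] sum.delta' cong: if_cong)
  have Q: "(\<Sum>x\<in>?V. \<Sum>d\<in>?V. ?n x d * w x * w d) = (\<Sum>x\<in>?V. w x * (\<Sum>d\<in>?V. ?n x d * w d))" for w
    by (simp add: sum_distrib_left algebra_simps)
  have s: "?n x y = ?n y x" for x y using ngeo_sym[OF cgraphD(4)[OF K]] by simp
  have wF: "(\<Sum>x\<in>?V. ?w x * ?n x c) = ?F c"
    by (rule sum.cong) (simp_all add: s[of _ c])
  have "(\<Sum>x\<in>?V. \<Sum>d\<in>?V. ?n x d * ?w' x * ?w' d) = (\<Sum>x\<in>?V. ?w' x * (?F x + ?n x c * ?b))"
    unfolding Q F' ..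
  also have "\<dots> = (\<Sum>x\<in>?V. ?w x * ?F x) + (\<Sum>x\<in>?V. ?w x * ?n x c) * ?b
      + (\<Sum>x\<in>?V. (if x = c then ?b else 0) * (?F x + ?n x c * ?b))"
    unfolding w' sum_distrib_right sum.distrib[symmetric]
    by (rule sum.cong) (simp_all add: algebra_simps)
  also have "(\<Sum>x\<in>?V. (if x = c then ?b else 0) * (?F x + ?n x c * ?b)) = ?b * (?F c + ?b)"
    using fin insert(2) by (simp add: if_distrib[of "\<lambda>z. z * _"] cong: if_cong)
  finally have "(\<Sum>x\<in>?V. \<Sum>d\<in>?V. ?n x d * ?w' x * ?w' d)
     = (\<Sum>x\<in>?V. \<Sum>d\<in>?V. ?n x d * ?w x * ?w d) + 2 * ?F c * ?b + ?b\<^sup>2"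
    unfolding wF Q[of ?w] by (simp add: algebra_simps power2_eq_square)
  moreover have "gtotal (attach K Bs (insert c S)) = gtotal (attach K Bs S) + gtotal (Bs c) - 1 + 2 * (?F c - 1) * ?b"
    unfolding attach_insert gtotal_glue[OF insert(5)] gsum_attach[OF insert(7,1,2)] ..
  moreover have "(\<Sum>x\<in>insert c S. gtotal (Bs x) - (gsum (Bs x) x)\<^sup>2)
      = (\<Sum>x\<in>S. gtotal (Bs x) - (gsum (Bs x) x)\<^sup>2) + gtotal (Bs c) - (gsum (Bs c) c)\<^sup>2"
    using insert(3,4) by simp
  ultimately show ?case using insert(6) by (simp add: algebra_simps power2_eq_square)
qed

lemma cycles_attach:
  "branching K Bs \<Longrightarrow> S \<subseteq> pverts K \<Longrightarrow> cycles (attach K Bs S) = cycles K \<union> (\<Union>c\<in>S. cycles (Bs c))"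
proof (induct rule: attach_induct)
  case (insert c S) then show ?case unfolding attach_insert by (simp add: cycles_glue Un_ac)
qed simp

lemma cactus_attach:
  "branching K Bs \<Longrightarrow> S \<subseteq> pverts K \<Longrightarrow>
    cactus (attach K Bs S) \<longleftrightarrow> cactus K \<and> (\<forall>c\<in>S. cactus (Bs c))"
proof (induct rule: attach_induct)
  case (insert c S) then show ?case unfolding attach_insert by (simp add: cactus_glue) blast
qed simp

lemma ncycles_attach:
  "branching K Bs \<Longrightarrow> S \<subseteq> pverts K \<Longrightarrow> ncycles (attach K Bs S) = ncycles K + (\<Sum>c\<in>S. ncycles (Bs c))"
proof (induct rule: attach_induct)
  case (insert c S) then show ?case unfolding attach_insert by (simp add: ncycles_glue)
qed simp

lemma branching_cong_core:
  "branching K Bs \<Longrightarrow> cgraph K' \<Longrightarrow> pverts K' = pverts K \<Longrightarrow> branching K' Bs"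
  by (simp add: branching_def)

subsection \<open>Decomposing a cactus at a block\<close>

definition core :: "'a rel \<Rightarrow> 'a pair_pre_digraph" where
  "core X = \<lparr>pverts = Field X, parcs = X\<rparr>"

text \<open>The connected component of \<open>c\<close> after deletion of the arcs \<open>X\<close>
  of a block.\<close>

definition branch :: "'a pair_pre_digraph \<Rightarrow> 'a rel \<Rightarrow> 'a \<Rightarrow> 'a pair_pre_digraph" where
  "branch G X c = \<lparr>pverts = {w. (c, w) \<in> (parcs G - X)\<^sup>*},
     parcs = (parcs G - X) \<inter> {w. (c, w) \<in> (parcs G - X)\<^sup>*} \<times> {w. (c, w) \<in> (parcs G - X)\<^sup>*}\<rparr>"

lemma core_sel [simp]: "pverts (core X) = Field X" "parcs (core X) = X"
  by (simp_all add: core_def)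

text \<open>By \<open>sep\<close> the components at different vertices of \<open>X\<close> are
  disjoint and meet \<open>X\<close> only once. They cover the graph, since a walk from
  \<open>X\<close> to any vertex stays, after its last arc in \<open>X\<close>, inside one
  component.\<close>

lemma attach_core_branch:
  assumes G: "cgraph G" and X: "X \<subseteq> parcs G" "sym X" "X \<noteq> {}"
    and conn: "\<And>c d. c \<in> Field X \<Longrightarrow> d \<in> Field X \<Longrightarrow> (c, d) \<in> X\<^sup>*"
    and sep: "\<And>c d. c \<in> Field X \<Longrightarrow> d \<in> Field X \<Longrightarrow> c \<noteq> d \<Longrightarrow> (c, d) \<notin> (parcs G - X)\<^sup>*"
  shows "branching (core X) (branch G X)" "attach (core X) (branch G X) (Field X) = G"
proof -
  note g = cgraphD[OF G]
  let ?R = "parcs G - X" and ?E = "parcs G"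
  let ?V = "\<lambda>c. {w. (c, w) \<in> ?R\<^sup>*}"
  have FX: "Field X \<subseteq> pverts G" using X(1) g(3) by (auto simp: Field_def)
  have symR: "sym ?R" using g(4) X(2) unfolding sym_def by blast
  then have symRs: "sym (?R\<^sup>*)" by (rule sym_rtrancl)
  have stepV: "w' \<in> ?V c" if "w \<in> ?V c" "(w, w') \<in> ?R" for c w w'
    using that by (auto intro: rtrancl_into_rtrancl)
  have disj: "?V c \<inter> ?V d = {}" if "c \<in> Field X" "d \<in> Field X" "c \<noteq> d" for c d
  proof (rule ccontr)
    assume "?V c \<inter> ?V d \<noteq> {}"
    then obtain w where "(c, w) \<in> ?R\<^sup>*" "(d, w) \<in> ?R\<^sup>*" by auto
    then have "(c, d) \<in> ?R\<^sup>*" using symRs by (meson rtrancl_trans symD)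
    with sep[OF that] show False by simp
  qed
  have Vsub: "w \<in> pverts G" if "c \<in> pverts G" "(c, w) \<in> ?R\<^sup>*" for c w
    using that(2,1) by (induct rule: rtrancl_induct) (use g(3) in auto)
  have sub: "(branch G X c) = \<lparr>pverts = ?V c, parcs = ?R \<inter> ?V c \<times> ?V c\<rparr>" for c
    by (simp add: branch_def)
  have walk: "(c, w) \<in> (?R \<inter> ?V c \<times> ?V c)\<^sup>*" if "(c, w) \<in> ?R\<^sup>*" for c w
    using that
  proof (induct rule: rtrancl_induct)
    case (step y z)
    then have "(y, z) \<in> ?R \<inter> ?V c \<times> ?V c" using stepV[of y c z] by auto
    with step(3) show ?case by (rule rtrancl_into_rtrancl)
  qed simp
  have symb: "sym (?R \<inter> ?V c \<times> ?V c)" for c using symR unfolding sym_def by blast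
  have branch_c: "cgraph (branch G X c)" if c: "c \<in> Field X" for c
    unfolding cgraph_def sub pair_pre_digraph.simps
  proof (intro conjI ballI)
    have "?V c \<subseteq> pverts G" using Vsub c FX by auto
    then show "finite (?V c)" using g(1) finite_subset by blast
    show "?V c \<noteq> {}" by auto
    show "sym (?R \<inter> ?V c \<times> ?V c)" by (rule symb)
    show "irrefl (?R \<inter> ?V c \<times> ?V c)" using g(5) by (auto simp: irrefl_def)
    fix u v assume "u \<in> ?V c" "v \<in> ?V c"
    then have "(c, u) \<in> (?R \<inter> ?V c \<times> ?V c)\<^sup>*" "(c, v) \<in> (?R \<inter> ?V c \<times> ?V c)\<^sup>*"
      using walk by auto
    then show "(u, v) \<in> (?R \<inter> ?V c \<times> ?V c)\<^sup>*"
      using sym_rtrancl[OF symb] by (meson rtrancl_trans symD)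
  qed auto
  have core: "cgraph (core X)"
    unfolding cgraph_def core_sel
  proof (intro conjI ballI)
    show "finite (Field X)" using FX g(1) finite_subset by blast
    show "Field X \<noteq> {}" using X(3) by (auto simp: Field_def)
    show "X \<subseteq> Field X \<times> Field X" by (auto simp: Field_def)
    show "irrefl X" using g(5) X(1) by (auto simp: irrefl_def)
  qed (use X conn in auto)
  have meet: "?V c \<inter> Field X = {c}" if c: "c \<in> Field X" for c
  proof -
    have "w = c" if "w \<in> Field X" "(c, w) \<in> ?R\<^sup>*" for w using sep[OF c that(1)] that(2) by metis
    then show ?thesis using c by auto
  qed
  show "branching (core X) (branch G X)"
    unfolding branching_def core_sel using core branch_c meet disj by (simp add: sub)
  have cover: "\<exists>c\<in>Field X. w \<in> ?V c" if w: "w \<in> pverts G" for w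
  proof -
    obtain c where c: "c \<in> Field X" using X(3) by (auto simp: Field_def)
    then have "(c, w) \<in> ?E\<^sup>*" using g(6) FX w by blast
    then show ?thesis
    proof (induct rule: rtrancl_induct)
      case base then show ?case using c by auto
    next
      case (step y z)
      show ?case
      proof (cases "(y, z) \<in> X")
        case True
        then have "z \<in> Field X" by (auto simp: Field_def)
        then show ?thesis by auto
      next
        case False
        then have "(y, z) \<in> ?R" using step(2) by simp
        then show ?thesis using step(3) stepV by blast
      qed
    qed
  qed
  have pv: "Field X \<union> (\<Union>c\<in>Field X. ?V c) = pverts G"
    using cover FX Vsub by blast
  have pa: "X \<union> (\<Union>c\<in>Field X. ?R \<inter> ?V c \<times> ?V c) = ?E"
  proof (intro equalityI subsetI)
    fix e assume e: "e \<in> ?E"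
    show "e \<in> X \<union> (\<Union>c\<in>Field X. ?R \<inter> ?V c \<times> ?V c)"
    proof (cases "e \<in> X")
      case False
      obtain a b where ab: "e = (a, b)" by (cases e)
      then obtain c where c: "c \<in> Field X" "a \<in> ?V c" using cover e g(3) by blast
      then have "b \<in> ?V c" using stepV False e ab by blast
      then show ?thesis using c False e ab by blast
    qed auto
  qed (use X(1) in auto)
  show "attach (core X) (branch G X) (Field X) = G"
    unfolding attach_def core_sel sub pair_pre_digraph.simps pv pa by simp
qed

lemma cyc_conn:
  assumes xs: "cyc E xs" and cd: "c \<in> set xs" "d \<in> set xs"
  shows "(c, d) \<in> (carcs xs)\<^sup>*"
proof -
  obtain ys where ys: "cyc E (c # ys)" "carcs (c # ys) = carcs xs"
    using cyc_rotate_to[OF xs cd(1)] by metis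
  then have "d \<in> set (c # ys)" using cyc_lengthD[OF xs] cyc_lengthD[OF ys(1)] cd by auto
  moreover have "larcs (c # ys) \<subseteq> carcs xs" using ys(2) by (auto simp: carcs_def symcl_def)
  ultimately show ?thesis using larcs_imp_rtrancl_mem by metis
qed

text \<open>A path outside \<open>C\<close> between two vertices of \<open>C\<close> would close up
  with a part of \<open>C\<close> to a second cycle that shares arcs with \<open>C\<close>.\<close>

lemma cycle_sep:
  assumes G: "cactus G" and C: "C \<in> cycles G" and cd: "c \<in> Field C" "d \<in> Field C" "c \<noteq> d"
  shows "(c, d) \<notin> (parcs G - C)\<^sup>*"
proof
  let ?R = "parcs G - C" and ?E = "parcs G"
  have cG: "cgraph G" using G by (rule cactus_cgraph)
  note g = cgraphD[OF cG]
  assume "(c, d) \<in> ?R\<^sup>*"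
  then have "paths ?R c d \<noteq> {}" by (rule rtrancl_imp_paths)
  then have ex: "\<exists>n. \<exists>p c d. length p = n \<and> c \<in> Field C \<and> d \<in> Field C \<and> c \<noteq> d \<and> p \<in> paths ?R c d"
    using cd by blast
  \<comment> \<open>A shortest such path meets the cycle in its end points only.\<close>
  define n where "n = (LEAST n. \<exists>p c d. length p = n \<and> c \<in> Field C \<and> d \<in> Field C \<and> c \<noteq> d \<and> p \<in> paths ?R c d)"
  obtain p c d where p: "length p = n" "c \<in> Field C" "d \<in> Field C" "c \<noteq> d" "p \<in> paths ?R c d"
    using LeastI_ex[OF ex] unfolding n_def by blast
  have min: "n \<le> length q" if "a \<in> Field C" "b \<in> Field C" "a \<noteq> b" "q \<in> paths ?R a b" for q a b
    unfolding n_def by (rule Least_le) (use that in blast)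
  from p(4,5) obtain m where m: "p = c # m @ [d]"
    by (cases p; cases "tl p" rule: rev_cases) (auto simp: paths_def split: if_splits)
  have pd: "distinct (c # m @ [d])" "larcs (c # m @ [d]) \<subseteq> ?R" using p(5) m by (auto simp: paths_def)
  have mC: "z \<notin> Field C" if zm: "z \<in> set m" for z
  proof
    assume z: "z \<in> Field C"
    obtain as bs where s: "m = as @ z # bs" using zm by (meson split_list)
    have "larcs (c # as @ [z]) \<subseteq> ?R"
      using pd(2) s larcs_append_mid[of "c # as" z "bs @ [d]"] by auto
    then have "c # as @ [z] \<in> paths ?R c z" using pd(1) s by (auto simp: paths_def)
    moreover have "c \<noteq> z" using pd(1) s by auto
    ultimately have "n \<le> length (c # as @ [z])" using min p(2) z by blast
    then show False using p(1) m s by simp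
  qed
  obtain xs where xs: "cyc ?E xs" "C = carcs xs" using cG C by (rule cyclesE)
  obtain ys where ys: "cyc ?E (c # ys)" "carcs (c # ys) = C"
    using cyc_rotate_to[OF xs(1)] cyc_lengthD[OF xs(1)] p(2) xs(2) by metis
  have FC: "Field C = set (c # ys)" using cyc_lengthD[OF ys(1)] ys(2) by simp
  then obtain as bs where ab: "ys = as @ d # bs" using p(3,4) by (metis set_ConsD split_list)
  \<comment> \<open>The second cycle follows \<open>C\<close> from \<open>c\<close> to
    \<open>d\<close> and returns through \<open>m\<close>. It differs from \<open>C\<close> by a
    vertex of \<open>m\<close>, or by the arc from \<open>d\<close> to \<open>c\<close> if
    \<open>m\<close> is empty.\<close>
  let ?a = "c # as @ [d]"
  let ?cs = "?a @ rev m"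
  have la: "larcs ?a \<subseteq> C"
    using larcs_append_mid[of "c # as" d bs] ys(2) ab by (auto simp: carcs_def symcl_def)
  have CE: "C \<subseteq> ?E" "sym C" using cyclesD[OF cG C] by auto
  have lm: "(c, d) \<in> ?R" if "m = []" using pd(2) that by simp
  have lm': "(c, hd m) \<in> ?R" "(last m, d) \<in> ?R" "larcs m \<subseteq> ?R" if "m \<noteq> []"
    using pd(2) that by (auto simp: larcs_append larcs_Cons)
  have "distinct ?cs"
    using ys(1) ab pd(1) mC FC by (auto simp: cyc_def)
  moreover have "3 \<le> length ?cs"
  proof (rule ccontr)
    assume "\<not> ?thesis"
    then have "as = []" "m = []" by (cases as; cases m; simp)+
    then have "(c, d) \<in> C" "(c, d) \<in> ?R" using la lm by auto
    then show False by simp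
  qed
  moreover have "larcs ?cs \<subseteq> ?E \<and> (last ?cs, hd ?cs) \<in> ?E"
  proof (cases "m = []")
    case True
    then have "(d, c) \<in> ?E" using lm symD[OF g(4), of c d] by simp
    then show ?thesis using True la CE(1) by auto
  next
    case False
    have "larcs ?cs = insert (d, last m) (larcs ?a \<union> (larcs m)\<inverse>)"
      using False larcs_append[of ?a "rev m"] by (simp add: larcs_rev hd_rev)
    moreover have "last ?cs = hd m" "hd ?cs = c" using False by (auto simp: last_rev)
    moreover have "(d, last m) \<in> ?E" "(hd m, c) \<in> ?E"
      using symD[OF g(4)] lm'(1,2)[OF False] by simp_all
    moreover have "(larcs m)\<inverse> \<subseteq> ?E"
    proof
      fix e assume "e \<in> (larcs m)\<inverse>"
      then show "e \<in> ?E" using lm'(3)[OF False] symD[OF g(4), of "snd e" "fst e"] by (cases e) auto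
    qed
    moreover have "larcs ?a \<subseteq> ?E" using la CE(1) by (rule subset_trans)
    ultimately show ?thesis by simp
  qed
  ultimately have cycD: "cyc ?E ?cs" by (simp add: cyc_def)
  have "carcs ?cs \<in> cycles G" by (rule cycles_cyc[OF cG cycD])
  moreover have "(c, hd (as @ [d])) \<in> carcs ?cs" "(c, hd (as @ [d])) \<in> C"
    using la by (cases as; auto simp: carcs_def symcl_def)+
  moreover have "carcs ?cs \<noteq> C"
  proof (cases "m = []")
    case True
    then have "(d, c) \<in> carcs ?cs" by (simp add: carcs_def symcl_def)
    moreover have "(d, c) \<notin> C" using lm[OF True] symD[OF CE(2), of d c] by blast
    ultimately show ?thesis by blast
  next
    case False
    then have "hd m \<in> Field (carcs ?cs)" using cyc_lengthD[OF cycD] by simp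
    then show ?thesis using mC[of "hd m"] False by auto
  qed
  ultimately show False using G C unfolding cactus_iff by (meson disjoint_iff)
qed

section \<open>Bridges, blocks and induction over blocks\<close>

definition edge :: "'a \<Rightarrow> 'a \<Rightarrow> 'a pair_pre_digraph" where
  "edge x y = \<lparr>pverts = {x, y}, parcs = {(x, y), (y, x)}\<rparr>"

text \<open>The blocks of a cactus: a bridge with its two ends, or a single cycle.\<close>

definition iscore :: "'a pair_pre_digraph \<Rightarrow> bool" where
  "iscore K \<longleftrightarrow> cactus K \<and>
     ((\<exists>x y. x \<noteq> y \<and> K = edge x y) \<or> (cycles K = {parcs K} \<and> pverts K = Field (parcs K)))"

lemma edge_sel [simp]: "pverts (edge x y) = {x, y}" "parcs (edge x y) = {(x, y), (y, x)}"
  by (simp_all add: edge_def)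

lemma cgraph_edge: "x \<noteq> y \<Longrightarrow> cgraph (edge x y)"
  by (auto simp: cgraph_def sym_def irrefl_def intro: r_into_rtrancl)

lemma cyc_card: assumes "cyc E xs" "E \<subseteq> V \<times> V" "finite V" shows "3 \<le> card V"
proof -
  have "set xs \<subseteq> V"
  proof -
    have "hd xs \<in> V" using assms by (auto simp: cyc_def)
    moreover have "xs \<in> paths E (hd xs) (last xs)" using assms(1) by (auto simp: cyc_def paths_def)
    ultimately show ?thesis using paths_in_field assms(2) by metis
  qed
  then have "card (set xs) \<le> card V" using assms(3) card_mono by blast
  then show ?thesis using assms(1) by (auto simp: cyc_def distinct_card)
qed

lemma cycles_small: assumes "cgraph G" "nverts G < 3" shows "cycles G = {}"
proof -
  have "\<not> cyc (parcs G) xs" for xs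
    using cyc_card[of "parcs G" xs "pverts G"] cgraphD(1,3)[OF assms(1)] assms(2)
    by (auto simp: nverts_def)
  then show ?thesis using cyclesE[OF assms(1)] by blast
qed

lemma edge_props:
  assumes "x \<noteq> y"
  shows "nverts (edge x y) = 2" "cycles (edge x y) = {}" "ncycles (edge x y) = 0" "cactus (edge x y)"
    "excess (edge x y) = 1" "iscore (edge x y)"
proof -
  show nverts: "nverts (edge x y) = 2" using assms by (simp add: nverts_def)
  show c: "cycles (edge x y) = {}" using cycles_small[OF cgraph_edge[OF assms]] nverts by simp
  then show "ncycles (edge x y) = 0" "excess (edge x y) = 1" using nverts by (simp_all add: ncycles_def excess_def)
  show ca: "cactus (edge x y)" using c cgraph_edge[OF assms] by (simp add: cactus_iff)
  then show "iscore (edge x y)" using assms by (auto simp: iscore_def)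
qed

lemma cycle_decomp:
  assumes G: "cactus G" and C: "C \<in> cycles G"
  obtains Bs where "branching (core C) Bs" "G = attach (core C) Bs (Field C)"
    "iscore (core C)" "cycles (core C) = {C}" "\<And>c. c \<in> Field C \<Longrightarrow> cactus (Bs c)"
proof -
  have cG: "cgraph G" using G by (rule cactus_cgraph)
  obtain xs where xs: "cyc (parcs G) xs" "C = carcs xs" using cG C by (rule cyclesE)
  have conn: "(c, d) \<in> C\<^sup>*" if "c \<in> Field C" "d \<in> Field C" for c d
    using cyc_conn[OF xs(1)] that xs cyc_lengthD by metis
  note A = attach_core_branch[OF cG cyclesD(1,2,3)[OF cG C] conn cycle_sep[OF G C]]
  have ca: "cactus G \<longleftrightarrow> cactus (core C) \<and> (\<forall>c\<in>Field C. cactus (branch G C c))"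
    using cactus_attach[OF A(1), of "Field C"] A(2) by simp
  have K: "cgraph (core C)" by (rule branchingD(1)[OF A(1)])
  have cyc: "cycles (core C) = {C}"
  proof (intro equalityI subsetI)
    fix Y assume Y: "Y \<in> cycles (core C)"
    then have "Y \<in> cycles G" using cycles_attach[OF A(1), of "Field C"] A(2) by simp
    moreover have "Y \<subseteq> C" "Y \<noteq> {}" using cyclesD[OF K Y] by auto
    ultimately show "Y \<in> {C}" using G C unfolding cactus_iff by (metis inf.absorb_iff1 singletonI)
  next
    have "cyc C xs" using xs by (auto simp: cyc_def carcs_def symcl_def)
    then show "Y \<in> cycles (core C)" if "Y \<in> {C}" for Y
      using that cycles_cyc[OF K, of xs] xs(2) by simp
  qed
  then have "iscore (core C)" using ca G by (simp add: iscore_def)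
  then show thesis using that[OF A(1) _ _ cyc] A(2) ca G by auto
qed

text \<open>A path from \<open>x\<close> to \<open>y\<close> avoiding the arc has at least three
  vertices, so the arc would close it to a cycle. An arc on no cycle therefore separates its
  ends.\<close>

lemma edge_decomp:
  assumes G: "cactus G" and xy: "(x, y) \<in> parcs G" and no: "\<And>C. C \<in> cycles G \<Longrightarrow> (x, y) \<notin> C"
  obtains Bs where "branching (edge x y) Bs" "G = attach (edge x y) Bs {x, y}"
    "x \<noteq> y" "\<And>c. c \<in> {x, y} \<Longrightarrow> cactus (Bs c)"
proof -
  have cG: "cgraph G" using G by (rule cactus_cgraph)
  note g = cgraphD[OF cG]
  let ?X = "{(x, y), (y, x)}"
  have ne: "x \<noteq> y" using g(5) xy by (auto simp: irrefl_def)
  have k: "core ?X = edge x y" "Field ?X = {x, y}" by (auto simp: core_def edge_def Field_def)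
  have no': "(x, y) \<notin> (parcs G - ?X)\<^sup>*"
  proof
    assume "(x, y) \<in> (parcs G - ?X)\<^sup>*"
    then obtain p where p: "p \<in> paths (parcs G - ?X) x y"
      using rtrancl_imp_paths by (metis ex_in_conv)
    have "length p \<noteq> 2"
    proof
      assume "length p = 2"
      then have "p = [x, y]" by (rule paths_length_two[OF ne p])
      then show False using p by (simp add: paths_def)
    qed
    then have "3 \<le> length p" using paths_two[OF ne p] by simp
    moreover have "(y, x) \<in> parcs G" using symD[OF g(4) xy] .
    ultimately have c: "cyc (parcs G) p" using p by (auto simp: cyc_def paths_def)
    have "(x, y) \<in> carcs p" using p by (auto simp: carcs_def symcl_def paths_def)
    then show False using no[OF cycles_cyc[OF cG c]] by simp
  qed
  moreover have "sym (parcs G - ?X)" using g(4) unfolding sym_def by blast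
  then have "sym ((parcs G - ?X)\<^sup>*)" by (rule sym_rtrancl)
  ultimately have "(y, x) \<notin> (parcs G - ?X)\<^sup>*" by (meson symD)
  then have sep: "(c, d) \<notin> (parcs G - ?X)\<^sup>*" if "c \<in> Field ?X" "d \<in> Field ?X" "c \<noteq> d" for c d
    using that no' unfolding k(2) by auto
  have conn: "(c, d) \<in> ?X\<^sup>*" if "c \<in> Field ?X" "d \<in> Field ?X" for c d
    using that unfolding k(2) by (auto intro: r_into_rtrancl)
  have X: "?X \<subseteq> parcs G" "sym ?X" "?X \<noteq> {}"
    using xy symD[OF g(4) xy] by (auto intro: symI)
  note A = attach_core_branch[OF cG X conn sep, unfolded k]
  show thesis
    using that[OF A(1) A(2)[symmetric] ne] cactus_attach[OF A(1), of "{x, y}"] A(2) G by auto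
qed

lemma block_decomp:
  assumes G: "cactus G" and xy: "(x, y) \<in> parcs G"
  obtains K Bs where "branching K Bs" "G = attach K Bs (pverts K)" "iscore K" "(x, y) \<in> parcs K"
    "\<And>c. c \<in> pverts K \<Longrightarrow> cactus (Bs c)"
    "parcs K \<in> cycles G \<or> (K = edge x y \<and> (\<forall>C\<in>cycles G. (x, y) \<notin> C))"
proof (cases "\<exists>C\<in>cycles G. (x, y) \<in> C")
  case True
  then obtain C where C: "C \<in> cycles G" "(x, y) \<in> C" by blast
  obtain Bs where "branching (core C) Bs" "G = attach (core C) Bs (Field C)"
    "iscore (core C)" "\<And>c. c \<in> Field C \<Longrightarrow> cactus (Bs c)"
    using cycle_decomp[OF G C(1)] by metis
  then show thesis using that[of "core C" Bs] C by simp
next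
  case False
  then obtain Bs where "branching (edge x y) Bs" "G = attach (edge x y) Bs {x, y}"
    "x \<noteq> y" "\<And>c. c \<in> {x, y} \<Longrightarrow> cactus (Bs c)"
    using edge_decomp[OF G xy] by metis
  then show thesis
    using that[of "edge x y" Bs] False edge_props(6)[of x y] by (metis insertCI edge_sel)
qed

lemma iscore_nverts: assumes "iscore K" shows "2 \<le> nverts K"
proof -
  have "3 \<le> nverts K" if "cycles K = {parcs K}" "pverts K = Field (parcs K)" "cgraph K"
    using cyclesD(4)[OF that(3), of "parcs K"] that by (simp add: nverts_def)
  then show ?thesis using assms edge_props(1) by (fastforce simp: iscore_def cactus_cgraph)
qed

lemma nverts_branch_less:
  assumes br: "branching K Bs" and K: "2 \<le> nverts K" and c: "c \<in> pverts K"
  shows "nverts (Bs c) < nverts (attach K Bs (pverts K))"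
proof -
  have "pverts (Bs c) \<subseteq> pverts (attach K Bs (pverts K))" using c by (auto simp: pverts_attach)
  moreover have "\<not> pverts K \<subseteq> pverts (Bs c)"
  proof
    assume "pverts K \<subseteq> pverts (Bs c)"
    then have "pverts K = {c}" using branchingD(3)[OF br c] by auto
    then show False using K by (simp add: nverts_def)
  qed
  then have "pverts (Bs c) \<noteq> pverts (attach K Bs (pverts K))" by (auto simp: pverts_attach)
  moreover have "finite (pverts (attach K Bs (pverts K)))"
    using cgraph_attach[OF br order_refl] by (rule cgraphD(1))
  ultimately show ?thesis unfolding nverts_def by (meson psubsetI psubset_card_mono)
qed

lemma cgraph_no_arcs: assumes "cgraph G" "parcs G = {}" shows "nverts G = 1"
proof -
  obtain v where v: "v \<in> pverts G" using cgraphD(2)[OF assms(1)] by auto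
  have "w = v" if "w \<in> pverts G" for w using cgraphD(6)[OF assms(1) v that] assms(2) by simp
  then have "pverts G = {v}" using v by blast
  then show ?thesis by (simp add: nverts_def)
qed

text \<open>Any block may serve as core. A block has at least two vertices and a branch contains
  just one of them, so all branches are smaller than the whole.\<close>

lemma cactus_induct [consumes 1, case_names single block]:
  assumes "cactus G"
    and "\<And>G. cactus G \<Longrightarrow> parcs G = {} \<Longrightarrow> nverts G = 1 \<Longrightarrow> P G"
    and "\<And>K Bs. branching K Bs \<Longrightarrow> iscore K \<Longrightarrow> cactus (attach K Bs (pverts K)) \<Longrightarrow>
      (\<And>c. c \<in> pverts K \<Longrightarrow> cactus (Bs c)) \<Longrightarrow> (\<And>c. c \<in> pverts K \<Longrightarrow> P (Bs c)) \<Longrightarrow>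
      P (attach K Bs (pverts K))"
  shows "P G"
  using assms(1)
proof (induct "nverts G" arbitrary: G rule: less_induct)
  case less
  show ?case
  proof (cases "parcs G = {}")
    case True
    then show ?thesis using assms(2)[OF less(2)] cgraph_no_arcs[OF cactus_cgraph[OF less(2)]] by simp
  next
    case False
    then obtain x y where "(x, y) \<in> parcs G" by auto
    then obtain K Bs where K: "branching K Bs" "G = attach K Bs (pverts K)" "iscore K"
      "\<And>c. c \<in> pverts K \<Longrightarrow> cactus (Bs c)"
      using block_decomp[OF less(2)] by metis
    have "P (Bs c)" if "c \<in> pverts K" for c
      using less(1)[OF _ K(4)[OF that]] nverts_branch_less[OF K(1) iscore_nverts[OF K(3)] that] K(2) by simp
    then show ?thesis using assms(3)[OF K(1,3)] K(2,4) less(2) by metis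
  qed
qed

lemma excess_attach:
  "branching K Bs \<Longrightarrow> S \<subseteq> pverts K \<Longrightarrow> excess (attach K Bs S) = excess K + (\<Sum>c\<in>S. excess (Bs c))"
proof (induct rule: attach_induct)
  case (insert c S) then show ?case unfolding attach_insert by (simp add: excess_glue)
qed simp

lemma excess_core: "iscore K \<Longrightarrow> 0 \<le> excess K \<and> (cycles K \<noteq> {} \<longrightarrow> excess K = 0)"
proof -
  assume K: "iscore K"
  show ?thesis
  proof (cases "\<exists>x y. x \<noteq> y \<and> K = edge x y")
    case True
    then show ?thesis using edge_props(2,5) by fastforce
  next
    case False
    then have "cycles K = {parcs K}" "pverts K = Field (parcs K)" using K by (auto simp: iscore_def)
    then show ?thesis by (simp add: excess_def nverts_def)
  qed
qed

lemma excess_nonneg: "cactus G \<Longrightarrow> 0 \<le> excess G"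
proof (induct rule: cactus_induct)
  case (single G)
  then show ?case using cycles_small[OF cactus_cgraph[OF single(1)]] by (simp add: excess_def)
next
  case (block K Bs)
  then show ?case unfolding excess_attach[OF block(1) order_refl]
    using excess_core[OF block(2)] sum_nonneg[of "pverts K" "\<lambda>c. excess (Bs c)"] by simp
qed

text \<open>Excess adds up over a core and its branches, and a cycle core has none. So a positive
  value comes from some branch, or the core is itself a bridge. Different pieces share at most one
  vertex, hence no cycle of another piece runs through the arc found.\<close>

lemma excess_pos_bridge:
  "cactus G \<Longrightarrow> 0 < excess G \<Longrightarrow> \<exists>x y. (x, y) \<in> parcs G \<and> (\<forall>C\<in>cycles G. (x, y) \<notin> C)"
proof (induct rule: cactus_induct)
  case (single G)
  then show ?case by (simp add: excess_def cycles_small[OF cactus_cgraph[OF single(1)]])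
next
  case (block K Bs)
  let ?G = "attach K Bs (pverts K)"
  have br: "branching K Bs" by fact
  have cyc: "cycles ?G = cycles K \<union> (\<Union>c\<in>pverts K. cycles (Bs c))"
    by (rule cycles_attach[OF br order_refl])
  have cK: "cgraph K" by (rule branchingD(1)[OF br])
  show ?case
  proof (cases "\<exists>c\<in>pverts K. 0 < excess (Bs c)")
    case True
    then obtain c where c: "c \<in> pverts K" "0 < excess (Bs c)" by blast
    from block(5)[OF this]
    obtain x y where xy: "(x, y) \<in> parcs (Bs c)" "\<And>C. C \<in> cycles (Bs c) \<Longrightarrow> (x, y) \<notin> C"
      by blast
    have cB: "cgraph (Bs d)" if "d \<in> pverts K" for d using branchingD(2)[OF br that] .
    have v: "x \<in> pverts (Bs c)" "y \<in> pverts (Bs c)" "x \<noteq> y"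
      using cgraphD(3,5)[OF cB[OF c(1)]] xy(1) by (auto simp: irrefl_def)
    have "(x, y) \<notin> C" if "C \<in> cycles K" for C
    proof
      assume "(x, y) \<in> C"
      then have "(x, y) \<in> parcs K" by (rule subsetD[OF cyclesD(1)[OF cK that]])
      then have "x \<in> pverts K" "y \<in> pverts K" using cgraphD(3)[OF cK] by auto
      with v(1,2) have "x \<in> {c}" "y \<in> {c}" unfolding branchingD(3)[OF br c(1), symmetric] by auto
      with v(3) show False by simp
    qed
    moreover have "(x, y) \<notin> C" if C: "C \<in> cycles (Bs d)" and d: "d \<in> pverts K" "d \<noteq> c" for C d
    proof
      assume "(x, y) \<in> C"
      then have "(x, y) \<in> parcs (Bs d)" by (rule subsetD[OF cyclesD(1)[OF cB[OF d(1)] C]])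
      then have "x \<in> pverts (Bs d)" using cgraphD(3)[OF cB[OF d(1)]] by auto
      with v(1) branchingD(4)[OF br c(1) d(1)] d(2) show False by auto
    qed
    moreover have "(x, y) \<in> parcs ?G" using xy(1) c(1) by (auto simp: attach_def)
    ultimately show ?thesis using xy(2) unfolding cyc by blast
  next
    case False
    then have "(\<Sum>c\<in>pverts K. excess (Bs c)) \<le> 0" by (intro sum_nonpos) auto
    then have "0 < excess K" using block(6) unfolding excess_attach[OF br order_refl] by linarith
    then have "cycles K = {}" using excess_core[OF block(2)] by auto
    then obtain x y where K: "x \<noteq> y" "K = edge x y" using block(2) by (auto simp: iscore_def)
    have "(x, y) \<notin> C" if "C \<in> cycles (Bs d)" and d: "d \<in> pverts K" for C d
      using cyclesD(1)[OF branchingD(2)[OF br d] that(1)] cgraphD(3)[OF branchingD(2)[OF br d]]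
        branchingD(3)[OF br d] K by auto
    then show ?thesis using K \<open>cycles K = {}\<close> unfolding cyc by (auto simp: attach_def)
  qed
qed

section \<open>Cacti without longer cycles than triangles have unique shortest paths\<close>

lemma triangle_core:
  assumes "iscore K" and "\<And>C. C \<in> cycles K \<Longrightarrow> card (Field C) = 3"
    and u: "u \<in> pverts K" and v: "v \<in> pverts K" and ne: "u \<noteq> v"
  shows "(u, v) \<in> parcs K"
proof (cases "\<exists>x y. x \<noteq> y \<and> K = edge x y")
  case True then show ?thesis using u v ne by auto
next
  case False
  then have c: "cycles K = {parcs K}" "pverts K = Field (parcs K)" "cgraph K"
    using assms(1) by (auto simp: iscore_def cactus_cgraph)
  obtain xs where xs: "cyc (parcs K) xs" "parcs K = carcs xs" using cyclesE[OF c(3)] c(1) by blast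
  have "length xs = 3"
    using cyc_lengthD[OF xs(1)] assms(2)[of "parcs K"] unfolding c(1) xs(2) by simp
  then obtain a b d where "xs = [a, b, d]" by (auto simp: length_Suc_conv numeral_3_eq_3)
  then show ?thesis using u v ne cyc_lengthD[OF xs(1)] c(2) xs(2)
    by (auto simp: carcs_def symcl_def)
qed

lemma ngeo_triangle_core:
  assumes "iscore K" and "\<And>C. C \<in> cycles K \<Longrightarrow> card (Field C) = 3"
    and "u \<in> pverts K" "v \<in> pverts K"
  shows "ngeo (parcs K) u v = 1"
  using triangle_core[OF assms(1) _ assms(3,4)] assms(2) ngeo_adj[of u v "parcs K"]
  by (cases "u = v") simp_all

text \<open>Every block is complete, and counts multiply at the vertices where blocks are
  glued.\<close>

lemma ngeo_triangle_cactus: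
  "cactus G \<Longrightarrow> (\<And>C. C \<in> cycles G \<Longrightarrow> card (Field C) = 3) \<Longrightarrow>
    \<forall>u\<in>pverts G. \<forall>v\<in>pverts G. ngeo (parcs G) u v = 1"
proof (induct rule: cactus_induct)
  case (single G)
  then obtain v where "pverts G = {v}" by (auto simp: nverts_def card_1_singleton_iff)
  then show ?case by simp
next
  case (block K Bs)
  have cyc: "cycles (attach K Bs (pverts K)) = cycles K \<union> (\<Union>c\<in>pverts K. cycles (Bs c))"
    by (rule cycles_attach[OF block(1) order_refl])
  have B: "\<forall>u\<in>pverts (Bs c). \<forall>v\<in>pverts (Bs c). ngeo (parcs (Bs c)) u v = 1" if "c \<in> pverts K" for c
  proof (rule block(5)[OF that])
    fix C assume "C \<in> cycles (Bs c)"
    then have "C \<in> cycles (attach K Bs (pverts K))" unfolding cyc using that by blast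
    then show "card (Field C) = 3" by (rule block(6))
  qed
  have K: "ngeo (parcs K) u v = 1" if "u \<in> pverts K" "v \<in> pverts K" for u v
    using ngeo_triangle_core[OF block(2) _ that] block(6) unfolding cyc by (metis UnI1)
  have "\<forall>u\<in>pverts (attach K Bs S). \<forall>v\<in>pverts (attach K Bs S). ngeo (parcs (attach K Bs S)) u v = 1"
    if "S \<subseteq> pverts K" for S
    using block(1) that
  proof (induct rule: attach_induct)
    case empty then show ?case using K by simp
  next
    case (insert c S)
    let ?A = "attach K Bs S"
    note at = insert(5)
    note at' = at[unfolded joint_sym[of ?A]]
    note d = jointD(3,4)[OF at]
    have A: "ngeo (parcs ?A) u v = 1" if "u \<in> pverts ?A" "v \<in> pverts ?A" for u v using insert(6) that by blast
    have B': "ngeo (parcs (Bs c)) u v = 1" if "u \<in> pverts (Bs c)" "v \<in> pverts (Bs c)" for u v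
      using B[OF insert(2)] that by blast
    have "ngeo (parcs (glue ?A (Bs c))) u v = 1" if "u \<in> pverts ?A" "v \<in> pverts ?A" for u v
      using ngeo_glue_same[OF at that] A[OF that] by simp
    moreover have "ngeo (parcs (glue ?A (Bs c))) u v = 1" if "u \<in> pverts ?A" "v \<in> pverts (Bs c)" for u v
      using ngeo_glue_cross[OF at that] A[OF that(1) d(1)] B'[OF d(2) that(2)] by simp
    moreover have "ngeo (parcs (glue ?A (Bs c))) u v = 1" if "u \<in> pverts (Bs c)" "v \<in> pverts ?A" for u v
      using ngeo_glue_cross[OF at' that] A[OF d(1) that(2)] B'[OF that(1) d(2)] by (simp add: glue_comm)
    moreover have "ngeo (parcs (glue ?A (Bs c))) u v = 1" if "u \<in> pverts (Bs c)" "v \<in> pverts (Bs c)" for u v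
      using ngeo_glue_same[OF at' that] B'[OF that] by (simp add: glue_comm)
    ultimately show ?case unfolding attach_insert pverts_glue by blast
  qed
  then show ?case by blast
qed

subsection \<open>Squares\<close>

definition sq :: "'a \<Rightarrow> 'a \<Rightarrow> 'a \<Rightarrow> 'a \<Rightarrow> 'a pair_pre_digraph" where
  "sq a b c d = core (carcs [a, b, c, d])"

lemma carcs_sq:
  "carcs [a, b, c, d] = {(a, b), (b, a), (b, c), (c, b), (c, d), (d, c), (d, a), (a, d)}"
  by (auto simp: carcs_def symcl_def)

lemma sq_sel [simp]: "pverts (sq a b c d) = {a, b, c, d}"
  by (simp add: sq_def Field_carcs)

lemma parcs_sq: "parcs (sq a b c d) = carcs [a, b, c, d]"
  by (simp add: sq_def)

lemma sq_rotate: "sq b c d a = sq a b c d"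
  unfolding sq_def carcs_sq by (rule arg_cong[where f = core]) auto

lemma irrefl_carcs: assumes "distinct xs" "2 \<le> length xs" shows "irrefl (carcs xs)"
proof -
  have "(x, x) \<notin> larcs xs" for x using assms(1) by (auto simp: larcs_nth nth_eq_iff_index_eq)
  moreover have "last xs \<noteq> hd xs"
    using assms by (cases xs) (auto simp: last_conv_nth nth_eq_iff_index_eq)
  ultimately show ?thesis by (auto simp: irrefl_def carcs_def symcl_def)
qed

lemma cgraph_cycle: assumes "distinct xs" "3 \<le> length xs" shows "cgraph (core (carcs xs))"
proof -
  have c: "cyc (carcs xs) xs" using assms by (auto simp: cyc_def carcs_def symcl_def)
  have F: "Field (carcs xs) = set xs" using cyc_lengthD[OF c] by simp
  show ?thesis unfolding cgraph_def core_sel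
  proof (intro conjI ballI)
    show "finite (Field (carcs xs))" unfolding F by simp
    show "Field (carcs xs) \<noteq> {}" unfolding F using assms by auto
    show "carcs xs \<subseteq> Field (carcs xs) \<times> Field (carcs xs)" by (auto simp: Field_def)
    show "sym (carcs xs)" by (rule sym_carcs)
    show "irrefl (carcs xs)" using assms by (intro irrefl_carcs) auto
    fix u v assume "u \<in> Field (carcs xs)" "v \<in> Field (carcs xs)"
    then show "(u, v) \<in> (carcs xs)\<^sup>*" unfolding F by (rule cyc_conn[OF c])
  qed
qed

lemma sq_cyc_three:
  assumes d: "distinct [a, b, c, d]" and "(p, q) \<in> carcs [a, b, c, d]" "(q, r) \<in> carcs [a, b, c, d]"
    "(r, p) \<in> carcs [a, b, c, d]"
  shows False
  using assms unfolding carcs_sq by auto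

lemma sq_cyc_four:
  assumes d: "distinct [a, b, c, d]" and y: "distinct [a, q, r, s]"
    and "(a, q) \<in> carcs [a, b, c, d]" "(q, r) \<in> carcs [a, b, c, d]"
    "(r, s) \<in> carcs [a, b, c, d]"
  shows "carcs [a, q, r, s] = carcs [a, b, c, d]"
proof -
  have "q = b \<or> q = d" using d assms(3) unfolding carcs_sq by auto
  moreover have "r = c" using d y calculation assms(4) unfolding carcs_sq by auto
  moreover have "s = b \<or> s = d" using d y calculation assms(5) unfolding carcs_sq by auto
  ultimately show ?thesis using y unfolding carcs_sq by auto
qed

lemma cycles_sq: assumes d: "distinct [a, b, c, d]" shows "cycles (sq a b c d) = {carcs [a, b, c, d]}"
proof -
  have cg: "cgraph (sq a b c d)" unfolding sq_def using d by (intro cgraph_cycle) auto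
  have "carcs ys = carcs [a, b, c, d]" if ys: "cyc (carcs [a, b, c, d]) ys" for ys
  proof -
    let ?E = "carcs [a, b, c, d]"
    have F: "Field (carcs ys) \<subseteq> {a, b, c, d}"
      using carcs_subset[OF ys sym_carcs] mono_Field[of "carcs ys" ?E] Field_carcs[of "[a, b, c, d]"]
      by simp
    then have sub: "set ys \<subseteq> {a, b, c, d}" using cyc_lengthD[OF ys] by simp
    have "card (set ys) \<le> card {a, b, c, d}" by (rule card_mono[OF _ sub]) simp
    then have "length ys \<le> 4" "3 \<le> length ys" "distinct ys"
      using ys d by (auto simp: cyc_def distinct_card)
    then consider "length ys = 3" | "length ys = 4" by linarith
    then show ?thesis
    proof cases
      case 1
      then obtain p q r where "ys = [p, q, r]" by (auto simp: length_Suc_conv numeral_3_eq_3)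
      then show ?thesis using ys sq_cyc_three[OF d, of p q r] by (auto simp: cyc_def)
    next
      case 2
      have "card (set ys) = card {a, b, c, d}" using 2 d \<open>distinct ys\<close> by (simp add: distinct_card)
      then have "set ys = {a, b, c, d}" using sub by (intro card_subset_eq) auto
      then obtain zs where zs: "cyc ?E (a # zs)" "carcs (a # zs) = carcs ys"
        using cyc_rotate_to[OF ys, of a] by auto
      then have "length (a # zs) = 4"
        using conjunct2[OF cyc_lengthD[OF ys]] conjunct2[OF cyc_lengthD[OF zs(1)]] 2 by metis
      then obtain q r s where "zs = [q, r, s]" by (auto simp: length_Suc_conv eval_nat_numeral)
      then show ?thesis using zs sq_cyc_four[OF d, of q r s] by (auto simp: cyc_def)
    qed
  qed
  moreover have "cyc (carcs [a, b, c, d]) [a, b, c, d]" using d by (auto simp: cyc_def carcs_sq)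
  ultimately show ?thesis
    unfolding cycles_conv[OF cgraphD(3)[OF cg]] parcs_sq by blast
qed

lemma sq_props:
  assumes d: "distinct [a, b, c, d]"
  shows "cgraph (sq a b c d)" "cactus (sq a b c d)" "iscore (sq a b c d)" "nverts (sq a b c d) = 4"
    "ncycles (sq a b c d) = 1"
proof -
  show cg: "cgraph (sq a b c d)" unfolding sq_def using d by (intro cgraph_cycle) auto
  then show ca: "cactus (sq a b c d)" using cycles_sq[OF d] by (simp add: cactus_iff)
  then show "iscore (sq a b c d)" using cycles_sq[OF d]
    unfolding iscore_def parcs_sq sq_sel by (simp add: Field_carcs)
  show "nverts (sq a b c d) = 4" "ncycles (sq a b c d) = 1" using d cycles_sq[OF d] by (auto simp: nverts_def ncycles_def)
qed

lemma ngeo_sq_opp: assumes d: "distinct [a, b, c, d]" shows "ngeo (carcs [a, b, c, d]) a c = 2"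
proof -
  let ?E = "carcs [a, b, c, d]"
  have Z: "{z. (a, z) \<in> ?E \<and> (z, c) \<in> ?E} = {b, d}" using d unfolding carcs_sq by auto
  have "ngeo ?E a c = card {z. (a, z) \<in> ?E \<and> (z, c) \<in> ?E}"
  proof (rule ngeo_common)
    show "(a, c) \<notin> ?E" using d unfolding carcs_sq by auto
    show "irrefl ?E" using d by (intro irrefl_carcs) auto
  qed (use d Z in auto)
  then show ?thesis unfolding Z using d by simp
qed

lemma ngeo_sq:
  assumes d: "distinct [a, b, c, d]"
  defines "E \<equiv> carcs [a, b, c, d]"
  shows "ngeo E a c = 2" "ngeo E c a = 2" "ngeo E b d = 2" "ngeo E d b = 2"
    "ngeo E a b = 1" "ngeo E b a = 1" "ngeo E b c = 1" "ngeo E c b = 1" "ngeo E c d = 1" "ngeo E d c = 1"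
    "ngeo E d a = 1" "ngeo E a d = 1"
proof -
  have r: "carcs [b, c, d, a] = E" "carcs [c, d, a, b] = E" "carcs [d, a, b, c] = E"
    unfolding E_def carcs_sq by auto
  show "ngeo E a c = 2" "ngeo E c a = 2" "ngeo E b d = 2" "ngeo E d b = 2"
    using ngeo_sq_opp[OF d] ngeo_sq_opp[of b c d a] ngeo_sq_opp[of c d a b] ngeo_sq_opp[of d a b c] d
    unfolding r by (auto simp: E_def)
  show "ngeo E a b = 1" "ngeo E b a = 1" "ngeo E b c = 1" "ngeo E c b = 1" "ngeo E c d = 1" "ngeo E d c = 1"
    "ngeo E d a = 1" "ngeo E a d = 1"
    by (rule ngeo_adj; use d in \<open>force simp: E_def carcs_sq\<close>)+
qed

lemma gsum_sq:
  assumes d: "distinct [a, b, c, d]" and x: "x \<in> {a, b, c, d}"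
  shows "gsum (sq a b c d) x = 5"
  using x ngeo_sq[OF d] d unfolding gsum_def parcs_sq sq_sel by auto

lemma gtotal_sq: assumes d: "distinct [a, b, c, d]" shows "gtotal (sq a b c d) = 20"
proof -
  have "gtotal (sq a b c d) = (\<Sum>x\<in>{a, b, c, d}. 5)"
    unfolding gtotal_def sq_sel by (rule sum.cong) (use gsum_sq[OF d] in auto)
  then show ?thesis using d by simp
qed

lemma square_coreE:
  assumes "cgraph G" "C \<in> cycles G" "card (Field C) = 4"
  obtains a b c d where "distinct [a, b, c, d]" "C = carcs [a, b, c, d]" "core C = sq a b c d"
    "Field C = {a, b, c, d}"
proof -
  obtain xs where xs: "cyc (parcs G) xs" "C = carcs xs" using cyclesE[OF assms(1,2)] .
  then have "length xs = 4" using conjunct2[OF cyc_lengthD[OF xs(1)]] assms(3) by metis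
  then obtain a b c d where x: "xs = [a, b, c, d]" by (auto simp: length_Suc_conv eval_nat_numeral)
  have "distinct xs" using xs(1) by (simp add: cyc_def)
  then show thesis using that[of a b c d] x xs(2) Field_carcs[of xs] by (simp add: sq_def)
qed

lemma sq_opposite:
  assumes "distinct [a, b, c, d]" "x \<in> {a, b, c, d}"
  shows "\<exists>y\<in>{a, b, c, d}. x \<noteq> y \<and> ngeo (carcs [a, b, c, d]) x y = 2"
  using ngeo_sq(1-4)[OF assms(1)] assms by auto

lemma attach_split:
  assumes br: "branching K Bs" and c: "c \<in> pverts K"
  shows "attach K Bs (pverts K) = glue (attach K Bs (pverts K - {c})) (Bs c)"
    and "joint (attach K Bs (pverts K - {c})) (Bs c) c"
  using attach_insert[of K Bs c "pverts K - {c}"] joint_attach[OF br _ c, of "pverts K - {c}"] c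
  by (auto simp: insert_absorb)

lemma attach_cover:
  assumes br: "branching K Bs" and z: "z \<in> pverts (attach K Bs (pverts K))"
  obtains c where "c \<in> pverts K" "z \<in> pverts (Bs c)"
proof (cases "z \<in> pverts K")
  case True
  then show ?thesis using that[of z] branchingD(3)[OF br True] by auto
next
  case False
  then show ?thesis using z that by (auto simp: pverts_attach)
qed

text \<open>If \<open>z\<close> hangs at the vertex \<open>c\<close> of the square, the vertex
  opposite to \<open>c\<close> is reached through \<open>c\<close>, in twice as many ways. This
  turns the presence of a square into the hypothesis used by the branch lemmas.\<close>

lemma square_ngeo_two:
  assumes G: "cactus G" and C: "C \<in> cycles G" "card (Field C) = 4" and z: "z \<in> pverts G"
  shows "\<exists>u\<in>pverts G. 2 \<le> ngeo (parcs G) z u"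
proof -
  obtain Bs where Bs: "branching (core C) Bs" "G = attach (core C) Bs (Field C)"
    using cycle_decomp[OF G C(1)] by metis
  obtain c where c: "c \<in> Field C" "z \<in> pverts (Bs c)"
    using attach_cover[OF Bs(1)] z Bs(2) by auto
  obtain a b e d where s: "distinct [a, b, e, d]" "C = carcs [a, b, e, d]" "Field C = {a, b, e, d}"
    using square_coreE[OF cactus_cgraph[OF G] C] by metis
  obtain y where y: "y \<in> Field C" "c \<noteq> y" "ngeo C c y = 2"
    using sq_opposite[OF s(1), of c] c(1) s by auto
  let ?R = "attach (core C) Bs (Field C - {c})"
  have at: "G = glue (Bs c) ?R" "joint (Bs c) ?R c"
    using attach_split[OF Bs(1), of c] c(1) Bs(2) glue_comm joint_sym by (metis core_sel(1))+
  have yR: "y \<in> pverts ?R" using y(1) by (simp add: pverts_attach)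
  have "ngeo (parcs G) z y = ngeo (parcs (Bs c)) z c * ngeo (parcs ?R) c y"
    unfolding at(1) by (rule ngeo_glue_cross[OF at(2) c(2) yR])
  moreover have "ngeo (parcs ?R) c y = 2"
    using ngeo_attach[OF Bs(1), of "Field C - {c}" c y] y c(1) by auto
  moreover have "1 \<le> ngeo (parcs (Bs c)) z c" using ngeo_pos jointD(1,3)[OF at(2)] c(2) by metis
  ultimately have "2 \<le> ngeo (parcs G) z y" by simp
  moreover have "y \<in> pverts G" using yR unfolding at(1) by simp
  ultimately show ?thesis by blast
qed

subsection \<open>Local structure of maximisers\<close>

text \<open>Compare \<open>C\<close> at \<open>v\<close> with \<open>C\<close> at \<open>a\<close>.
  From \<open>a\<close> all paths into \<open>B\<close> run through \<open>v\<close> and are counted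
  at least twice, which gains at least \<open>gsum B v - 1\<close>; optimality forces the loss
  inside \<open>A\<close> to outweigh this.\<close>

lemma three_branches_aux:
  assumes opt: "optimal (glue (glue A B) C)" and at: "joint A B v" and at2: "joint (glue A B) C v"
    and C: "2 \<le> nverts C" and a: "a \<in> pverts A" "2 \<le> ngeo (parcs A) v a"
  shows "gsum B v + 2 \<le> gsum A v"
proof -
  note d = jointD[OF at]
  have s: "ngeo (parcs A) a v = ngeo (parcs A) v a" by (rule ngeo_sym[OF cgraphD(4)[OF d(1)]])
  have "gsum (glue A B) a \<le> gsum (glue A B) v" using reloc_le[OF opt at2 _ C, of a] a by simp
  then have "gsum A a + int (ngeo (parcs A) a v) * (gsum B v - 1) \<le> gsum A v + (gsum B v - 1)"
    using gsum_glue[OF at a(1)] gsum_glue[OF at d(3)] by simp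
  moreover have "2 * (gsum B v - 1) \<le> int (ngeo (parcs A) a v) * (gsum B v - 1)"
    using gsum_ge_1[OF d(2,4)] a(2) s by (intro mult_right_mono) auto
  moreover have "3 \<le> gsum A a" using gsum_ge_two_ngeo[OF d(1) a(1) d(3)] a(2) s by linarith
  moreover define t where "t = int (ngeo (parcs A) a v) * (gsum B v - 1)"
  ultimately have "gsum A a + t \<le> gsum A v + (gsum B v - 1)" "2 * (gsum B v - 1) \<le> t" "3 \<le> gsum A a" by auto
  then show ?thesis by simp
qed

text \<open>By symmetry each of \<open>gsum A v\<close> and \<open>gsum B v\<close> would exceed the
  other by 2. So a vertex with two branches that contain a square leaves no room for a third
  branch.\<close>

lemma three_branches:
  assumes opt: "optimal (glue (glue A B) C)" and at: "joint A B v" and at2: "joint (glue A B) C v"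
    and C: "2 \<le> nverts C" and a: "a \<in> pverts A" "2 \<le> ngeo (parcs A) v a"
    and b: "b \<in> pverts B" "2 \<le> ngeo (parcs B) v b"
  shows False
  using three_branches_aux[OF opt at at2 C a]
    three_branches_aux[OF opt[unfolded glue_comm[of A B]] at[unfolded joint_sym[of A]]
      at2[unfolded glue_comm[of A B]] C b] by linarith

lemma gsum_one_iff: assumes "cgraph G" "u \<in> pverts G" shows "gsum G u = 1 \<longleftrightarrow> nverts G = 1"
proof
  assume "gsum G u = 1"
  then show "nverts G = 1" using gsum_ge[OF assms] cgraph_card_ge_1[OF assms(1)] by (simp add: nverts_def)
next
  assume "nverts G = 1"
  then have "pverts G = {u}" using assms(2) by (auto simp: nverts_def card_1_singleton_iff)
  then show "gsum G u = 1" by (simp add: gsum_def)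
qed

text \<open>The branches at \<open>b\<close> and \<open>d\<close> are moved together to
  \<open>a\<close> and \<open>c\<close>. Their interaction is unchanged, as both pairs are
  antipodal, and the gain is proportional to
  \<open>(wb - 1) * (wc - 1) + (wd - 1) * (wa - 1)\<close>, a sum of nonnegative terms. Two branches
  must move at once: with four equal branches no single move is a gain.\<close>

lemma square_branches:
  assumes opt: "optimal (attach (sq a b c d) Bs {a, b, c, d})" and br: "branching (sq a b c d) Bs"
    and dist: "distinct [a, b, c, d]"
  shows "(nverts (Bs b) = 1 \<or> nverts (Bs c) = 1) \<and> (nverts (Bs a) = 1 \<or> nverts (Bs d) = 1)"
proof -
  let ?K = "sq a b c d"
  let ?Q = "attach ?K Bs {a, c}"
  have at: "joint ?Q (Bs b) b" using dist by (intro joint_attach[OF br]) auto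
  have Q1: "attach ?K Bs {a, b, c} = glue ?Q (Bs b)"
    by (simp add: attach_insert[symmetric] insert_commute)
  have at2: "joint (glue ?Q (Bs b)) (Bs d) d"
    unfolding Q1[symmetric] using dist by (intro joint_attach[OF br]) auto
  have G: "attach ?K Bs {a, b, c, d} = glue (glue ?Q (Bs b)) (Bs d)"
    unfolding Q1[symmetric] attach_insert[symmetric] by (simp add: insert_commute)
  have g: "cgraph (Bs x) \<and> x \<in> pverts (Bs x)" if "x \<in> {a, b, c, d}" for x
    using branchingD(2,3)[OF br, of x] that by auto
  define wa wb wc wd where w: "wa = gsum (Bs a) a" "wb = gsum (Bs b) b" "wc = gsum (Bs c) c" "wd = gsum (Bs d) d"
  have W1: "1 \<le> gsum (Bs x) x" if "x \<in> {a, b, c, d}" for x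
    by (rule gsum_ge_1) (use g[OF that] in simp_all)
  have wge: "1 \<le> wa" "1 \<le> wb" "1 \<le> wc" "1 \<le> wd"
    unfolding w using W1[of a] W1[of b] W1[of c] W1[of d] by simp_all
  have npQ: "ngeo (parcs ?Q) x y = ngeo (carcs [a, b, c, d]) x y" if "x \<in> {a, b, c, d}" "y \<in> {a, b, c, d}" for x y
    using ngeo_attach[OF br, of "{a, c}" x y] that by (simp add: parcs_sq)
  have WQ: "gsum ?Q x = (\<Sum>y\<in>{a, b, c, d}. int (ngeo (carcs [a, b, c, d]) x y) * wt Bs {a, c} y)"
    if "x \<in> {a, b, c, d}" for x
    using gsum_attach[OF br, of "{a, c}" x] that by (simp add: parcs_sq)
  have wts: "wt Bs {a, c} a = wa" "wt Bs {a, c} b = 1" "wt Bs {a, c} c = wc" "wt Bs {a, c} d = 1"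
    using dist by (auto simp: wt_def w)
  note n = ngeo_sq[OF dist]
  have Wb: "gsum ?Q b = wa + wc + 3" and Wd: "gsum ?Q d = wa + wc + 3"
    and Wa: "gsum ?Q a = wa + 2 * wc + 2" and Wc: "gsum ?Q c = 2 * wa + wc + 2"
    using dist by (simp_all add: WQ n wts)
  have "(wb - 1) * gsum ?Q a + (wd - 1) * gsum ?Q c + (wb - 1) * (wd - 1) * int (ngeo (parcs ?Q) c a)
     \<le> (wb - 1) * gsum ?Q b + (wd - 1) * gsum ?Q d + (wb - 1) * (wd - 1) * int (ngeo (parcs ?Q) d b)"
    unfolding w by (rule reloc2[OF opt[unfolded G] at at2]) (simp_all add: pverts_attach)
  then have "(wb - 1) * (wc - 1) + (wd - 1) * (wa - 1) \<le> 0"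
    unfolding Wa Wb Wc Wd by (simp add: npQ n algebra_simps)
  moreover have "0 \<le> (wb - 1) * (wc - 1)" "0 \<le> (wd - 1) * (wa - 1)" using wge by auto
  ultimately have "(wb - 1) * (wc - 1) = 0" "(wd - 1) * (wa - 1) = 0" by linarith+
  then have "wb = 1 \<or> wc = 1" "wd = 1 \<or> wa = 1" by auto
  moreover have Wn: "gsum (Bs x) x = 1 \<longleftrightarrow> nverts (Bs x) = 1" if "x \<in> {a, b, c, d}" for x
    by (rule gsum_one_iff) (use g[OF that] in simp_all)
  ultimately show ?thesis
    unfolding w using Wn[of a] Wn[of b] Wn[of c] Wn[of d] by (simp add: disj_commute)
qed

subsection \<open>Long cycles are not optimal\<close>

lemma carcs_nth:
  assumes "3 \<le> length zs"
  shows "carcs zs = {(zs ! i, zs ! j) | i j. i < length zs \<and> j < length zs \<and>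
    (j = Suc i \<or> i = Suc j \<or> (i = 0 \<and> j = length zs - 1) \<or> (j = 0 \<and> i = length zs - 1))}"
    (is "_ = ?R")
proof -
  let ?L = "length zs"
  have "zs \<noteq> []" using assms by auto
  then have e: "last zs = zs ! (?L - 1)" "hd zs = zs ! 0" by (simp_all add: last_conv_nth hd_conv_nth)
  have "carcs zs = {(zs ! i, zs ! Suc i) | i. Suc i < ?L} \<union> {(zs ! Suc i, zs ! i) | i. Suc i < ?L}
      \<union> {(zs ! (?L - 1), zs ! 0), (zs ! 0, zs ! (?L - 1))}"
    unfolding carcs_def symcl_def larcs_nth e by auto
  also have "\<dots> = ?R"
  proof (intro equalityI subsetI)
    fix p assume "p \<in> {(zs ! i, zs ! Suc i) | i. Suc i < ?L} \<union> {(zs ! Suc i, zs ! i) | i. Suc i < ?L}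
      \<union> {(zs ! (?L - 1), zs ! 0), (zs ! 0, zs ! (?L - 1))}"
    then consider i where "p = (zs ! i, zs ! Suc i)" "Suc i < ?L"
      | i where "p = (zs ! Suc i, zs ! i)" "Suc i < ?L"
      | "p = (zs ! (?L - 1), zs ! 0)" | "p = (zs ! 0, zs ! (?L - 1))" by blast
    then show "p \<in> ?R"
    proof cases
      case (1 i) then show ?thesis by (intro CollectI exI[of _ i] exI[of _ "Suc i"]) simp
    next
      case (2 i) then show ?thesis by (intro CollectI exI[of _ i] exI[of _ "Suc i"]) auto
    next
      case 3 then show ?thesis using assms by (intro CollectI exI[of _ 0] exI[of _ "?L - 1"]) auto
    next
      case 4 then show ?thesis using assms by (intro CollectI exI[of _ 0] exI[of _ "?L - 1"]) auto
    qed
  next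
    fix p assume "p \<in> ?R"
    then show "p \<in> {(zs ! i, zs ! Suc i) | i. Suc i < ?L} \<union> {(zs ! Suc i, zs ! i) | i. Suc i < ?L}
      \<union> {(zs ! (?L - 1), zs ! 0), (zs ! 0, zs ! (?L - 1))}" by auto
  qed
  finally show ?thesis .
qed

lemma carcs_nbr:
  assumes d: "distinct zs" "3 \<le> length zs" and k: "k < length zs" and e: "(zs ! k, x) \<in> carcs zs"
  shows "(Suc k < length zs \<and> x = zs ! Suc k) \<or> (0 < k \<and> x = zs ! (k - 1)) \<or>
    (k = 0 \<and> x = zs ! (length zs - 1)) \<or> (k = length zs - 1 \<and> x = zs ! 0)"
proof -
  obtain i j where ij: "zs ! k = zs ! i" "x = zs ! j" "i < length zs" "j < length zs"
    "j = Suc i \<or> i = Suc j \<or> (i = 0 \<and> j = length zs - 1) \<or> (j = 0 \<and> i = length zs - 1)"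
    using e unfolding carcs_nth[OF d(2)] by blast
  then have "i = k" using d(1) k by (metis nth_eq_iff_index_eq)
  with ij show ?thesis by auto
qed

text \<open>Each vertex of a cycle has two neighbours, and the path came from one of them, so after
  its first step it has no choice left.\<close>

lemma cycle_path_forced:
  assumes d: "distinct zs" "3 \<le> length zs" and p: "p \<in> paths (carcs zs) (zs ! 0) x"
    and one: "2 \<le> length p" "p ! 1 = zs ! 1"
  shows "k < length p \<Longrightarrow> p ! k = zs ! k"
proof (induct k rule: less_induct)
  case (less k)
  have pp: "p \<noteq> []" "p ! 0 = zs ! 0" "distinct p" "larcs p \<subseteq> carcs zs"
    using p by (auto simp: paths_def hd_conv_nth)
  have F: "Field (carcs zs) = set zs" using d(2) by (intro Field_carcs) simp
  have "carcs zs \<subseteq> set zs \<times> set zs" unfolding F[symmetric] by (auto simp: Field_def)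
  moreover have "zs ! 0 \<in> set zs" using d(2) by (intro nth_mem) linarith
  ultimately have "set p \<subseteq> set zs" using paths_in_field[OF p] by blast
  then have "length p \<le> length zs"
    using pp(3) d(1) card_mono[of "set zs" "set p"] by (simp add: distinct_card)
  consider "k = 0" | "k = 1" | j where "k = Suc (Suc j)" by (metis One_nat_def old.nat.exhaust)
  then show ?case
  proof cases
    case (3 j)
    have b: "p ! j = zs ! j" "p ! Suc j = zs ! Suc j" using less 3 by auto
    have "(p ! Suc j, p ! k) \<in> carcs zs" using pp(4) less(2) 3 unfolding larcs_nth by blast
    then have "(zs ! Suc j, p ! k) \<in> carcs zs" using b by simp
    \<comment> \<open>The alternative \<open>zs ! 0\<close> is the wrap-around at the end of the
      list; it is excluded because the path started there.\<close>
    from carcs_nbr[OF d _ this] less(2) 3 \<open>length p \<le> length zs\<close>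
    have "p ! k = zs ! k \<or> p ! k = zs ! j \<or> p ! k = zs ! 0" by auto
    moreover have "p ! k \<noteq> p ! j" "p ! k \<noteq> p ! 0"
      using nth_eq_iff_index_eq[OF pp(3), of k j] nth_eq_iff_index_eq[OF pp(3), of k 0] less(2) 3 pp(1)
      by simp_all
    ultimately show ?thesis using b pp(2) by auto
  qed (use pp one in auto)
qed

lemma cycle_paths:
  assumes d: "distinct (c # ys)" "2 \<le> length ys" and p: "p \<in> paths (carcs (c # ys)) c x"
  shows "p = take (length p) (c # ys) \<or> p = take (length p) (c # rev ys)"
proof (cases "2 \<le> length p")
  case False
  then have "length p = 1" using p by (cases p; cases "tl p") (auto simp: paths_def)
  then show ?thesis using p by (cases p) (auto simp: paths_def)
next
  case True
  let ?z = "c # ys" and ?z' = "c # rev ys"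
  have r: "carcs ?z' = carcs ?z"
  proof -
    have ne: "ys \<noteq> []" using d(2) by auto
    then show ?thesis
      by (auto simp: carcs_def symcl_def larcs_Cons larcs_rev hd_rev last_rev)
  qed
  have d': "distinct ?z" "3 \<le> length ?z" "distinct ?z'" "3 \<le> length ?z'" using d by auto
  have len: "length p \<le> length ?z"
  proof -
    have F: "Field (carcs ?z) = set ?z" using d(2) by (intro Field_carcs) simp
    have "carcs ?z \<subseteq> set ?z \<times> set ?z" unfolding F[symmetric] by (auto simp: Field_def)
    then have "set p \<subseteq> set ?z" using paths_in_field[OF p] by simp
    then show ?thesis
      using p d(1) card_mono[of "set ?z" "set p"] by (simp add: paths_def distinct_card)
  qed
  have "(p ! 0, p ! 1) \<in> larcs p" using True unfolding larcs_nth by force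
  moreover have "p ! 0 = c" using p by (auto simp: paths_def hd_conv_nth)
  ultimately have "(?z ! 0, p ! 1) \<in> carcs ?z" using p by (auto simp: paths_def)
  from carcs_nbr[OF d'(1,2) _ this] have "p ! 1 = ?z ! 1 \<or> p ! 1 = ?z ! (length ?z - 1)"
    using d(2) by auto
  moreover have "?z ! (length ?z - 1) = ?z' ! 1"
    using d(2) by (cases "length ys") (auto simp: rev_nth)
  ultimately consider "p ! 1 = ?z ! 1" | "p ! 1 = ?z' ! 1" by auto
  then show ?thesis
  proof cases
    case 1
    have "p = take (length p) ?z"
      by (rule nth_equalityI) (use len cycle_path_forced[OF d'(1,2) _ True 1] p in auto)
    then show ?thesis ..
  next
    case 2
    have "p = take (length p) ?z'"
      by (rule nth_equalityI) (use len cycle_path_forced[OF d'(3,4) _ True 2] p r in auto)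
    then show ?thesis ..
  qed
qed

text \<open>A shortest path is a prefix of one of the two orientations, hence the bound. Two
  shortest paths are prefixes of equal length ending in the same vertex, so its position in
  \<open>ys\<close> is the same from both ends: it is the antipode of \<open>c\<close>.\<close>

lemma cycle_ngeo:
  assumes d: "distinct (c # ys)" "2 \<le> length ys"
  shows "ngeo (carcs (c # ys)) c x \<le> 2"
    and "2 \<le> ngeo (carcs (c # ys)) c x \<Longrightarrow> x = (c # ys) ! (length (c # ys) div 2)"
proof -
  let ?z = "c # ys" and ?z' = "c # rev ys"
  let ?G = "geos (carcs ?z) c x"
  have sub: "?G \<subseteq> {take (length p) ?z, take (length p) ?z'}" if "p \<in> ?G" for p
    using cycle_paths[OF d, of _ x] geos_length[OF that] unfolding geos_def by force
  show "ngeo (carcs ?z) c x \<le> 2"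
  proof (cases "?G = {}")
    case True then show ?thesis by (simp add: ngeo_def)
  next
    case False
    then obtain p where "p \<in> ?G" by auto
    then have "card ?G \<le> card {take (length p) ?z, take (length p) ?z'}"
      by (intro card_mono sub) auto
    also have "\<dots> \<le> 2" by (simp add: card_insert_if)
    finally show ?thesis by (simp add: ngeo_def)
  qed
  assume two: "2 \<le> ngeo (carcs ?z) c x"
  then have "?G \<noteq> {}" by (auto simp: ngeo_def)
  then obtain p where p: "p \<in> ?G" by auto
  let ?m = "length p"
  have "take ?m ?z \<in> ?G \<and> take ?m ?z' \<in> ?G \<and> take ?m ?z \<noteq> take ?m ?z'"
  proof (rule ccontr)
    assume "\<not> ?thesis"
    then have "\<exists>q. ?G \<subseteq> {q}" using sub[OF p] by blast
    then obtain q where "?G \<subseteq> {q}" ..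
    then have "card ?G \<le> 1" using card_mono[of "{q}" ?G] by simp
    with two show False by (simp add: ngeo_def)
  qed
  then have t: "take ?m ?z \<in> ?G" "take ?m ?z' \<in> ?G" "take ?m ?z \<noteq> take ?m ?z'" by auto
  have lm: "length (take ?m ?z) = ?m" using geos_length[OF t(1) p] .
  then have m: "?m \<le> length ?z" by simp
  have m1: "1 < ?m" using t(3) by (cases p; cases "tl p") auto
  have "last (take ?m ?z) = x" "last (take ?m ?z') = x" using t by (auto simp: geos_def paths_def)
  then have l: "?z ! (?m - 1) = x" "?z' ! (?m - 1) = x"
  proof -
    have lt: "last (take ?m zs) = zs ! (?m - 1)" if "length zs = length ?z" for zs
    proof -
      have "take ?m zs \<noteq> []" using that m1 by auto
      then show ?thesis using m m1 that by (simp add: last_conv_nth)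
    qed
    show "?z ! (?m - 1) = x" "?z' ! (?m - 1) = x"
      using lt[of ?z] lt[of ?z'] \<open>last (take ?m ?z) = x\<close> \<open>last (take ?m ?z') = x\<close> by simp_all
  qed
  define j where "j = ?m - 2"
  have j: "?m = Suc (Suc j)" using m1 unfolding j_def by arith
  have jl: "j < length ys" using m j by simp
  have "ys ! j = x" "rev ys ! j = x" using l j by auto
  then have "ys ! j = ys ! (length ys - Suc j)" using jl by (simp add: rev_nth)
  then have "j = length ys - Suc j" using d(1) jl by (simp add: nth_eq_iff_index_eq)
  then have "length ?z div 2 = Suc j" using jl by simp
  then show "x = ?z ! (length ?z div 2)" using \<open>ys ! j = x\<close> by simp
qed

section \<open>Replacing a long cycle by a square with pendant vertices\<close>

lemma tree_on:
  assumes "finite Y" "a \<notin> Y"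
  shows "\<exists>T. cactus T \<and> cycles T = {} \<and> pverts T = insert a Y"
  using assms
proof (induct Y)
  case empty
  let ?T = "\<lparr>pverts = {a}, parcs = {}\<rparr>"
  have "cgraph ?T" by (simp add: cgraph_def irrefl_def sym_def)
  moreover from this have "cycles ?T = {}" by (rule cycles_small) (simp add: nverts_def)
  ultimately have "cactus ?T \<and> cycles ?T = {} \<and> pverts ?T = insert a {}" by (simp add: cactus_iff)
  then show ?case by blast
next
  case (insert y Y)
  then obtain T where T: "cactus T" "cycles T = {}" "pverts T = insert a Y" by auto
  have ay: "a \<noteq> y" using insert by auto
  \<comment> \<open>Every new vertex is joined to \<open>a\<close> itself, so the tree is a star
    with centre \<open>a\<close>.\<close>
  have at: "joint T (edge a y) a"
    using T cactus_cgraph[OF T(1)] cgraph_edge[OF ay] insert by (auto simp: joint_def)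
  have "cactus (glue T (edge a y))" "cycles (glue T (edge a y)) = {}"
    using cactus_glue[OF at] cycles_glue[OF at] T edge_props[OF ay] by auto
  moreover have "pverts (glue T (edge a y)) = insert a (insert y Y)" using T by auto
  ultimately show ?case by blast
qed

text \<open>The new core: a square \<open>M p a q\<close> with all the other vertices of the long cycle hanging on \<open>a\<close>,
  so that every vertex but \<open>p\<close> and \<open>q\<close> is doubly connected to \<open>M\<close>.\<close>

lemma short_core:
  assumes V: "finite V" and d: "distinct [M, p, a, q]" "{M, p, a, q} \<subseteq> V"
  obtains K where "cactus K" "ncycles K = 1" "pverts K = V"
    "\<And>x. x \<in> V - {M, p, q} \<Longrightarrow> 2 \<le> ngeo (parcs K) M x" "2 \<le> ngeo (parcs K) p q"
proof -
  let ?Y = "V - {M, p, a, q}" and ?S = "sq M p a q"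
  obtain T where T: "cactus T" "cycles T = {}" "pverts T = insert a ?Y"
    using tree_on[of ?Y a] V by auto
  note s = sq_props[OF d(1)] and n = ngeo_sq[OF d(1)]
  have at: "joint ?S T a" using T(3) s(1) cactus_cgraph[OF T(1)] d by (auto simp: joint_def)
  let ?K = "glue ?S T"
  show thesis
  proof
    show "cactus ?K" using cactus_glue[OF at] s T by simp
    show "ncycles ?K = 1" using ncycles_glue[OF at] s T by (simp add: ncycles_def)
    show "pverts ?K = V" using T d by auto
    show "2 \<le> ngeo (parcs ?K) p q"
      using ngeo_glue_same[OF at, of p q] n by (simp add: parcs_sq)
    fix x assume x: "x \<in> V - {M, p, q}"
    show "2 \<le> ngeo (parcs ?K) M x"
    proof -
      have xT: "x \<in> pverts T" using x T by auto
      have "ngeo (parcs ?K) M x = 2 * ngeo (parcs T) a x"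
        using ngeo_glue_cross[OF at, of M x] xT n by (simp add: parcs_sq)
      moreover have "1 \<le> ngeo (parcs T) a x"
        using ngeo_pos[OF cactus_cgraph[OF T(1)] _ xT, of a] T(3) by simp
      ultimately show ?thesis by simp
    qed
  qed
qed

lemma row_bound:
  fixes e w :: "'a \<Rightarrow> int"
  assumes "finite V" "d0 \<in> V" "\<And>d. d \<in> V \<Longrightarrow> e d \<noteq> 0 \<Longrightarrow> d = d0" "e d0 \<le> 1" "0 \<le> w d0"
  shows "(\<Sum>d\<in>V. e d * w d) \<le> w d0"
proof -
  have "(\<Sum>d\<in>V. e d * w d) = (\<Sum>d\<in>{d0}. e d * w d)"
    by (rule sum.mono_neutral_right) (use assms in auto)
  also have "\<dots> \<le> w d0" using mult_right_mono[OF assms(4,5)] by simp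
  finally show ?thesis .
qed

text \<open>Here \<open>e\<close> and \<open>e'\<close> are the numbers of additional shortest paths in the old and the new core,
  \<open>part\<close> is the antipode on the old cycle and \<open>w\<close> weighs the branches.\<close>

lemma core_comparison:
  fixes w :: "'a \<Rightarrow> int" and e :: "'a \<Rightarrow> 'a \<Rightarrow> int" and part :: "'a \<Rightarrow> 'a"
  assumes V: "finite V" "5 \<le> card V" and w: "\<And>x. x \<in> V \<Longrightarrow> 1 \<le> w x"
    and e: "\<And>x y. x \<in> V \<Longrightarrow> y \<in> V \<Longrightarrow> e x y = e y x"
      "\<And>x y. x \<in> V \<Longrightarrow> y \<in> V \<Longrightarrow> e x y \<noteq> 0 \<Longrightarrow> y = part x \<and> x \<noteq> y"
      "\<And>x y. x \<in> V \<Longrightarrow> y \<in> V \<Longrightarrow> 0 \<le> e x y \<and> e x y \<le> 1"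
    and M: "M \<in> V" "\<And>x. x \<in> V \<Longrightarrow> w x \<le> w M"
  obtains p a q where "distinct [M, p, a, q]" "{M, p, a, q} \<subseteq> V"
    "\<forall>e'. (\<forall>x\<in>V. \<forall>y\<in>V. (0 :: int) \<le> e' x y \<and> e' x y = e' y x) \<longrightarrow>
      (\<forall>x\<in>V - {M, p, q}. 1 \<le> e' M x) \<longrightarrow> 1 \<le> e' p q \<longrightarrow>
      (\<Sum>x\<in>V. \<Sum>y\<in>V. e x y * w x * w y) < (\<Sum>x\<in>V. \<Sum>y\<in>V. e' x y * w x * w y)"
proof -
  \<comment> \<open>Five vertices are required for \<open>M\<close>, \<open>p\<close>,
    \<open>q\<close>, \<open>a\<close> and one more vertex \<open>z\<close> that makes the gain
    strict.\<close>
  have pick: "\<exists>x. x \<in> V - S" if S: "finite S" "card S \<le> 4" for S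
  proof (rule ccontr)
    assume "\<not> ?thesis"
    then have "V \<subseteq> S" by blast
    then have "card V \<le> card S" using S(1) by (rule card_mono[rotated])
    with S V show False by simp
  qed
  \<comment> \<open>The antipode of \<open>M\<close>, with \<open>M\<close> itself as default value
    if there is none.\<close>
  define b where "b = (if part M \<in> V \<and> e M (part M) \<noteq> 0 then part M else M)"
  have b: "y = b" if "y \<in> V" "e M y \<noteq> 0" for y using e(2)[OF M(1) that] that by (auto simp: b_def)
  have bV: "b \<in> V" using M by (auto simp: b_def)
  have bM: "e M b \<noteq> 0" if "b \<noteq> M" using that by (auto simp: b_def split: if_splits)
  \<comment> \<open>The side vertices are an antipodal pair avoiding \<open>M\<close>, if there is one.\<close>
  have "\<exists>p q. p \<in> V \<and> q \<in> V \<and> p \<noteq> q \<and> p \<notin> {M, b} \<and> q \<notin> {M, b} \<and>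
      (\<forall>x\<in>V. \<forall>y\<in>V. e x y \<noteq> 0 \<longrightarrow> x \<in> {p, q} \<longrightarrow> x \<noteq> M \<and> y \<noteq> M \<and> y \<in> {p, q})"
  proof (cases "\<exists>p\<in>V - {M}. \<exists>q\<in>V - {M}. e p q \<noteq> 0")
    case True
    then obtain p q where pq: "p \<in> V" "q \<in> V" "p \<noteq> M" "q \<noteq> M" "e p q \<noteq> 0" by blast
    then have qp: "e q p \<noteq> 0" using e(1) by metis
    have ne: "p \<noteq> q" using e(2)[OF pq(1,2,5)] by blast
    have "x = q" if "x \<in> V" "e p x \<noteq> 0" for x using e(2)[OF pq(1) that] e(2)[OF pq(1,2,5)] by simp
    moreover have "x = p" if "x \<in> V" "e q x \<noteq> 0" for x
      using e(2)[OF pq(2) that] e(2)[OF pq(2,1) qp] by simp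
    moreover have "p \<noteq> b" using calculation(1)[of M] e(1)[OF M(1) bV] bM M(1) pq by metis
    moreover have "q \<noteq> b" using calculation(2)[of M] e(1)[OF M(1) bV] bM M(1) pq by metis
    ultimately have "\<forall>x\<in>V. \<forall>y\<in>V. e x y \<noteq> 0 \<longrightarrow> x \<in> {p, q} \<longrightarrow> x \<noteq> M \<and> y \<noteq> M \<and> y \<in> {p, q}"
      using pq by blast
    with pq ne \<open>p \<noteq> b\<close> \<open>q \<noteq> b\<close> show ?thesis by blast
  next
    case False
    have "card {M, b} \<le> 4" by (simp add: card_insert_if)
    then obtain p where p: "p \<in> V - {M, b}" using pick[of "{M, b}"] by auto
    have "card {M, b, p} \<le> 4" by (simp add: card_insert_if)
    then obtain q where q: "q \<in> V - {M, b, p}" using pick[of "{M, b, p}"] by auto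
    have "e x y = 0" if "x \<in> V" "y \<in> V" "x \<in> {p, q}" for x y
    proof (rule ccontr)
      assume a: "e x y \<noteq> 0"
      have "x \<noteq> M" "x \<noteq> b" using that p q by auto
      with False that a have "y = M" by blast
      then have "e M x \<noteq> 0" using a e(1)[OF that(1) M(1)] by simp
      with b[OF that(1)] \<open>x \<noteq> b\<close> show False by simp
    qed
    then show ?thesis using p q by blast
  qed
  then obtain p q where pq: "p \<in> V" "q \<in> V" "p \<noteq> q" "p \<notin> {M, b}" "q \<notin> {M, b}"
    and side: "\<And>x y. x \<in> V \<Longrightarrow> y \<in> V \<Longrightarrow> e x y \<noteq> 0 \<Longrightarrow> x \<in> {p, q} \<Longrightarrow> y \<in> {p, q}"
    by blast
  \<comment> \<open>The vertex opposite to \<open>M\<close> in the new square is the old antipode of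
    \<open>M\<close> if there is one, so the old row of \<open>M\<close> is at most
    \<open>w a\<close>.\<close>
  have "\<exists>a. a \<in> V - {M, p, q} \<and> (b \<noteq> M \<longrightarrow> a = b)"
  proof (cases "b = M")
    case True
    have "card {M, p, q} \<le> 4" by (simp add: card_insert_if)
    then show ?thesis using pick[of "{M, p, q}"] True by auto
  qed (use pq bV in auto)
  then obtain a where a: "a \<in> V - {M, p, q}" "b \<noteq> M \<Longrightarrow> a = b" by blast
  \<comment> \<open>A second vertex doubly connected to \<open>M\<close> in the new core: row
    \<open>M\<close> grows from at most \<open>w a\<close> to at least
    \<open>w a + w z\<close>.\<close>
  have "card {M, p, q, a} \<le> 4" by (simp add: card_insert_if)
  then obtain z where z: "z \<in> V - {M, p, q, a}" using pick[of "{M, p, q, a}"] by auto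
  show thesis
  proof (rule that[of p a q], goal_cases)
    case 1
    show ?case using pq a M by auto
  next
    case 2
    show ?case using pq a M by auto
  next
    case 3
    show ?case
    proof (intro allI impI)
      fix e' :: "'a \<Rightarrow> 'a \<Rightarrow> int"
      assume e'_ball: "\<forall>x\<in>V. \<forall>y\<in>V. 0 \<le> e' x y \<and> e' x y = e' y x"
        and eM_ball: "\<forall>x\<in>V - {M, p, q}. 1 \<le> e' M x" and epq: "1 \<le> e' p q"
      note e' = e'_ball[rule_format] and eM = eM_ball[rule_format]
      have w0: "0 \<le> w x" if "x \<in> V" for x using w[OF that] by simp
      have up: "(\<Sum>y\<in>V. e x y * w y) \<le> w y0" if "x \<in> V" "y0 \<in> V" "\<And>y. y \<in> V \<Longrightarrow> e x y \<noteq> 0 \<Longrightarrow> y = y0" for x y0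
        by (rule row_bound[OF V(1) that(2,3)]) (use e(3)[OF that(1,2)] w0[OF that(2)] in auto)
      have upM: "(\<Sum>y\<in>V. e x y * w y) \<le> w M" if x: "x \<in> V" for x
      proof (cases "\<exists>y\<in>V. e x y \<noteq> 0")
        case True
        then obtain y0 where y0: "y0 \<in> V" "e x y0 \<noteq> 0" by blast
        have "y = y0" if "y \<in> V" "e x y \<noteq> 0" for y using e(2)[OF x that] e(2)[OF x y0] by simp
        then show ?thesis using up[OF x y0(1)] M(2)[OF y0(1)] by fastforce
      next
        case False
        then have "(\<Sum>y\<in>V. e x y * w y) = 0" by (intro sum.neutral) auto
        then show ?thesis using w0[OF M(1)] by simp
      qed
      have low: "e' x y * w y \<le> (\<Sum>y\<in>V. e' x y * w y)" if "x \<in> V" "y \<in> V" for x y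
        by (rule member_le_sum[OF that(2) _ V(1)]) (use e' w0 that in auto)
      have rowM: "(\<Sum>y\<in>V. e M y * w y) < (\<Sum>y\<in>V. e' M y * w y)"
      proof -
        have "(\<Sum>y\<in>V. e M y * w y) \<le> w a"
        proof (rule up[OF M(1)])
          show "a \<in> V" using a by simp
          fix y assume y: "y \<in> V" "e M y \<noteq> 0"
          then have "y = b" "M \<noteq> y" using b e(2)[OF M(1)] by auto
          then show "y = a" using a(2) by auto
        qed
        also have "w a < w a + w z" using w[of z] z by simp
        also have "a \<noteq> z" using z by auto
        then have "w a + w z = (\<Sum>y\<in>{a, z}. w y)" by simp
        also have "\<dots> \<le> (\<Sum>y\<in>{a, z}. e' M y * w y)"
        proof (rule sum_mono)
          fix y assume "y \<in> {a, z}"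
          then have "y \<in> V - {M, p, q}" using a z by auto
          then show "w y \<le> e' M y * w y" using mult_right_mono[OF eM w0, of y y] by simp
        qed
        also have "\<dots> \<le> (\<Sum>y\<in>V. e' M y * w y)"
          by (rule sum_mono2) (use V a z e' w0 M in auto)
        finally show ?thesis .
      qed
      \<comment> \<open>An old row contains at most one weight. Rows \<open>p\<close> and
        \<open>q\<close> keep each other's weight as a bound; every other row except that of
        \<open>M\<close> now contains \<open>w M\<close>, the largest weight of all.\<close>
      have row: "(\<Sum>y\<in>V. e x y * w y) \<le> (\<Sum>y\<in>V. e' x y * w y)" if x: "x \<in> V" for x
      proof -
        consider "x = M" | "x = p" | "x = q" | "x \<in> V - {M, p, q}" using x by blast
        then show ?thesis
        proof cases
          case 1 then show ?thesis using rowM by simp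
        next
          case 2
          have "(\<Sum>y\<in>V. e x y * w y) \<le> w q"
          proof (rule up[OF x pq(2)])
            fix y assume y: "y \<in> V" "e x y \<noteq> 0"
            then show "y = q" using side[OF x y] e(2)[OF x y] 2 by auto
          qed
          also have "\<dots> \<le> e' p q * w q" using mult_right_mono[OF epq w0[OF pq(2)]] by simp
          finally show ?thesis using low[OF x pq(2)] 2 by simp
        next
          case 3
          have "(\<Sum>y\<in>V. e x y * w y) \<le> w p"
          proof (rule up[OF x pq(1)])
            fix y assume y: "y \<in> V" "e x y \<noteq> 0"
            then show "y = p" using side[OF x y] e(2)[OF x y] 3 by auto
          qed
          also have "\<dots> \<le> e' q p * w p"
            using mult_right_mono[OF epq w0[OF pq(1)]] e'[OF pq(1,2)] by simp
          finally show ?thesis using low[OF x pq(1)] 3 by simp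
        next
          case 4
          have "w M \<le> e' x M * w M"
            using mult_right_mono[OF eM[OF 4] w0[OF M(1)]] e'[OF M(1) x] by simp
          then show ?thesis using upM[OF x] low[OF x M(1)] by simp
        qed
      qed
      have r: "(\<Sum>x\<in>V. \<Sum>y\<in>V. f x y * w x * w y) = (\<Sum>x\<in>V. w x * (\<Sum>y\<in>V. f x y * w y))" for f
        by (simp add: sum_distrib_left algebra_simps)
      show "(\<Sum>x\<in>V. \<Sum>y\<in>V. e x y * w x * w y) < (\<Sum>x\<in>V. \<Sum>y\<in>V. e' x y * w x * w y)"
        unfolding r
      proof (rule sum_strict_mono_ex1[OF V(1)])
        show "\<forall>x\<in>V. w x * (\<Sum>y\<in>V. e x y * w y) \<le> w x * (\<Sum>y\<in>V. e' x y * w y)"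
          using row w0 by (intro ballI mult_left_mono) auto
        have "0 < w M" using w[OF M(1)] by simp
        then show "\<exists>x\<in>V. w x * (\<Sum>y\<in>V. e x y * w y) < w x * (\<Sum>y\<in>V. e' x y * w y)"
          using M(1) rowM by (intro bexI[of _ M] mult_strict_left_mono) auto
      qed
    qed
  qed
qed

text \<open>All branches stay in place and only the core on the vertices of the long cycle is
  exchanged, so by \<open>gtotal_attach\<close> just the two quadratic forms have to be compared.
  The vertex \<open>M\<close> that gets the double connections is one with a heaviest
  branch.\<close>

lemma optimal_cycle_length:
  assumes opt: "optimal G" and C: "C \<in> cycles G"
  shows "card (Field C) \<le> 4"
proof (rule ccontr)
  assume "\<not> ?thesis"
  then have V5: "5 \<le> card (Field C)" by simp
  let ?V = "Field C"
  have G: "cactus G" using opt by (rule opt_cactus)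
  obtain Bs where Bs: "branching (core C) Bs" "G = attach (core C) Bs ?V" "cycles (core C) = {C}"
    "\<And>c. c \<in> ?V \<Longrightarrow> cactus (Bs c)"
    using cycle_decomp[OF G C] by metis
  have cC: "cgraph (core C)" by (rule branchingD(1)[OF Bs(1)])
  have fin: "finite ?V" using cgraphD(1)[OF cC] by simp
  obtain xs where xs: "cyc (parcs G) xs" "C = carcs xs" using cyclesE[OF cactus_cgraph[OF G] C] .
  have Vx: "?V = set xs" using cyc_lengthD[OF xs(1)] xs(2) by simp
  have ex: "\<exists>y. \<forall>x\<in>?V. ngeo C c x \<le> 2 \<and> (2 \<le> ngeo C c x \<longrightarrow> x = y)" if c: "c \<in> ?V" for c
  proof -
    have "c \<in> set xs" using c Vx by simp
    then obtain ys where "cyc (parcs G) (c # ys)" "carcs (c # ys) = carcs xs"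
      using cyc_rotate_to[OF xs(1)] by metis
    then have ys: "cyc (parcs G) (c # ys)" "carcs (c # ys) = C" using xs(2) by simp_all
    then have "distinct (c # ys)" "2 \<le> length ys" by (auto simp: cyc_def)
    from cycle_ngeo[OF this] show ?thesis unfolding ys(2) by blast
  qed
  \<comment> \<open>If no vertex has two shortest paths from \<open>c\<close>, as on an odd cycle,
    the choice is arbitrary.\<close>
  define part where
    "part c = (SOME y. \<forall>x\<in>?V. ngeo C c x \<le> 2 \<and> (2 \<le> ngeo C c x \<longrightarrow> x = y))" for c
  have part0: "\<forall>x\<in>?V. ngeo C c x \<le> 2 \<and> (2 \<le> ngeo C c x \<longrightarrow> x = part c)" if "c \<in> ?V" for c
    unfolding part_def by (rule someI_ex[OF ex[OF that]])
  have part: "ngeo C c x \<le> 2" "2 \<le> ngeo C c x \<Longrightarrow> x = part c" if "c \<in> ?V" "x \<in> ?V" for c x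
    using part0[OF that(1)] that(2) by simp_all
  define w where "w x = gsum (Bs x) x" for x
  define e where "e x y = int (ngeo C x y) - 1" for x y
  have w1: "1 \<le> w x" if "x \<in> ?V" for x
    unfolding w_def using branchingD(2,3)[OF Bs(1), of x] that by (intro gsum_ge_1) auto
  have pos: "1 \<le> ngeo C x y" if "x \<in> ?V" "y \<in> ?V" for x y using ngeo_pos[OF cC, of x y] that by simp
  have "?V \<noteq> {}" using V5 by auto
  then have "Max (w ` ?V) \<in> w ` ?V" using fin by (intro Max_in) auto
  then obtain M where M: "M \<in> ?V" "Max (w ` ?V) = w M" by (elim imageE)
  then have M: "M \<in> ?V" "\<And>x. x \<in> ?V \<Longrightarrow> w x \<le> w M"
    using Max_ge[of "w ` ?V"] fin by fastforce+
  have e1: "e x y = e y x" for x y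
    using ngeo_sym[OF cgraphD(4)[OF cC], of x y] by (simp add: e_def)
  have e2: "y = part x \<and> x \<noteq> y" if "x \<in> ?V" "y \<in> ?V" "e x y \<noteq> 0" for x y
  proof -
    have "2 \<le> ngeo C x y" using pos[OF that(1,2)] that(3) by (simp add: e_def)
    then show ?thesis using part(2)[OF that(1,2)] by auto
  qed
  have e3: "0 \<le> e x y \<and> e x y \<le> 1" if "x \<in> ?V" "y \<in> ?V" for x y
    using pos[OF that] part(1)[OF that] by (simp add: e_def)
  obtain p a q where pq: "distinct [M, p, a, q]" "{M, p, a, q} \<subseteq> ?V"
    "\<forall>e'. (\<forall>x\<in>?V. \<forall>y\<in>?V. (0 :: int) \<le> e' x y \<and> e' x y = e' y x) \<longrightarrow>
      (\<forall>x\<in>?V - {M, p, q}. 1 \<le> e' M x) \<longrightarrow> 1 \<le> e' p q \<longrightarrow>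
      (\<Sum>x\<in>?V. \<Sum>y\<in>?V. e x y * w x * w y) < (\<Sum>x\<in>?V. \<Sum>y\<in>?V. e' x y * w x * w y)"
    by (rule core_comparison[where V = ?V and w = w and e = e and part = part and M = M,
          OF fin V5 w1 e1 e2 e3 M]) (assumption | rule that)+
  obtain K where K: "cactus K" "ncycles K = 1" "pverts K = ?V"
    "\<And>x. x \<in> ?V - {M, p, q} \<Longrightarrow> 2 \<le> ngeo (parcs K) M x" "2 \<le> ngeo (parcs K) p q"
    using short_core[OF fin pq(1,2)] by metis
  define e' where "e' x y = int (ngeo (parcs K) x y) - 1" for x y
  have cK: "cgraph K" using K(1) by (rule cactus_cgraph)
  have less: "(\<Sum>x\<in>?V. \<Sum>y\<in>?V. e x y * w x * w y) < (\<Sum>x\<in>?V. \<Sum>y\<in>?V. e' x y * w x * w y)"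
  proof (rule pq(3)[rule_format])
    show "0 \<le> e' x y \<and> e' x y = e' y x" if "x \<in> ?V" "y \<in> ?V" for x y
      using ngeo_pos[OF cK, of x y] ngeo_sym[OF cgraphD(4)[OF cK], of x y] that K(3) by (simp add: e'_def)
    show "1 \<le> e' M x" if "x \<in> ?V - {M, p, q}" for x using K(4)[OF that] by (simp add: e'_def)
    show "1 \<le> e' p q" using K(5) by (simp add: e'_def)
  qed
  have brK: "branching K Bs" using branching_cong_core[OF Bs(1) cK] K(3) by simp
  let ?N = "attach K Bs ?V"
  have "cactus ?N" using cactus_attach[OF brK, of ?V] K(1,3) Bs(4) by simp
  moreover have "nverts ?N = nverts G" unfolding nverts_def using Bs(2) K(3) by (simp add: pverts_attach)
  moreover have "ncycles ?N = ncycles G"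
    using ncycles_attach[OF brK, of ?V] ncycles_attach[OF Bs(1), of ?V] K(2,3) Bs(2,3) by (simp add: ncycles_def)
  ultimately have "gtotal ?N \<le> gtotal G" by (rule opt_le[OF opt])
  moreover have "gtotal ?N = (\<Sum>x\<in>?V. \<Sum>y\<in>?V. int (ngeo (parcs K) x y) * w x * w y)
      + (\<Sum>c\<in>?V. gtotal (Bs c) - (gsum (Bs c) c)\<^sup>2)"
    using gtotal_attach[OF brK, of ?V] K(3) by (simp add: wt_def w_def)
  moreover have "gtotal G = (\<Sum>x\<in>?V. \<Sum>y\<in>?V. int (ngeo C x y) * w x * w y)
      + (\<Sum>c\<in>?V. gtotal (Bs c) - (gsum (Bs c) c)\<^sup>2)"
    using gtotal_attach[OF Bs(1), of ?V] Bs(2) by (simp add: wt_def w_def)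
  \<comment> \<open>Taking one path off every entry removes the same sum of \<open>w x * w y\<close>
    from both quadratic forms.\<close>
  moreover have "(\<Sum>x\<in>?V. \<Sum>y\<in>?V. int (f x y) * w x * w y)
      = (\<Sum>x\<in>?V. \<Sum>y\<in>?V. (int (f x y) - 1) * w x * w y) + (\<Sum>x\<in>?V. \<Sum>y\<in>?V. w x * w y)" for f
    by (simp add: sum.distrib[symmetric] algebra_simps)
  ultimately show False using less unfolding e_def e'_def by simp
qed

subsection \<open>Global structure of maximisers\<close>

lemma joint_three:
  assumes "joint M (glue R S) v" "joint R S v"
  shows "joint M R v" "joint M S v" "joint (glue M R) S v" "joint (glue M S) R v"
proof -
  have c: "cgraph M" "cgraph R" "cgraph S" using assms by (auto simp: joint_def)
  have i: "pverts M \<inter> (pverts R \<union> pverts S) = {v}" "pverts R \<inter> pverts S = {v}"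
    using assms by (simp_all add: joint_def)
  show a: "joint M R v" "joint M S v" using c i by (auto simp: joint_def)
  show "joint (glue M R) S v" "joint (glue M S) R v"
    using c i cgraph_glue[OF a(1)] cgraph_glue[OF a(2)] by (auto simp: joint_def)
qed

lemma joint_three':
  assumes "joint (glue M R) S v" "joint M R v"
  shows "joint M S v" "joint (glue M S) R v" "joint R S v" "joint M (glue R S) v"
proof -
  have c: "cgraph M" "cgraph R" "cgraph S" using assms by (auto simp: joint_def)
  have i: "(pverts M \<union> pverts R) \<inter> pverts S = {v}" "pverts M \<inter> pverts R = {v}"
    using assms by (simp_all add: joint_def)
  show a: "joint M S v" "joint R S v" using c i by (auto simp: joint_def)
  show "joint (glue M S) R v" "joint M (glue R S) v"
    using c i cgraph_glue[OF a(1)] cgraph_glue[OF a(2)] by (auto simp: joint_def)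
qed

lemma trivial_graph:
  assumes "cgraph T" "nverts T = 1" "v \<in> pverts T" shows "pverts T = {v}" "parcs T = {}"
proof -
  show v: "pverts T = {v}" using assms(2,3) by (auto simp: nverts_def card_1_singleton_iff)
  show "parcs T = {}" using cgraphD(3,5)[OF assms(1)] unfolding v by (auto simp: irrefl_def)
qed

lemma glue_trivial: assumes "joint R T v" "nverts T = 1" shows "glue R T = R"
  using trivial_graph[OF jointD(2)[OF assms(1)] assms(2) jointD(4)[OF assms(1)]] jointD(3)[OF assms(1)]
  by (simp add: glue_def insert_absorb)

lemma attach_trivial:
  assumes br: "branching K Bs" and c: "c \<in> pverts K" "nverts (Bs c) = 1"
  shows "attach K Bs (insert c S) = attach K Bs S"
proof -
  have "c \<in> pverts (Bs c)" using branchingD(3)[OF br c(1)] by auto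
  from trivial_graph[OF branchingD(2)[OF br c(1)] c(2) this] c(1) show ?thesis
    by (auto simp: attach_def)
qed

lemma exists_arc: assumes "cgraph G" "v \<in> pverts G" "2 \<le> nverts G" shows "\<exists>z. (v, z) \<in> parcs G"
proof -
  have "\<exists>w. w \<in> pverts G \<and> w \<noteq> v"
  proof (rule ccontr)
    assume "\<not> ?thesis"
    then have "pverts G = {v}" using assms(2) by blast
    then show False using assms(3) by (simp add: nverts_def)
  qed
  then obtain w where "w \<in> pverts G" "w \<noteq> v" by blast
  then have "(v, w) \<in> (parcs G)\<^sup>*" "w \<noteq> v" using cgraphD(6)[OF assms(1,2)] by auto
  then show ?thesis by (metis converse_rtranclE)
qed

lemma gsum_const_core:
  assumes br: "branching K Bs" and S: "S \<subseteq> pverts K"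
    and one: "\<And>x y. x \<in> pverts K \<Longrightarrow> y \<in> pverts K \<Longrightarrow> ngeo (parcs K) x y = 1"
    and xy: "x \<in> pverts K" "y \<in> pverts K"
  shows "gsum (attach K Bs S) x = gsum (attach K Bs S) y"
  using gsum_attach[OF br S] one xy by simp

lemma square_coreE_at:
  assumes "cgraph G" "C \<in> cycles G" "card (Field C) = 4" "v \<in> Field C"
  obtains x r y where "distinct [v, x, r, y]" "core C = sq v x r y" "C = carcs [v, x, r, y]"
proof -
  obtain a b c d where s: "distinct [a, b, c, d]" "C = carcs [a, b, c, d]" "Field C = {a, b, c, d}"
    using square_coreE[OF assms(1-3)] by metis
  have rot: "carcs [b, c, d, a] = C" "carcs [c, d, a, b] = C" "carcs [d, a, b, c] = C"
    unfolding s(2) carcs_sq by auto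
  consider "v = a" | "v = b" | "v = c" | "v = d" using assms(4) s(3) by auto
  then show thesis
  proof cases
    case 1 then show ?thesis using that[of b c d] s by (simp add: sq_def)
  next
    case 2
    show ?thesis
    proof (rule that[of c d a])
      show "distinct [v, c, d, a]" using s(1) 2 by auto
      show "core C = sq v c d a" unfolding 2 sq_def rot(1) ..
      show "C = carcs [v, c, d, a]" unfolding 2 rot(1) ..
    qed
  next
    case 3
    show ?thesis
    proof (rule that[of d a b])
      show "distinct [v, d, a, b]" using s(1) 3 by auto
      show "core C = sq v d a b" unfolding 3 sq_def rot(2) ..
      show "C = carcs [v, d, a, b]" unfolding 3 rot(2) ..
    qed
  next
    case 4
    show ?thesis
    proof (rule that[of a b c])
      show "distinct [v, a, b, c]" using s(1) 4 by auto
      show "core C = sq v a b c" unfolding 4 sq_def rot(3) ..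
      show "C = carcs [v, a, b, c]" unfolding 4 rot(3) ..
    qed
  qed
qed

lemma sq_flip: "sq a d c b = sq a b c d"
  unfolding sq_def carcs_sq by (rule arg_cong[where f = core]) auto

lemma ngeo_one_core:
  assumes K: "iscore K" and "\<And>C. C \<in> cycles K \<Longrightarrow> card (Field C) \<noteq> 4"
    and le: "\<And>C. C \<in> cycles K \<Longrightarrow> card (Field C) \<le> 4"
    and xy: "x \<in> pverts K" "y \<in> pverts K"
  shows "ngeo (parcs K) x y = 1"
proof (rule ngeo_triangle_core[OF K _ xy])
  fix C assume C: "C \<in> cycles K"
  have "cgraph K" using K by (simp add: iscore_def cactus_cgraph)
  from cyclesD(4)[OF this C] assms(2)[OF C] le[OF C] show "card (Field C) = 3" by simp
qed

text \<open>The step that lengthens the chain. \<open>M\<close> offers a double connection, so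
  \<open>three_branches\<close> limits what may happen at \<open>v\<close>: it excludes a further
  branch there, and after a tie move also a bridge or triangle in front of the square. What starts
  at \<open>v\<close> is then a square with two bare sides, and \<open>B\<close> continues only at
  its far vertex \<open>r\<close>.\<close>

lemma branch_behind_square:
  assumes opt: "optimal (glue M B)" and at: "joint M B v" and u: "u \<in> pverts M" "2 \<le> ngeo (parcs M) v u"
    and C: "C \<in> cycles B" "card (Field C) = 4"
  obtains x r y B' where "distinct [v, x, r, y]" "B = glue (sq v x r y) B'"
    "joint (sq v x r y) B' r"
proof -
  note d = jointD[OF at]
  have cacB: "cactus B" using opt_cactus[OF opt] cactus_glue[OF at] by simp
  have le4: "card (Field Y) \<le> 4" if "Y \<in> cycles B" for Y
    using optimal_cycle_length[OF opt] that cycles_glue[OF at] by simp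
  have nvM: "2 \<le> nverts M"
  proof -
    have "u \<noteq> v" using u(2) by auto
    then have "card {u, v} \<le> nverts M" unfolding nverts_def
      using u(1) d(3) cgraphD(1)[OF d(1)] by (intro card_mono) auto
    with \<open>u \<noteq> v\<close> show ?thesis by simp
  qed
  have "4 \<le> nverts B" unfolding nverts_def C(2)[symmetric]
    using cyclesD(5)[OF d(2) C(1)] cgraphD(1)[OF d(2)] by (rule card_mono[rotated])
  then obtain z where z: "(v, z) \<in> parcs B" using exists_arc[OF d(2,4)] by auto
  obtain K Bs where K: "branching K Bs" "B = attach K Bs (pverts K)" "iscore K" "(v, z) \<in> parcs K"
    "\<And>c. c \<in> pverts K \<Longrightarrow> cactus (Bs c)" "parcs K \<in> cycles B \<or> K = edge v z"
    using block_decomp[OF cacB z] by metis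
  note br = K(1)
  have cK: "cgraph K" by (rule branchingD(1)[OF br])
  have vz: "v \<in> pverts K" "z \<in> pverts K" "v \<noteq> z"
    using cgraphD(3,5)[OF cK] K(4) by (auto simp: irrefl_def)
  have cycK: "Y \<in> cycles B" if "Y \<in> cycles K" for Y
    using that cycles_attach[OF br order_refl] K(2) by simp
  have nvK: "2 \<le> nverts K" by (rule iscore_nverts[OF K(3)])
  have big: "2 \<le> nverts (attach K Bs S)" if "S \<subseteq> pverts K" for S
  proof -
    have "card (pverts K) \<le> card (pverts (attach K Bs S))"
      using cgraphD(1)[OF cgraph_attach[OF br that]] by (intro card_mono) (auto simp: pverts_attach)
    then show ?thesis using nvK by (simp add: nverts_def)
  qed
  let ?R = "attach K Bs (pverts K - {v})"
  have R: "B = glue ?R (Bs v)" "joint ?R (Bs v) v" using attach_split[OF br vz(1)] K(2) by auto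
  note at3 = joint_three[OF at[unfolded R(1)] R(2)]
  have G: "glue M B = glue (glue M ?R) (Bs v)" "glue M B = glue (glue M (Bs v)) ?R"
    unfolding R(1) by (auto simp: glue_def)
  have two: "\<exists>u\<in>pverts T. 2 \<le> ngeo (parcs T) x u" if "cactus T" "C \<in> cycles T" "x \<in> pverts T" for T x
    by (rule square_ngeo_two[OF that(1,2) C(2) that(3)])
  have cacR: "cactus ?R" "cactus (Bs v)" using cacB cactus_glue[OF R(2)] R(1) by auto
  \<comment> \<open>Otherwise \<open>M\<close>, \<open>?R\<close> and \<open>Bs v\<close> are three
    non-trivial branches at \<open>v\<close>, and \<open>C\<close> lies in one of the last
    two.\<close>
  have nv1: "nverts (Bs v) = 1"
  proof (rule ccontr)
    assume "nverts (Bs v) \<noteq> 1"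
    then have n2: "2 \<le> nverts (Bs v)"
      using cgraph_card_ge_1[OF branchingD(2)[OF br vz(1)]] by (simp add: nverts_def)
    have "C \<in> cycles ?R \<or> C \<in> cycles (Bs v)" using C(1) cycles_glue[OF R(2)] R(1) by simp
    then show False
    proof
      assume "C \<in> cycles ?R"
      then obtain u' where "u' \<in> pverts ?R" "2 \<le> ngeo (parcs ?R) v u'"
        using two[OF cacR(1) _ jointD(3)[OF R(2)]] by blast
      then show False using three_branches[OF opt[unfolded G(1)] at3(1,3) n2 u] by blast
    next
      assume "C \<in> cycles (Bs v)"
      then obtain u' where "u' \<in> pverts (Bs v)" "2 \<le> ngeo (parcs (Bs v)) v u'"
        using two[OF cacR(2) _ jointD(4)[OF R(2)]] by blast
      then show False
        using three_branches[OF opt[unfolded G(2)] at3(2,4) big[of "pverts K - {v}"] u] by blast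
    qed
  qed
  have BR: "B = ?R" using glue_trivial[OF R(2) nv1] R(1) by simp
  \<comment> \<open>In a block with unique shortest paths \<open>c\<close> and \<open>v\<close> are
    tied: \<open>M\<close> contributes the same to both, and so does the rest of the block. The
    branch holding \<open>C\<close> can therefore be slid from \<open>c\<close> to \<open>v\<close>,
    where it forms three branches together with \<open>M\<close> and \<open>?R0\<close>.\<close>
  have sqK: "card (Field (parcs K)) = 4 \<and> parcs K \<in> cycles B"
  proof (rule ccontr)
    assume not4: "\<not> ?thesis"
    have cK4: "card (Field Y) \<noteq> 4" if "Y \<in> cycles K" for Y
    proof -
      have "Y = parcs K"
      proof (cases "\<exists>x y. x \<noteq> y \<and> K = edge x y")
        case True
        then have "cycles K = {}" using edge_props(2) by metis
        then show ?thesis using that by simp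
      next
        case False
        then show ?thesis using that K(3) by (auto simp: iscore_def)
      qed
      then show ?thesis using not4 cycK[OF that] by simp
    qed
    have one: "ngeo (parcs K) x y = 1" if "x \<in> pverts K" "y \<in> pverts K" for x y
      by (rule ngeo_one_core[OF K(3) cK4 le4[OF cycK] that])
    have "C \<notin> cycles K" using cK4 C(2) by blast
    then obtain c where c: "c \<in> pverts K - {v}" "C \<in> cycles (Bs c)"
      using C(1) cycles_attach[OF br, of "pverts K - {v}"] BR by auto
    let ?R0 = "attach K Bs (pverts K - {v, c})"
    have i: "pverts K - {v} = insert c (pverts K - {v, c})" using c by auto
    have R0: "B = glue ?R0 (Bs c)" using BR unfolding i attach_insert .
    have j0: "joint ?R0 (Bs c) c" using c by (intro joint_attach[OF br]) auto
    have vR0: "v \<in> pverts ?R0" "c \<in> pverts ?R0" using vz c by (auto simp: pverts_attach)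
    have vc: "v \<notin> pverts (Bs c)" using joint_unique[OF j0 vR0(1)] c by auto
    have jM: "joint M ?R0 v"
      using at vR0 jointD(1)[OF j0] unfolding R0 by (auto simp: joint_def)
    let ?H = "glue M ?R0"
    have GH: "glue M B = glue ?H (Bs c)" unfolding R0 by (simp add: glue_assoc)
    have jH: "joint ?H (Bs c) c"
      using cgraph_glue[OF jM] j0 at vc unfolding R0 by (auto simp: joint_def)
    note H' = glue_comm[of M ?R0] jM[unfolded joint_sym[of M]]
    have "gsum ?H c = gsum ?R0 c + 1 * (gsum M v - 1)"
      unfolding H'(1) gsum_glue[OF H'(2) vR0(2)]
      using ngeo_attach[OF br, of "pverts K - {v, c}" c v] one[of c v] c vz by simp
    moreover have "gsum ?H v = gsum ?R0 v + 1 * (gsum M v - 1)"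
      unfolding H'(1) gsum_glue[OF H'(2) vR0(1)] by simp
    moreover have "gsum ?R0 c = gsum ?R0 v" by (rule gsum_const_core[OF br _ one]) (use c vz in auto)
    ultimately have tie: "gsum ?H v = gsum ?H c" by simp
    let ?B' = "move (Bs c) c v"
    have vH: "v \<in> pverts ?H" using vR0 by simp
    have opt': "optimal (glue ?H ?B')" by (rule reloc_tie[OF opt[unfolded GH] jH vH tie])
    have jH': "joint ?H ?B' v" by (rule joint_move[OF jH vH])
    note j3 = joint_three'[OF jH' jM]
    have G': "glue ?H ?B' = glue (glue M ?B') ?R0" by (auto simp: glue_def)
    obtain u' where u': "u' \<in> pverts (Bs c)" "2 \<le> ngeo (parcs (Bs c)) c u'"
      using two[OF K(5) c(2) jointD(4)[OF j0]] c(1) by blast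
    have "transpose c v u' \<in> pverts ?B'" "2 \<le> ngeo (parcs ?B') v (transpose c v u')"
      using u' ngeo_move[of "Bs c" c v u'] pverts_move'[of c v "Bs c"] by auto
    then show False
      using three_branches[OF opt'[unfolded G'] j3(1,2) big[of "pverts K - {v, c}"] u] by blast
  qed
  have pK: "pverts K = Field (parcs K)"
  proof (cases "\<exists>x y. x \<noteq> y \<and> K = edge x y")
    case True
    then show ?thesis by (auto simp: Field_def)
  next
    case False
    then show ?thesis using K(3) by (auto simp: iscore_def)
  qed
  then have Kc: "K = core (parcs K)" by (simp add: core_def)
  obtain x r y where s: "distinct [v, x, r, y]" "core (parcs K) = sq v x r y"
    using square_coreE_at[OF d(2), of "parcs K" v] sqK vz(1) pK by metis
  have Ks: "K = sq v x r y" using Kc s(2) by simp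
  \<comment> \<open>The square is now viewed as core of the whole graph, with \<open>M\<close> as
    its branch at \<open>v\<close>, so that \<open>square_branches\<close> applies.\<close>
  let ?Bs = "Bs(v := M)"
  have nM: "pverts M \<inter> pverts (Bs e) = {}" if "e \<in> pverts K" "e \<noteq> v" for e
  proof -
    have "pverts (Bs e) \<subseteq> pverts B" using K(2) that by (auto simp: pverts_attach)
    moreover have "v \<notin> pverts (Bs e)" using branchingD(3)[OF br that(1)] vz(1) that(2) by auto
    ultimately show ?thesis using at by (auto simp: joint_def)
  qed
  have KB: "pverts K \<subseteq> pverts B" using K(2) by (auto simp: pverts_attach)
  have br': "branching K ?Bs"
    unfolding branching_def
  proof (intro conjI ballI impI)
    show "cgraph K" by (rule cK)
  next
    fix e assume e: "e \<in> pverts K"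
    show "cgraph (?Bs e)" using branchingD(2)[OF br e] d(1) by simp
    show "pverts (?Bs e) \<inter> pverts K = {e}"
    proof (cases "e = v")
      case True then show ?thesis using at KB vz(1) by (auto simp: joint_def)
    next
      case False then show ?thesis using branchingD(3)[OF br e] by simp
    qed
  next
    fix e f assume ef: "e \<in> pverts K" "f \<in> pverts K" "e \<noteq> f"
    show "pverts (?Bs e) \<inter> pverts (?Bs f) = {}"
      using nM[OF ef(1)] nM[OF ef(2)] branchingD(4)[OF br ef] ef(3) by (auto simp: Int_commute)
  qed
  have "attach K ?Bs (pverts K) = glue (attach K ?Bs (pverts K - {v})) M"
    using attach_split(1)[OF br' vz(1)] by simp
  also have "attach K ?Bs (pverts K - {v}) = ?R" by (simp add: attach_def)
  finally have GA: "attach K ?Bs (pverts K) = glue M B" using BR glue_comm by metis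
  \<comment> \<open>\<open>v\<close> carries the non-trivial branch \<open>M\<close>, so its
    neighbour \<open>y\<close> is bare; the reversed orientation of the square treats
    \<open>x\<close>.\<close>
  have "nverts (Bs y) = 1"
    using square_branches[of v x r y ?Bs] opt br' GA s(1) nvM unfolding Ks by auto
  moreover have "nverts (Bs x) = 1"
    using square_branches[of v y r x ?Bs] opt br' GA s(1) nvM unfolding Ks
    by (auto simp: sq_flip[of v y r x] insert_commute)
  ultimately have "attach K Bs (insert x (insert y {r})) = attach K Bs {r}"
    using attach_trivial[OF br] Ks by (metis insertCI sq_sel)
  moreover have "pverts K - {v} = insert x (insert y {r})" using s(1) Ks by auto
  ultimately have "B = attach K Bs {r}" using BR by simp
  then have Br: "B = glue K (Bs r)" using attach_insert[of K Bs r "{}"] by simp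
  have "joint K (Bs r) r" using joint_attach[OF br, of "{}" r] Ks by simp
  then show thesis using that[OF s(1)] Br Ks by blast
qed

text \<open>Inside a core with unique shortest paths all vertices are tied for every branch, so the
  branches can be slid to \<open>t\<close> one after another, \<open>A\<close> collecting them. The
  excess is carried along because it still shows that a bridge exists after the moves.\<close>

lemma gather:
  assumes br: "branching K Bs" and one: "\<And>x y. x \<in> pverts K \<Longrightarrow> y \<in> pverts K \<Longrightarrow> ngeo (parcs K) x y = 1"
    and t: "t \<in> pverts K" and S: "S \<subseteq> pverts K"
  shows "optimal (glue (attach K Bs S) A) \<Longrightarrow> joint (attach K Bs S) A t \<Longrightarrow>
    \<exists>A'. optimal (glue K A') \<and> joint K A' t \<and> excess (glue K A') = excess (glue (attach K Bs S) A)"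
  using br S
proof (induct arbitrary: A rule: attach_induct)
  case empty
  then show ?case by auto
next
  case (insert c S)
  let ?T = "attach K Bs S"
  have opt: "optimal (glue (glue ?T (Bs c)) A)" and j: "joint (glue ?T (Bs c)) A t"
    using insert(8,9) unfolding attach_insert by auto
  have tT: "t \<in> pverts ?T" "c \<in> pverts ?T" using t insert(2) by (auto simp: pverts_attach)
  show ?case
  proof (cases "c = t")
    case True
    note j1 = insert(5)[unfolded True]
    note j3 = joint_three'[OF j[unfolded True] j1]
    have "glue (glue ?T (Bs c)) A = glue ?T (glue (Bs c) A)" by (rule glue_assoc)
    then show ?thesis using insert(6)[of "glue (Bs c) A"] opt j3(4) True
      unfolding attach_insert by simp
  next
    case False
    have jA: "joint ?T A t" using j tT jointD(1)[OF insert(5)] by (auto simp: joint_def)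
    let ?H = "glue ?T A"

    have i: "pverts ?T \<inter> pverts (Bs c) = {c}" "(pverts ?T \<union> pverts (Bs c)) \<inter> pverts A = {t}"
      using insert(5) j by (simp_all add: joint_def)
    have "t \<notin> pverts (Bs c)" using joint_unique[OF insert(5) tT(1)] False by auto
    then have "pverts A \<inter> pverts (Bs c) = {}" using i(2) by auto
    then have "pverts ?H \<inter> pverts (Bs c) = {c}" using i(1) by auto
    then have jH: "joint ?H (Bs c) c"
      using cgraph_glue[OF jA] jointD(2)[OF insert(5)] by (simp add: joint_def)
    have G: "glue (glue ?T (Bs c)) A = glue ?H (Bs c)" by (auto simp: glue_def)
    have "gsum ?H c = gsum ?H t"
      using gsum_glue[OF jA tT(1)] gsum_glue[OF jA tT(2)] ngeo_attach[OF br insert(1,2) t] one[OF insert(2) t]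
        gsum_const_core[OF br insert(1) one insert(2) t] by simp
    then have opt': "optimal (glue ?H (move (Bs c) c t))"
      using reloc_tie[OF opt[unfolded G] jH, of t] tT by simp
    have jH': "joint ?H (move (Bs c) c t) t" by (rule joint_move[OF jH]) (use tT in simp)
    note j3 = joint_three'[OF jH' jA]
    have G': "glue ?H (move (Bs c) c t) = glue ?T (glue A (move (Bs c) c t))" by (rule glue_assoc)
    have "excess (glue ?T (glue A (move (Bs c) c t))) = excess (glue (glue ?T (Bs c)) A)"
      unfolding G G'[symmetric] excess_glue[OF jH] excess_glue[OF jH'] using move_inv(5)[OF jointD(2)[OF jH]] by simp
    then show ?thesis
      using insert(6)[of "glue A (move (Bs c) c t)"] opt'[unfolded G'] j3(4) unfolding attach_insert by simp
  qed
qed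

lemma ngeo_one_gsum_gtotal:
  assumes G: "cgraph G" and one: "\<And>x y. x \<in> pverts G \<Longrightarrow> y \<in> pverts G \<Longrightarrow> ngeo (parcs G) x y = 1"
  shows "u \<in> pverts G \<Longrightarrow> gsum G u = int (nverts G)" "gtotal G = (int (nverts G))\<^sup>2"
proof -
  show gsum: "gsum G u = int (nverts G)" if "u \<in> pverts G" for u
    unfolding gsum_def nverts_def using one[OF that] by simp
  show "gtotal G = (int (nverts G))\<^sup>2" unfolding gtotal_def using gsum by (simp add: nverts_def power2_eq_square)
qed

lemma edge_ngeo: "a \<noteq> b \<Longrightarrow> x \<in> {a, b} \<Longrightarrow> y \<in> {a, b} \<Longrightarrow> ngeo (parcs (edge a b)) x y = 1"
  using ngeo_adj[of a b "parcs (edge a b)"] ngeo_adj[of b a "parcs (edge a b)"] by auto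

text \<open>A pendant triangle at \<open>t\<close> and a pendant edge at \<open>p\<close> can be replaced by a pendant square, either
  at \<open>t\<close> or at \<open>p\<close>; one of the two is a strict gain.\<close>

lemma pendant_triangle_and_edge:
  assumes opt: "optimal (glue (glue Z (edge p q)) K)" and pq: "p \<noteq> q"
    and jE: "joint Z (edge p q) p" and jK: "joint (glue Z (edge p q)) K t" and t: "t \<in> pverts Z"
    and K: "cactus K" "nverts K = 3" "ncycles K = 1"
    and one: "\<And>x y. x \<in> pverts K \<Longrightarrow> y \<in> pverts K \<Longrightarrow> ngeo (parcs K) x y = 1"
  shows False
proof -
  let ?E = "edge p q"
  note dE = jointD[OF jE] and dK = jointD[OF jK]
  have qZ: "q \<notin> pverts Z" using joint_unique[OF jE, of q] pq by auto
  have "card (pverts K - {t}) = 2" using dK(4) K(2) cgraphD(1)[OF dK(2)] by (simp add: nverts_def)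
  then obtain a b where ab: "pverts K - {t} = {a, b}" "a \<noteq> b" by (meson card_2_iff)
  have abt: "a \<noteq> t" "b \<noteq> t" using ab(1) by auto
  have "a \<in> pverts K" "b \<in> pverts K" using ab(1) by auto
  then have abZ: "a \<notin> pverts Z" "b \<notin> pverts Z" "a \<noteq> q" "b \<noteq> q" "a \<noteq> p" "b \<noteq> p"
    using joint_unique[OF jK, of a] joint_unique[OF jK, of b] abt dE(3) by auto
  have cacZ: "cactus Z"
    using opt_cactus[OF opt] cactus_glue[OF jK] cactus_glue[OF jE] by simp
  have WE: "gsum ?E p = 2" "gtotal ?E = 4"
    using ngeo_one_gsum_gtotal[OF cgraph_edge[OF pq], OF edge_ngeo[OF pq]] edge_props(1)[OF pq] by simp_all
  have WK: "gsum K t = 3" "gtotal K = 9" using ngeo_one_gsum_gtotal[OF dK(2) one] K(2) dK(4) by simp_all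
  \<comment> \<open>Besides \<open>z\<close> the new square uses \<open>a\<close>, \<open>b\<close>
    and \<open>q\<close>, which become free with the triangle and the edge. By
    \<open>gtotal_glue\<close> it contributes \<open>20 - 1 + 2 * (gsum Z z - 1) * (5 - 1)\<close>,
    that is, \<open>8 * gsum Z z + 11\<close>.\<close>
  let ?N = "\<lambda>z. glue Z (sq z a q b)"
  define wp wt g where w: "wp = gsum Z p" "wt = gsum Z t" "g = int (ngeo (parcs Z) p t)"
  have new: "gtotal Z + 11 + 8 * gsum Z z \<le> gtotal (glue (glue Z ?E) K)" if z: "z \<in> pverts Z" for z
  proof -
    have d: "distinct [z, a, q, b]" using z abZ ab(2) qZ by auto
    note s = sq_props[OF d]
    have j: "joint Z (sq z a q b) z" using dE(1) s(1) z abZ qZ by (auto simp: joint_def)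
    have "cactus (?N z)" using cactus_glue[OF j] cacZ s(2) by simp
    moreover have "nverts (?N z) = nverts (glue (glue Z ?E) K)"
      using nverts_glue[OF j] nverts_glue[OF jE] nverts_glue[OF jK] s(4) K(2) edge_props(1)[OF pq] by simp
    moreover have "ncycles (?N z) = ncycles (glue (glue Z ?E) K)"
      using ncycles_glue[OF j] ncycles_glue[OF jE] ncycles_glue[OF jK] s(5) K(3) edge_props(3)[OF pq] by simp
    ultimately have "gtotal (?N z) \<le> gtotal (glue (glue Z ?E) K)" by (rule opt_le[OF opt])
    moreover have "gtotal (?N z) = gtotal Z + 11 + 8 * gsum Z z"
      using gtotal_glue[OF j] gtotal_sq[OF d] gsum_sq[OF d, of z] by simp
    ultimately show ?thesis by simp
  qed
  have "ngeo (parcs Z) t p = ngeo (parcs Z) p t" by (rule ngeo_sym[OF cgraphD(4)[OF dE(1)]])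
  then have "gtotal (glue (glue Z ?E) K) = gtotal Z + 5 + 2 * wp + 4 * wt + 4 * g"
    using gtotal_glue[OF jK] gtotal_glue[OF jE] gsum_glue[OF jE t] WE WK by (simp add: w algebra_simps)
  then have "11 + 8 * wt \<le> 5 + 2 * wp + 4 * wt + 4 * g" "11 + 8 * wp \<le> 5 + 2 * wp + 4 * wt + 4 * g"
    using new[OF t] new[OF dE(3)] by (simp_all add: w)
  \<comment> \<open>The sum of the two inequalities above is \<open>wp + 3 \<le> 2 * g\<close> up to
    a factor 4, which contradicts this bound.\<close>
  moreover have "2 * g - 1 \<le> wp" unfolding w by (rule gsum_ge_two_ngeo[OF dE(1) dE(3) t])
  ultimately show False by presburger
qed

text \<open>Positive excess means a bridge. Two rounds of tie moves make both blocks pendant: all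
  branches of the triangle are gathered at \<open>t\<close>, then everything behind the far end of
  the bridge is slid to its near end. Then \<open>pendant_triangle_and_edge\<close> applies.\<close>

lemma optimal_triangle_excess:
  assumes opt: "optimal G" and C: "C \<in> cycles G" "card (Field C) = 3"
  shows "excess G = 0"
proof (rule ccontr)
  assume "excess G \<noteq> 0"
  then have pos: "0 < excess G" using excess_nonneg[OF opt_cactus[OF opt]] by simp
  let ?K = "core C"
  obtain Bs where Bs: "branching ?K Bs" "G = attach ?K Bs (Field C)" "iscore ?K" "cycles ?K = {C}"
    using cycle_decomp[OF opt_cactus[OF opt] C(1)] by metis
  have one: "ngeo (parcs ?K) x y = 1" if "x \<in> pverts ?K" "y \<in> pverts ?K" for x y
    by (rule ngeo_triangle_core[OF Bs(3) _ that]) (use Bs(4) C(2) in simp)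
  have nvK: "nverts ?K = 3" "ncycles ?K = 1" using C(2) Bs(4) by (simp_all add: nverts_def ncycles_def)
  have cacK: "cactus ?K" using Bs(3) by (simp add: iscore_def)
  have "Field C \<noteq> {}" using C(2) by auto
  then obtain t where t: "t \<in> pverts ?K" by auto
  have sp: "G = glue (attach ?K Bs (pverts ?K - {t})) (Bs t)" "joint (attach ?K Bs (pverts ?K - {t})) (Bs t) t"
    using attach_split[OF Bs(1) t] Bs(2) by auto
  obtain A where A: "optimal (glue ?K A)" "joint ?K A t" "excess (glue ?K A) = excess G"
    using gather[OF Bs(1) one t _ opt[unfolded sp(1)] sp(2)] sp(1) by auto
  have "excess ?K = 0" using excess_core[OF Bs(3)] Bs(4) by simp
  then have "0 < excess A" using excess_glue[OF A(2)] A(3) pos by simp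
  moreover have cacA: "cactus A" using cactus_glue[OF A(2)] opt_cactus[OF A(1)] by simp
  ultimately obtain x y where xy: "(x, y) \<in> parcs A" "\<And>Y. Y \<in> cycles A \<Longrightarrow> (x, y) \<notin> Y"
    using excess_pos_bridge by blast
  obtain Es where Es: "branching (edge x y) Es" "A = attach (edge x y) Es {x, y}" "x \<noteq> y"
    using edge_decomp[OF cacA xy] by metis
  \<comment> \<open>\<open>p\<close> is the end of the bridge on the side of the triangle.\<close>
  obtain p where p: "p \<in> {x, y}" "t \<in> pverts (Es p)"
    using attach_cover[OF Es(1), of t] jointD(4)[OF A(2)] Es(2) by auto
  obtain q where q: "{x, y} = {p, q}" "p \<noteq> q" using p(1) Es(3) by auto
  let ?E = "edge p q"
  have E: "edge x y = ?E" using q by (auto simp: edge_def doubleton_eq_iff)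
  note br = Es(1)[unfolded E]
  have "A = attach ?E Es {q, p}"
    unfolding insert_commute[of q p] q(1)[symmetric] E[symmetric] by (rule Es(2))
  then have A2: "A = glue (glue ?E (Es p)) (Es q)"
    using attach_insert[of ?E Es q "{p}"] attach_insert[of ?E Es p "{}"] by simp
  have jp: "joint ?E (Es p) p" using joint_attach[OF br, of "{}" p] by simp
  have jq: "joint (glue ?E (Es p)) (Es q) q"
    using joint_attach[OF br, of "{p}" q] q(2) attach_insert[of ?E Es p "{}"] by simp
  have tq: "t \<notin> pverts (Es q)" using branchingD(4)[OF br, of p q] p(2) q(2) by auto
  have KA: "pverts ?K \<inter> (pverts ?E \<union> pverts (Es p) \<union> pverts (Es q)) = {t}"
    using A(2) unfolding A2 by (auto simp: joint_def)
  have cK: "cgraph ?K" by (rule jointD(1)[OF A(2)])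
  let ?L = "glue (Es p) ?K"
  have jL: "joint (Es p) ?K t" using KA p(2) cK jointD(2)[OF jp] by (auto simp: joint_def)
  have pK: "p \<notin> pverts ?K \<or> p = t" "q \<notin> pverts ?K" 
  proof -
    show "p \<notin> pverts ?K \<or> p = t" using KA by auto
    show "q \<notin> pverts ?K"
    proof
      assume "q \<in> pverts ?K"
      then have "q = t" using KA by auto
      then show False using tq jointD(4)[OF jq] by simp
    qed
  qed
  have meet: "pverts ?E \<inter> pverts (Es p) = {p}" "(pverts ?E \<union> pverts (Es p)) \<inter> pverts (Es q) = {q}"
    using jp jq by (simp_all add: joint_def)
  have jEL: "joint ?E ?L p"
    using cgraph_glue[OF jL] jointD(1)[OF jp] meet(1) pK by (auto simp: joint_def)
  let ?H = "glue ?E ?L"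
  have "pverts ?H \<inter> pverts (Es q) = {q}" using meet(2) KA tq by auto
  then have jH: "joint ?H (Es q) q" using cgraph_glue[OF jEL] jointD(2)[OF jq] by (simp add: joint_def)
  have G1: "glue ?K A = glue ?H (Es q)" unfolding A2 by (auto simp: glue_def)
  have W2: "gsum ?E p = 2" "gsum ?E q = 2"
    using ngeo_one_gsum_gtotal(1)[OF cgraph_edge[OF q(2)], OF edge_ngeo[OF q(2)]] edge_props(1)[OF q(2)] by simp_all
  \<comment> \<open>The two ends of a bridge are tied, so what hangs at \<open>q\<close> may move to
    \<open>p\<close>, which leaves \<open>q\<close> as a leaf.\<close>
  have "gsum ?H p = gsum ?H q"
    using gsum_glue[OF jEL, of p] gsum_glue[OF jEL, of q] edge_ngeo[OF q(2), of q p] W2 by simp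
  then have opt2: "optimal (glue ?H (move (Es q) q p))"
    using reloc_tie[OF A(1)[unfolded G1] jH, of p] by simp
  have jH2: "joint ?H (move (Es q) q p) p" by (rule joint_move[OF jH]) simp
  let ?X = "move (Es q) q p"
  let ?Z = "glue (Es p) ?X"
  have X: "pverts ?H \<inter> pverts ?X = {p}" using jH2 by (simp add: joint_def)
  have jZ: "joint (Es p) ?X p"
    using X jointD(2)[OF jH2] jointD(1)[OF jL] jointD(4)[OF jp] by (auto simp: joint_def)
  have "pverts ?Z \<inter> pverts ?E = {p}" using X meet(1) by auto
  then have jE: "joint ?Z ?E p" using cgraph_glue[OF jZ] jointD(1)[OF jp] by (simp add: joint_def)
  have "pverts (glue ?Z ?E) \<inter> pverts ?K = {t}"
    using X KA pK p(2) by auto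
  then have jK: "joint (glue ?Z ?E) ?K t" using cgraph_glue[OF jE] cK by (simp add: joint_def)
  have "glue ?H ?X = glue (glue ?Z ?E) ?K" by (auto simp: glue_def)
  then show False
    using pendant_triangle_and_edge[OF opt2[unfolded \<open>glue ?H ?X = glue (glue ?Z ?E) ?K\<close>] q(2) jE jK _ cacK nvK one]
      p(2) by simp
qed

lemma leaf_block:
  assumes K: "cactus K1" "2 \<le> nverts K1" and e: "e \<in> pverts K1"
  obtains A P p where "K1 = glue A P" "joint A P p" "e \<in> pverts A" "iscore P"
proof -
  let ?Q = "\<lambda>n. \<exists>A P p. K1 = glue A P \<and> joint A P p \<and> e \<in> pverts A \<and> 2 \<le> nverts P \<and> nverts P = n"
  have cK: "cgraph K1" using K(1) by (rule cactus_cgraph)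
  \<comment> \<open>The bare vertex \<open>e\<close> glued to the whole of \<open>K1\<close> shows
    that some splitting exists.\<close>
  let ?T = "\<lparr>pverts = {e}, parcs = {}\<rparr> :: 'a pair_pre_digraph"
  have "cgraph ?T" by (simp add: cgraph_def irrefl_def sym_def)
  then have "joint ?T K1 e" using cK e by (simp add: joint_def)
  moreover have "K1 = glue ?T K1" using e by (simp add: glue_def insert_absorb)
  moreover have "e \<in> pverts ?T" by simp
  ultimately have "?Q (nverts K1)" using K(2) by (intro exI conjI) (assumption | rule refl)+
  then have "\<exists>n. ?Q n" by (rule exI[of ?Q])
  then have "\<exists>n. ?Q n \<and> (\<forall>m<n. \<not> ?Q m)" by (rule exists_least_iff[of ?Q, THEN iffD1])
  then obtain n A P p where P: "K1 = glue A P" "joint A P p" "e \<in> pverts A" "2 \<le> nverts P" "nverts P = n"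
    and least: "\<forall>m<n. \<not> ?Q m"
    by (elim exE conjE)
  have min: "nverts P \<le> nverts P'" if "K1 = glue A' P'" "joint A' P' p'" "e \<in> pverts A'" "2 \<le> nverts P'" for A' P' p'
  proof (rule ccontr)
    assume "\<not> nverts P \<le> nverts P'"
    then have "\<not> ?Q (nverts P')" using least P(5) by simp
    moreover have "?Q (nverts P')" using that by (intro exI conjI) (assumption | rule refl)+
    ultimately show False by contradiction
  qed
  have cP: "cactus P" using K(1) P(1) cactus_glue[OF P(2)] by simp
  obtain z where z: "(p, z) \<in> parcs P" using exists_arc[OF jointD(2,4)[OF P(2)] P(4)] by blast
  obtain K Bs where KB: "branching K Bs" "P = attach K Bs (pverts K)" "iscore K" "(p, z) \<in> parcs K"
    using block_decomp[OF cP z] by metis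
  note br = KB(1)
  have pK: "p \<in> pverts K" using cgraphD(3)[OF branchingD(1)[OF br]] KB(4) by auto
  \<comment> \<open>A non-trivial branch away from \<open>p\<close> is itself a smaller end piece;
    one at \<open>p\<close> can be given to \<open>A\<close>, and the rest is smaller.\<close>
  have triv: "nverts (Bs c) = 1" if c: "c \<in> pverts K" for c
  proof (rule ccontr)
    assume "nverts (Bs c) \<noteq> 1"
    then have n2: "2 \<le> nverts (Bs c)"
      using cgraph_card_ge_1[OF branchingD(2)[OF br c]] by (simp add: nverts_def)
    let ?R = "attach K Bs (pverts K - {c})"
    have R: "P = glue ?R (Bs c)" "joint ?R (Bs c) c" using attach_split[OF br c] KB(2) by auto
    have pR: "p \<in> pverts ?R" using pK by (simp add: pverts_attach)
    show False
    proof (cases "c = p")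
      case True
      note j3 = joint_three[OF P(2)[unfolded R(1)[unfolded True]] R(2)[unfolded True]]
      have "K1 = glue (glue A (Bs c)) ?R" unfolding P(1) R(1) by (auto simp: glue_def)
      moreover have "2 \<le> nverts ?R"
      proof -
        have "card (pverts K) \<le> card (pverts ?R)"
          using cgraphD(1)[OF jointD(1)[OF R(2)]] by (intro card_mono) (auto simp: pverts_attach)
        then show ?thesis using iscore_nverts[OF KB(3)] by (simp add: nverts_def)
      qed
      ultimately have "nverts P \<le> nverts ?R"
        using min[of "glue A (Bs c)" ?R p] j3(4) P(3) True by simp
      then show False using nverts_glue[OF R(2)] R(1) n2 by simp
    next
      case False
      have jA: "joint A ?R p"
        using P(2) pR jointD(1)[OF R(2)] unfolding R(1) by (auto simp: joint_def)
      have "p \<notin> pverts (Bs c)" using joint_unique[OF R(2) pR] False by auto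
      then have "joint (glue A ?R) (Bs c) c"
        using cgraph_glue[OF jA] R(2) P(2) unfolding R(1) by (auto simp: joint_def)
      moreover have "K1 = glue (glue A ?R) (Bs c)" unfolding P(1) R(1) by (simp add: glue_assoc)
      ultimately have "nverts P \<le> nverts (Bs c)" using min n2 P(3) by simp
      then show False using nverts_branch_less[OF br iscore_nverts[OF KB(3)] c] KB(2) by simp
    qed
  qed
  have "attach K Bs S = K" if "S \<subseteq> pverts K" for S
    using br that
  proof (induct rule: attach_induct)
    case (insert c S)
    then show ?case using attach_trivial[OF br insert(2) triv[OF insert(2)]] by simp
  qed simp
  then have "P = K" using KB(2) by simp
  then show thesis using that P(1-3) KB(3) by blast
qed

subsection \<open>Chains of squares\<close>

definition cyc_at :: "'a pair_pre_digraph \<Rightarrow> 'a \<Rightarrow> 'a rel set" where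
  "cyc_at X z = {C \<in> cycles X. z \<in> Field C}"

text \<open>The data of a linear chain of \<open>s\<close> squares with ends \<open>u\<close> and \<open>w\<close> that enter the argument; the
  shape itself is not recorded.\<close>

definition sqchain :: "'a pair_pre_digraph \<Rightarrow> 'a \<Rightarrow> 'a \<Rightarrow> nat \<Rightarrow> bool" where
  "sqchain X u w s \<longleftrightarrow> cactus X \<and> u \<in> pverts X \<and> w \<in> pverts X \<and> u \<noteq> w \<and> 1 \<le> s \<and>
     ngeo (parcs X) u w = 2 ^ s \<and> gsum X u = 2 ^ (s + 2) - 3 \<and> gsum X w = 2 ^ (s + 2) - 3 \<and>
     (\<forall>C\<in>cycles X. card (Field C) = 4) \<and> \<Union>(cycles X) = parcs X \<and>
     (\<forall>z. card (cyc_at X z) \<le> 2) \<and> card (cyc_at X u) = 1 \<and> card (cyc_at X w) = 1"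

lemma sqchain_sym: assumes "sqchain X u w s" shows "sqchain X w u s"
proof -
  have "cgraph X" using assms by (simp add: sqchain_def cactus_cgraph)
  then have "ngeo (parcs X) w u = ngeo (parcs X) u w" using ngeo_sym[OF cgraphD(4)] by metis
  then show ?thesis using assms unfolding sqchain_def by auto
qed

lemma cyc_at_sq:
  assumes "distinct [a, b, c, d]"
  shows "cyc_at (sq a b c d) z = (if z \<in> {a, b, c, d} then {carcs [a, b, c, d]} else {})"
  unfolding cyc_at_def cycles_sq[OF assms] using Field_carcs[of "[a, b, c, d]"] by auto

lemma sqchain_sq: assumes d: "distinct [a, b, c, d]" shows "sqchain (sq a b c d) a c 1"
proof -
  have "gsum (sq a b c d) a = 5" "gsum (sq a b c d) c = 5" using gsum_sq[OF d] by auto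
  moreover have "card (Field (carcs [a, b, c, d])) = 4"
    using Field_carcs[of "[a, b, c, d]"] d by simp
  moreover have "card (cyc_at (sq a b c d) z) \<le> 2" for z using cyc_at_sq[OF d] by simp
  moreover have "card (cyc_at (sq a b c d) z) = 1" if "z = a \<or> z = c" for z
    using cyc_at_sq[OF d] that by auto
  ultimately show ?thesis
    unfolding sqchain_def using sq_props(2)[OF d] ngeo_sq(1)[OF d] cycles_sq[OF d] d
    by (simp add: parcs_sq)
qed

text \<open>The new square adds \<open>5 - 1\<close> paths at \<open>w\<close>, seen from
  \<open>u\<close> with multiplicity \<open>2 ^ s\<close>, so \<open>gsum\<close> at
  \<open>u\<close> grows by \<open>2 ^ (s + 2)\<close>. From \<open>r\<close> the square counts 5
  and the old chain without \<open>w\<close> counts twice. Both agree with the closed form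
  \<open>2 ^ (s + 2) - 3\<close> for \<open>s + 1\<close> squares.\<close>

lemma sqchain_append:
  assumes X: "sqchain X u w s" and d: "distinct [w, x, r, y]" and j: "joint X (sq w x r y) w"
  shows "sqchain (glue X (sq w x r y)) u r (Suc s)"
proof -
  let ?S = "sq w x r y" and ?N = "glue X (sq w x r y)"
  note x = X[unfolded sqchain_def]
  note j' = j[unfolded joint_sym[of X]]
  have u: "u \<in> pverts X" and w: "w \<in> pverts X" and r: "r \<in> pverts ?S" and uw: "u \<noteq> w" and rw: "r \<noteq> w"
    using x d by auto
  have cX: "cgraph X" by (rule jointD(1)[OF j])
  have uS: "u \<notin> pverts ?S" using joint_unique[OF j u] uw by auto
  have rX: "r \<notin> pverts X" using joint_unique[OF j _ r] rw by auto
  have cyc: "cycles ?N = cycles X \<union> {carcs [w, x, r, y]}" using cycles_glue[OF j] cycles_sq[OF d] by simp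
  have FX: "Field C \<subseteq> pverts X" if "C \<in> cycles X" for C by (rule cyclesD(5)[OF cX that])
  have at: "cyc_at ?N z = cyc_at X z \<union> cyc_at ?S z" for z
    unfolding cyc_at_def cycles_glue[OF j] by auto
  have none: "cyc_at X z = {}" if "z \<notin> pverts X" for z using FX that unfolding cyc_at_def by auto
  have finX: "finite (cyc_at X z)" for z unfolding cyc_at_def using finite_cycles[OF cX] by simp
  have S1: "card (cyc_at ?S z) \<le> 1" for z using cyc_at_sq[OF d] by simp
  have atu: "card (cyc_at ?N u) = 1" unfolding at using cyc_at_sq[OF d, of u] uS x by auto
  have atr: "card (cyc_at ?N r) = 1" unfolding at using cyc_at_sq[OF d, of r] none[OF rX] by simp
  have at2: "card (cyc_at ?N z) \<le> 2" for z
  proof (cases "z \<in> pverts X")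
    case False
    then show ?thesis unfolding at none[OF False] using S1[of z] by simp
  next
    case True
    show ?thesis
    proof (cases "z = w")
      case True
      have "card (cyc_at ?N w) \<le> card (cyc_at X w) + card (cyc_at ?S w)"
        unfolding at by (rule card_Un_le)
      then show ?thesis using S1[of w] x True by simp
    next
      case False
      then have "z \<notin> pverts ?S" using joint_unique[OF j True] by auto
      then have "cyc_at ?S z = {}" using cyc_at_sq[OF d, of z] by auto
      then show ?thesis unfolding at using x by simp
    qed
  qed
  have npw: "ngeo (parcs X) w u = 2 ^ s" using ngeo_sym[OF cgraphD(4)[OF cX], of w u] x by simp
  have npS: "ngeo (parcs ?S) w r = 2" "ngeo (parcs ?S) r w = 2" using ngeo_sq(1,2)[OF d] by (simp_all add: parcs_sq)
  have WS: "gsum ?S w = 5" "gsum ?S r = 5" using gsum_sq[OF d] by auto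
  have ngeo: "ngeo (parcs ?N) u r = 2 ^ Suc s" using ngeo_glue_cross[OF j u r] npS x by simp
  have Wu: "gsum ?N u = 2 ^ (Suc s + 2) - 3" using gsum_glue[OF j u] WS x by simp
  have "gsum ?N r = gsum (glue ?S X) r" by (simp add: glue_comm)
  also have "\<dots> = 2 ^ (Suc s + 2) - 3" using gsum_glue[OF j' r] WS npS x by simp
  finally have Wr: "gsum ?N r = 2 ^ (Suc s + 2) - 3" .
  have ca: "cactus ?N" using cactus_glue[OF j] x sq_props(2)[OF d] by simp
  have c4: "card (Field C) = 4" if "C \<in> cycles ?N" for C
    using that x d Field_carcs[of "[w, x, r, y]"] unfolding cyc by auto
  have pa: "\<Union>(cycles ?N) = parcs ?N" unfolding cyc parcs_glue using x by (auto simp: parcs_sq)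
  show ?thesis
    unfolding sqchain_def using ca u r uS ngeo Wu Wr c4 pa at2 atu atr by auto
qed

text \<open>\<open>X\<close> consists of the squares found so far, and \<open>K1\<close> and
  \<open>K2\<close> are the parts beyond its two ends, which may still contain squares.\<close>

definition config :: "'a pair_pre_digraph \<Rightarrow> 'a pair_pre_digraph \<Rightarrow> 'a pair_pre_digraph \<Rightarrow>
    'a pair_pre_digraph \<Rightarrow> 'a \<Rightarrow> 'a \<Rightarrow> nat \<Rightarrow> bool" where
  "config G K1 X K2 u w s \<longleftrightarrow> G = glue (glue K1 X) K2 \<and> joint K1 X u \<and> joint (glue K1 X) K2 w \<and> sqchain X u w s"

lemma config_meet:
  assumes "config G K1 X K2 u w s"
  shows "pverts K1 \<inter> pverts X = {u}" "pverts X \<inter> pverts K2 = {w}" "pverts K1 \<inter> pverts K2 = {}"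
proof -
  have i: "pverts K1 \<inter> pverts X = {u}" "(pverts K1 \<union> pverts X) \<inter> pverts K2 = {w}"
    "u \<noteq> w" "w \<in> pverts X"
    using assms by (simp_all add: config_def joint_def sqchain_def)
  show "pverts K1 \<inter> pverts X = {u}" by (rule i)
  have "w \<notin> pverts K1" using i(1,3,4) by auto
  then show "pverts K1 \<inter> pverts K2 = {}" using i(2) by auto
  show "pverts X \<inter> pverts K2 = {w}" using i(2,4) by auto
qed

lemma config_cgraph:
  assumes "config G K1 X K2 u w s" shows "cgraph K1" "cgraph X" "cgraph K2"
  using assms by (auto simp: config_def joint_def)

lemma config_sym: assumes "config G K1 X K2 u w s" shows "config G K2 X K1 w u s"
proof -
  note m = config_meet[OF assms] and c = config_cgraph[OF assms]
  have j: "joint K2 X w" using m(2) c by (simp add: joint_def Int_commute)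
  have "pverts (glue K2 X) \<inter> pverts K1 = {u}" using m(1,3) by auto
  then have "joint (glue K2 X) K1 u" using cgraph_glue[OF j] c by (simp add: joint_def)
  moreover have "G = glue (glue K2 X) K1" using assms by (auto simp: config_def glue_def)
  moreover have "sqchain X u w s" using assms by (simp add: config_def)
  then have "sqchain X w u s" by (rule sqchain_sym)
  ultimately show ?thesis using j unfolding config_def by simp
qed

text \<open>Seen from \<open>w\<close>, the part before \<open>K2\<close> contains \<open>u\<close>
  with \<open>2 ^ s\<close> shortest paths, and \<open>1 \<le> s\<close> makes this at least 2. So
  \<open>branch_behind_square\<close> applies and moves one square from \<open>K2\<close> to the
  chain.\<close>

lemma config_extend:
  assumes opt: "optimal G" and config: "config G K1 X K2 u w s" and C: "C \<in> cycles K2" "card (Field C) = 4"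
  shows "\<exists>X' K2' w'. config G K1 X' K2' u w' (Suc s) \<and> nverts K2' < nverts K2"
proof -
  note m = config_meet[OF config] and cg = config_cgraph[OF config]
  have G: "G = glue (glue K1 X) K2" and j1: "joint K1 X u" and j2: "joint (glue K1 X) K2 w"
    and X: "sqchain X u w s"
    using config by (simp_all add: config_def)
  have s1: "1 \<le> s" and ngeo: "ngeo (parcs X) u w = 2 ^ s" and uw: "u \<in> pverts X" "w \<in> pverts X"
    using X by (simp_all add: sqchain_def)
  have "ngeo (parcs (glue K1 X)) w u = ngeo (parcs X) w u"
    unfolding glue_comm[of K1 X] by (rule ngeo_glue_same[OF j1[unfolded joint_sym[of K1]] uw(2,1)])
  also have "\<dots> = 2 ^ s" using ngeo ngeo_sym[OF cgraphD(4)[OF cg(2)], of w u] by simp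
  finally have "2 \<le> ngeo (parcs (glue K1 X)) w u"
    using s1 power_increasing[of 1 s "2 :: nat"] by simp
  moreover have "u \<in> pverts (glue K1 X)" using uw by simp
  ultimately obtain x r y B' where B: "distinct [w, x, r, y]" "K2 = glue (sq w x r y) B'"
    "joint (sq w x r y) B' r"
    using branch_behind_square[OF opt[unfolded G] j2 _ _ C] by metis
  let ?S = "sq w x r y"
  have S2: "pverts ?S \<subseteq> pverts K2" "pverts B' \<subseteq> pverts K2" unfolding B(2) by auto
  have wr: "w \<noteq> r" using B(1) by auto
  have wB: "w \<notin> pverts B'" using joint_unique[OF B(3), of w] wr by auto
  have "pverts X \<inter> pverts ?S = {w}" using m(2) S2(1) by auto
  then have jX: "joint X ?S w" using cg(2) sq_props(1)[OF B(1)] by (simp add: joint_def)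
  have "pverts K1 \<inter> pverts (glue X ?S) = {u}" using m(1,3) S2(1) by auto
  then have j1': "joint K1 (glue X ?S) u" using cg(1) cgraph_glue[OF jX] by (simp add: joint_def)
  have "pverts K1 \<inter> pverts B' = {}" "pverts X \<inter> pverts B' = {}" "pverts ?S \<inter> pverts B' = {r}"
    using m(2,3) S2(2) wB B(3) by (auto simp: joint_def)
  then have "pverts (glue K1 (glue X ?S)) \<inter> pverts B' = {r}" unfolding pverts_glue by blast
  then have j2': "joint (glue K1 (glue X ?S)) B' r"
    using cgraph_glue[OF j1'] jointD(2)[OF B(3)] by (simp add: joint_def)
  have "G = glue (glue K1 (glue X ?S)) B'" unfolding G B(2) by (simp add: glue_assoc)
  then have "config G K1 (glue X ?S) B' u r (Suc s)"
    using j1' j2' sqchain_append[OF X B(1) jX] by (simp add: config_def)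
  moreover have "nverts B' < nverts K2" using nverts_glue[OF B(3)] sq_props(4)[OF B(1)] B(2) by simp
  ultimately show ?thesis by blast
qed

lemma config_saturate:
  assumes opt: "optimal G"
  shows "config G K1 X K2 u w s \<Longrightarrow> \<exists>K1 X K2 u w s. config G K1 X K2 u w s \<and>
    (\<forall>C\<in>cycles K1. card (Field C) \<noteq> 4) \<and> (\<forall>C\<in>cycles K2. card (Field C) \<noteq> 4)"
proof (induct "nverts K1 + nverts K2" arbitrary: K1 X K2 u w s rule: less_induct)
  case less
  show ?case
  proof (cases "\<exists>C\<in>cycles K2. card (Field C) = 4")
    case True
    then obtain C where C: "C \<in> cycles K2" "card (Field C) = 4" by blast
    obtain X' K2' w' where "config G K1 X' K2' u w' (Suc s)" "nverts K2' < nverts K2"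
      using config_extend[OF opt less(2) C] by blast
    then show ?thesis using less(1)[of K1 K2' X' u w' "Suc s"] by simp
  next
    case no2: False
    show ?thesis
    proof (cases "\<exists>C\<in>cycles K1. card (Field C) = 4")
      case True
      then obtain C where C: "C \<in> cycles K1" "card (Field C) = 4" by blast
      obtain X' K1' u' where "config G K2 X' K1' w u' (Suc s)" "nverts K1' < nverts K1"
        using config_extend[OF opt config_sym[OF less(2)] C] by blast
      then show ?thesis using less(1)[of K2 K1' X' w u' "Suc s"] by simp
    next
      case False
      then show ?thesis using less(2) no2 by blast
    qed
  qed
qed

text \<open>\<open>square_branches\<close> treats two of the four sides, its rotation the other two.
  If no adjacent vertices both carry branches, one antipodal pair is bare.\<close>

lemma trivial_sides:
  assumes opt: "optimal (attach (sq a b c d) Bs {a, b, c, d})" and br: "branching (sq a b c d) Bs"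
    and dist: "distinct [a, b, c, d]"
  shows "(nverts (Bs b) = 1 \<and> nverts (Bs d) = 1) \<or> (nverts (Bs a) = 1 \<and> nverts (Bs c) = 1)"
proof -
  have r: "sq b c d a = sq a b c d" by (rule sq_rotate)
  have "{b, c, d, a} = {a, b, c, d}" by auto
  then have "(nverts (Bs c) = 1 \<or> nverts (Bs d) = 1) \<and> (nverts (Bs b) = 1 \<or> nverts (Bs a) = 1)"
    using square_branches[of b c d a Bs] opt br dist unfolding r by auto
  then show ?thesis using square_branches[OF opt br dist] by auto
qed

lemma config_base:
  assumes opt: "optimal (attach (sq a b c d) Bs {a, b, c, d})" and br: "branching (sq a b c d) Bs"
    and dist: "distinct [a, b, c, d]" and triv: "nverts (Bs b) = 1" "nverts (Bs d) = 1"
  shows "config (attach (sq a b c d) Bs {a, b, c, d}) (Bs a) (sq a b c d) (Bs c) a c 1"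
proof -
  let ?S = "sq a b c d"
  have ja: "joint ?S (Bs a) a" using joint_attach[OF br, of "{}" a] by simp
  then have ja': "joint (Bs a) ?S a" unfolding joint_sym[of "Bs a"] .
  have "attach ?S Bs {a} = glue (Bs a) ?S" using attach_insert[of ?S Bs a "{}"] by (simp add: glue_comm)
  moreover have "joint (attach ?S Bs {a}) (Bs c) c" using dist by (intro joint_attach[OF br]) auto
  ultimately have jc: "joint (glue (Bs a) ?S) (Bs c) c" by simp
  have "{a, b, c, d} = insert b (insert d {c, a})" by auto
  then have "attach ?S Bs {a, b, c, d} = attach ?S Bs {c, a}"
    using attach_trivial[OF br, of b] attach_trivial[OF br, of d] triv by simp
  then have "attach ?S Bs {a, b, c, d} = glue (glue (Bs a) ?S) (Bs c)"
    using attach_insert[of ?S Bs c "{a}"] \<open>attach ?S Bs {a} = glue (Bs a) ?S\<close> by simp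
  then show ?thesis using ja' jc sqchain_sq[OF dist] by (simp add: config_def)
qed

lemma square_decomp:
  assumes "cactus G" "C \<in> cycles G" "card (Field C) = 4"
  obtains a b c d Bs where "distinct [a, b, c, d]" "C = carcs [a, b, c, d]" "Field C = {a, b, c, d}"
    "branching (sq a b c d) Bs" "G = attach (sq a b c d) Bs {a, b, c, d}"
proof -
  obtain Bs where Bs: "branching (core C) Bs" "G = attach (core C) Bs (Field C)"
    using cycle_decomp[OF assms(1,2)] by metis
  obtain a b c d where s: "distinct [a, b, c, d]" "C = carcs [a, b, c, d]" "core C = sq a b c d"
    "Field C = {a, b, c, d}"
    using square_coreE[OF cactus_cgraph[OF assms(1)] assms(2,3)] by metis
  show thesis by (rule that[OF s(1,2,4)]) (use Bs s(3,4) in simp_all)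
qed

lemma optimal_config:
  assumes opt: "optimal G" and C: "C \<in> cycles G" "card (Field C) = 4"
  shows "\<exists>K1 X K2 u w s. config G K1 X K2 u w s \<and>
    (\<forall>C\<in>cycles K1. card (Field C) \<noteq> 4) \<and> (\<forall>C\<in>cycles K2. card (Field C) \<noteq> 4)"
proof -
  obtain a b c d Bs where s: "distinct [a, b, c, d]" "branching (sq a b c d) Bs"
    "G = attach (sq a b c d) Bs {a, b, c, d}"
    using square_decomp[OF opt_cactus[OF opt] C] by metis
  have "\<exists>K1 X K2 u w s. config G K1 X K2 u w s"
    using trivial_sides[OF opt[unfolded s(3)] s(2,1)]
  proof
    assume t: "nverts (Bs b) = 1 \<and> nverts (Bs d) = 1"
    then have "config G (Bs a) (sq a b c d) (Bs c) a c 1"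
      using config_base[OF opt[unfolded s(3)] s(2,1)] s(3) by simp
    then show ?thesis by blast
  next
    assume t: "nverts (Bs a) = 1 \<and> nverts (Bs c) = 1"
    have e: "sq b c d a = sq a b c d" "{b, c, d, a} = {a, b, c, d}" by (auto simp: sq_rotate)
    have d: "distinct [b, c, d, a]" using s(1) by auto
    have "config G (Bs b) (sq b c d a) (Bs d) b d 1"
      using config_base[of b c d a Bs] opt s(2,3) d t unfolding e by simp
    then show ?thesis by blast
  qed
  then show ?thesis using config_saturate[OF opt] by blast
qed

text \<open>Take a leaf block \<open>P\<close> off \<open>K1\<close> and compare its place with
  \<open>w\<close>, the other end of the chain. Optimality gives
  \<open>nverts A \<le> nverts K2\<close> for the remainder \<open>A\<close> of \<open>K1\<close>.
  Putting \<open>P\<close> back adds one vertex for an edge and two for a triangle: these are the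
  constants 1 and 2.\<close>

lemma config_balance:
  assumes opt: "optimal G" and config: "config G K1 X K2 u w s"
    and tri: "\<And>C. C \<in> cycles K1 \<Longrightarrow> card (Field C) = 3" "\<And>C. C \<in> cycles K2 \<Longrightarrow> card (Field C) = 3"
  shows "nverts K1 \<le> nverts K2 + 2 \<and> (cycles K1 = {} \<longrightarrow> nverts K1 \<le> nverts K2 + 1)"
proof (cases "2 \<le> nverts K1")
  case False
  then show ?thesis by simp
next
  case True
  note m = config_meet[OF config] and cg = config_cgraph[OF config]
  have G: "G = glue (glue K1 X) K2" and j1: "joint K1 X u" and j2: "joint (glue K1 X) K2 w"
    and X: "sqchain X u w s"
    using config by (simp_all add: config_def)
  note x = X[unfolded sqchain_def]
  have cac: "cactus K1" "cactus K2"
    using opt_cactus[OF opt] cactus_glue[OF j1] cactus_glue[OF j2] G by auto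
  obtain A P p where P: "K1 = glue A P" "joint A P p" "u \<in> pverts A" "iscore P"
    using leaf_block[OF cac(1) True jointD(3)[OF j1]] by metis
  have cycK1: "cycles K1 = cycles A \<union> cycles P" using cycles_glue[OF P(2)] P(1) by simp
  have nvP: "nverts P \<le> 3 \<and> (cycles P = {} \<longrightarrow> nverts P = 2)"
  proof (cases "\<exists>a b. a \<noteq> b \<and> P = edge a b")
    case True
    then show ?thesis using edge_props(1) by fastforce
  next
    case False
    then have "cycles P = {parcs P}" "pverts P = Field (parcs P)" using P(4) by (auto simp: iscore_def)
    then show ?thesis using tri(1)[of "parcs P"] cycK1 by (simp add: nverts_def)
  qed
  have uX: "u \<in> pverts X" "w \<in> pverts X" using x by auto
  have AK: "pverts A \<subseteq> pverts K1" "pverts P \<subseteq> pverts K1" unfolding P(1) by auto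
  have "pverts A \<inter> pverts X = {u}" using m(1) AK(1) P(3) uX by blast
  then have jA: "joint A X u" using jointD(1)[OF P(2)] cg(2) by (simp add: joint_def)
  have "pverts (glue A X) \<inter> pverts K2 = {w}" using m(2,3) AK(1) by auto
  then have jA2: "joint (glue A X) K2 w" using cgraph_glue[OF jA] cg(3) by (simp add: joint_def)
  let ?H = "glue (glue A X) K2"
  have "pverts X \<inter> pverts P \<subseteq> {p}"
  proof
    fix z assume z: "z \<in> pverts X \<inter> pverts P"
    then have "z = u" using m(1) AK(2) by blast
    then show "z \<in> {p}" using joint_unique[OF P(2) P(3)] z by simp
  qed
  moreover have "pverts K2 \<inter> pverts P = {}" using m(3) AK(2) by blast
  ultimately have "pverts ?H \<inter> pverts P = {p}" using P(2) by (auto simp: joint_def)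
  then have jH: "joint ?H P p" using cgraph_glue[OF jA2] jointD(2)[OF P(2)] by (simp add: joint_def)
  have GH: "G = glue ?H P" unfolding G P(1) by (auto simp: glue_def)
  have "gsum ?H w \<le> gsum ?H p"
    using reloc_le[OF opt[unfolded GH] jH _ iscore_nverts[OF P(4)], of w] uX by simp
  have pA: "p \<in> pverts A" by (rule jointD(3)[OF P(2)])
  have cacA: "cactus A" using cactus_glue[OF P(2)] cac(1) P(1) by simp
  have "\<forall>u\<in>pverts A. \<forall>v\<in>pverts A. ngeo (parcs A) u v = 1"
    by (rule ngeo_triangle_cactus[OF cacA]) (use tri(1) cycK1 in blast)
  then have oneA: "ngeo (parcs A) y z = 1" if "y \<in> pverts A" "z \<in> pverts A" for y z using that by blast
  have "\<forall>u\<in>pverts K2. \<forall>v\<in>pverts K2. ngeo (parcs K2) u v = 1"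
    by (rule ngeo_triangle_cactus[OF cac(2) tri(2)])
  then have oneK: "ngeo (parcs K2) y z = 1" if "y \<in> pverts K2" "z \<in> pverts K2" for y z using that by blast
  have WA: "gsum A z = int (nverts A)" if "z \<in> pverts A" for z
    by (rule ngeo_one_gsum_gtotal(1)[OF jointD(1)[OF P(2)] oneA that])
  have WK: "gsum K2 w = int (nverts K2)"
    by (rule ngeo_one_gsum_gtotal(1)[OF cg(3) oneK jointD(4)[OF jA2]])
  define t :: int where "t = 2 ^ s"
  have t2: "2 \<le> t" unfolding t_def using x power_increasing[of 1 s "2 :: int"] by simp
  have npw: "int (ngeo (parcs X) u w) = t" "int (ngeo (parcs X) w u) = t"
    using x ngeo_sym[OF cgraphD(4)[OF cg(2)], of w u] by (simp_all add: t_def)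
  have "gsum ?H p = gsum (glue A X) p + int (ngeo (parcs (glue A X)) p w) * (gsum K2 w - 1)"
    by (rule gsum_glue[OF jA2]) (use pA in simp)
  also have "gsum (glue A X) p = int (nverts A) + (gsum X u - 1)"
    using gsum_glue[OF jA pA] WA[OF pA] oneA[OF pA P(3)] by simp
  also have "int (ngeo (parcs (glue A X)) p w) = t"
    using ngeo_glue_cross[OF jA pA uX(2)] oneA[OF pA P(3)] npw by simp
  finally have Hp: "gsum ?H p = int (nverts A) + (gsum X u - 1) + t * (int (nverts K2) - 1)" unfolding WK .
  have "gsum ?H w = gsum (glue A X) w + (int (nverts K2) - 1)"
    using gsum_glue[OF jA2, of w] uX WK by simp
  also have "gsum (glue A X) w = gsum X w + t * (int (nverts A) - 1)"
    using gsum_glue[OF jA[unfolded joint_sym[of A]] uX(2)] WA[OF P(3)] npw by (simp add: glue_comm)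
  finally have Hw: "gsum ?H w = gsum X w + t * (int (nverts A) - 1) + (int (nverts K2) - 1)" .
  \<comment> \<open>Both ends see the chain equally, so its own contribution cancels. What is left
    is the difference of the sizes of \<open>A\<close> and \<open>K2\<close> times
    \<open>t - 1\<close>, which is positive.\<close>
  have "gsum X u = gsum X w" using x by simp
  then have "(t - 1) * (int (nverts A) - int (nverts K2)) \<le> 0"
    using \<open>gsum ?H w \<le> gsum ?H p\<close> unfolding Hp Hw by (simp add: algebra_simps)
  then have "nverts A \<le> nverts K2" using t2 by (simp add: mult_le_0_iff)
  moreover have "nverts K1 + 1 = nverts A + nverts P" using nverts_glue[OF P(2)] P(1) by simp
  ultimately show ?thesis using nvP cycK1 by auto
qed

subsection \<open>Translation to balanced square chains\<close>

text \<open>Guarantees that the \<open>div 2\<close> in \<open>gpn\<close> is exact.\<close>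

lemma even_sum_off_diagonal:
  fixes f :: "'a \<Rightarrow> 'a \<Rightarrow> nat"
  assumes "finite V" "\<And>x y. f x y = f y x"
  shows "even (\<Sum>u\<in>V. \<Sum>v\<in>V - {u}. f u v)"
  using assms(1)
proof (induct V)
  case (insert x V)
  have "(\<Sum>v\<in>insert x V - {u}. f u v) = f u x + (\<Sum>v\<in>V - {u}. f u v)" if "u \<in> V" for u
  proof -
    have "insert x V - {u} = insert x (V - {u})" using insert(2) that by auto
    then show ?thesis using insert(1,2) by simp
  qed
  then have "(\<Sum>u\<in>V. \<Sum>v\<in>insert x V - {u}. f u v) = (\<Sum>u\<in>V. f u x) + (\<Sum>u\<in>V. \<Sum>v\<in>V - {u}. f u v)"
    by (simp add: sum.distrib)
  moreover have "insert x V - {x} = V" using insert(2) by auto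
  moreover have "(\<Sum>u\<in>V. f u x) = (\<Sum>v\<in>V. f x v)" by (rule sum.cong) (simp_all add: assms(2)[of _ x])
  ultimately have "(\<Sum>u\<in>insert x V. \<Sum>v\<in>insert x V - {u}. f u v)
      = 2 * (\<Sum>v\<in>V. f x v) + (\<Sum>u\<in>V. \<Sum>v\<in>V - {u}. f u v)"
    using insert(1,2) by simp
  then show ?case using insert(3) by simp
qed simp

lemma gpn_gtotal:
  assumes "cgraph G" shows "2 * int (gpn G) = gtotal G + int (nverts G)"
proof -
  let ?V = "pverts G" and ?n = "\<lambda>u v. ngeo (parcs G) u v"
  have fin: "finite ?V" by (rule cgraphD(1)[OF assms])
  let ?S = "\<Sum>u\<in>?V. \<Sum>v\<in>?V - {u}. ?n u v"
  have "(\<Sum>u\<in>?V. \<Sum>v\<in>?V - {u}. gpn_pair G u v) = ?S"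
    using gpn_pair_ngeo by (intro sum.cong) auto
  then have g: "gpn G = ?S div 2 + nverts G" by (simp add: gpn_def nverts_def)
  have "even ?S" by (rule even_sum_off_diagonal[OF fin]) (rule ngeo_sym[OF cgraphD(4)[OF assms]])
  then have S: "2 * (?S div 2) = ?S" by simp
  have "gtotal G = (\<Sum>u\<in>?V. 1 + (\<Sum>v\<in>?V - {u}. int (?n u v)))"
    unfolding gtotal_def gsum_def by (rule sum.cong) (simp_all add: sum.remove[OF fin])
  also have "\<dots> = int (nverts G) + int ?S" by (simp add: sum.distrib nverts_def)
  finally have "gtotal G = int (nverts G) + int ?S" .
  then show ?thesis using g S by linarith
qed

lemma optimal_of_gpn:
  fixes G :: "'a pair_pre_digraph"
  assumes G: "G \<in> cactus_class n k"
    and max: "\<forall>G' \<in> cactus_class n k. gpn (G' :: 'a pair_pre_digraph) \<le> gpn G"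
  shows "optimal G"
  unfolding optimal_def
proof (intro conjI allI impI)
  show cG: "cactus G" using G by (simp add: cactus_class_def)
  fix N :: "'a pair_pre_digraph"
  assume N: "cactus N" "nverts N = nverts G" "ncycles N = ncycles G"
  then have "N \<in> cactus_class n k" using G by (simp add: cactus_class_def nverts_def ncycles_def)
  then have "gpn N \<le> gpn G" using max by blast
  then show "gtotal N \<le> gtotal G"
    using gpn_gtotal[OF cactus_cgraph[OF N(1)]] gpn_gtotal[OF cactus_cgraph[OF cG]] N(2) by simp
qed

text \<open>The second bound is nonnegativity of \<open>excess\<close>: beyond the first vertex,
  every cycle accounts for at least two vertices and a square for three.\<close>

lemma squares_bound:
  assumes H: "cactus H"
  shows "card (squares H) \<le> ncycles H" "card (squares H) + 2 * ncycles H + 1 \<le> nverts H"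
proof -
  have fin: "finite (cycles H)" by (rule finite_cycles[OF cactus_cgraph[OF H]])
  have sub: "squares H \<subseteq> cycles H" by (auto simp: squares_def)
  show "card (squares H) \<le> ncycles H" unfolding ncycles_def by (rule card_mono[OF fin sub])
  have "(\<Sum>C\<in>cycles H. 2 + (if C \<in> squares H then 1 else 0)) \<le> (\<Sum>C\<in>cycles H. int (card (Field C)) - 1)"
  proof (rule sum_mono)
    fix C assume C: "C \<in> cycles H"
    show "2 + (if C \<in> squares H then 1 else 0) \<le> int (card (Field C)) - 1"
      using cyclesD(4)[OF cactus_cgraph[OF H] C] by (auto simp: squares_def)
  qed
  moreover have "(\<Sum>C\<in>cycles H. 2 + (if C \<in> squares H then 1 else 0)) = 2 * int (ncycles H) + int (card (squares H))"
    using fin sub by (simp add: sum.distrib ncycles_def sum.If_cases Int_absorb1 inf.absorb_iff2[symmetric])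
  ultimately show "card (squares H) + 2 * ncycles H + 1 \<le> nverts H"
    using excess_nonneg[OF H] unfolding excess_def by linarith
qed

lemma optimal_cycle_card:
  assumes opt: "optimal G" and C: "C \<in> cycles G"
  shows "card (Field C) = 3 \<or> card (Field C) = 4"
  using optimal_cycle_length[OF opt C] cyclesD(4)[OF cactus_cgraph[OF opt_cactus[OF opt]] C] by linarith

text \<open>If there is a triangle, the excess vanishes and the vertices beyond the first are
  exactly two per triangle and three per square, so the order determines the number of squares and
  lies below \<open>3 * ncycles G + 1\<close>. Without triangles all cycles are squares, and
  \<open>squares_bound\<close> puts the graph into the other case.\<close>

lemma optimal_squares:
  assumes opt: "optimal G"
  shows "card (squares G) = (if nverts G \<ge> 3 * ncycles G + 1 then ncycles G else nverts G - 2 * ncycles G - 1)"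
    "nverts G \<ge> 3 * ncycles G + 1 \<Longrightarrow> \<forall>C\<in>cycles G. card (Field C) = 4"
proof -
  have cG: "cactus G" using opt by (rule opt_cactus)
  have fin: "finite (cycles G)" by (rule finite_cycles[OF cactus_cgraph[OF cG]])
  have "(card (squares G) = (if nverts G \<ge> 3 * ncycles G + 1 then ncycles G else nverts G - 2 * ncycles G - 1)) \<and>
     (nverts G \<ge> 3 * ncycles G + 1 \<longrightarrow> (\<forall>C\<in>cycles G. card (Field C) = 4))"
  proof (cases "\<exists>C\<in>cycles G. card (Field C) = 3")
    case False
    then have all4: "card (Field C) = 4" if "C \<in> cycles G" for C
      using optimal_cycle_card[OF opt that] that by blast
    then have "squares G = cycles G" by (auto simp: squares_def)
    then have "card (squares G) = ncycles G" by (simp add: ncycles_def)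
    then show ?thesis using squares_bound(2)[OF cG] all4 by auto
  next
    case True
    then obtain T where T: "T \<in> cycles G" "card (Field T) = 3" by blast
    have e0: "excess G = 0" by (rule optimal_triangle_excess[OF opt T])
    have sub: "squares G \<subseteq> cycles G - {T}" using T(2) by (auto simp: squares_def)
    have "card (squares G) \<le> card (cycles G - {T})" using fin sub by (intro card_mono) auto
    also have "\<dots> < ncycles G" unfolding ncycles_def using fin T(1) by (intro psubset_card_mono) auto
    finally have less: "card (squares G) < ncycles G" .
    have "(\<Sum>C\<in>cycles G. int (card (Field C)) - 1) = (\<Sum>C\<in>cycles G. 2 + (if C \<in> squares G then 1 else 0))"
    proof (rule sum.cong)
      fix C assume C: "C \<in> cycles G"
      show "int (card (Field C)) - 1 = 2 + (if C \<in> squares G then 1 else 0)"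
        using optimal_cycle_card[OF opt C] C by (auto simp: squares_def)
    qed simp
    also have "\<dots> = (\<Sum>C\<in>cycles G. 2) + (\<Sum>C\<in>cycles G. if C \<in> squares G then 1 else 0)"
      by (rule sum.distrib)
    also have "(\<Sum>C\<in>cycles G. if C \<in> squares G then 1 else (0 :: int)) = (\<Sum>C\<in>squares G. 1)"
      using fin sub by (intro sum.mono_neutral_cong_right) auto
    finally have "int (nverts G) - 1 = 2 * int (ncycles G) + int (card (squares G))"
      using e0 unfolding excess_def by (simp add: ncycles_def)
    then have "nverts G = 2 * ncycles G + card (squares G) + 1" by linarith
    then show ?thesis using less by auto
  qed
  then show "card (squares G) = (if nverts G \<ge> 3 * ncycles G + 1 then ncycles G else nverts G - 2 * ncycles G - 1)"
    "nverts G \<ge> 3 * ncycles G + 1 \<Longrightarrow> \<forall>C\<in>cycles G. card (Field C) = 4" by auto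
qed

text \<open>A square vertex with a trivial branch has only its two arcs on the square and is
  inactive. By \<open>trivial_sides\<close> the active vertices then lie in an antipodal
  pair.\<close>

lemma optimal_antipodal:
  assumes opt: "optimal G" shows "antipodal_cactus G"
  unfolding antipodal_cactus_def
proof (intro conjI allI impI)
  have cG: "cactus G" using opt by (rule opt_cactus)
  show "girth_restricted G"
    unfolding girth_restricted_def triangles_def squares_def
    using cG optimal_cycle_card[OF opt] by auto
  fix S assume S: "multiactive_square G S"
  then have SC: "S \<in> cycles G" "card (Field S) = 4" and two: "2 \<le> card {v \<in> Field S. active G v}"
    by (auto simp: multiactive_square_def squares_def)
  obtain a b c d Bs where s: "distinct [a, b, c, d]" "S = carcs [a, b, c, d]" "Field S = {a, b, c, d}"
    "branching (sq a b c d) Bs" "G = attach (sq a b c d) Bs {a, b, c, d}"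
    using square_decomp[OF cG SC] by metis
  note br = s(4)
  have inactive: "\<not> active G v" if v: "v \<in> {a, b, c, d}" "nverts (Bs v) = 1" for v
  proof -
    have vK: "v \<in> pverts (sq a b c d)" using v by simp
    have mem: "v \<in> pverts (Bs v)" using branchingD(3)[OF br vK] by auto
    note tr = trivial_graph[OF branchingD(2)[OF br vK] v(2) mem]
    have "e \<in> S" if e: "e \<in> parcs G" "fst e = v" for e
    proof (rule ccontr)
      assume "e \<notin> S"
      then obtain x where x: "x \<in> {a, b, c, d}" "e \<in> parcs (Bs x)"
        using e(1) s(2,5) by (auto simp: attach_def parcs_sq)
      have xK: "x \<in> pverts (sq a b c d)" using x by simp
      have "v \<in> pverts (Bs x)" using cgraphD(3)[OF branchingD(2)[OF br xK]] x(2) e(2) by auto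
      then have "x = v" using branchingD(3)[OF br xK] vK by auto
      then show False using x(2) tr(2) by simp
    qed
    then have "{e \<in> parcs G. fst e = v} \<subseteq> {e \<in> S. fst e = v}" by blast
    moreover have "\<exists>p q. {e \<in> S. fst e = v} \<subseteq> {p, q}"
    proof -
      consider "v = a" | "v = b" | "v = c" | "v = d" using v(1) by auto
      then show ?thesis
      proof cases
        case 1 then show ?thesis using s(1) unfolding s(2) carcs_sq
          by (intro exI[of _ "(a, b)"] exI[of _ "(a, d)"]) auto
      next
        case 2 then show ?thesis using s(1) unfolding s(2) carcs_sq
          by (intro exI[of _ "(b, a)"] exI[of _ "(b, c)"]) auto
      next
        case 3 then show ?thesis using s(1) unfolding s(2) carcs_sq
          by (intro exI[of _ "(c, b)"] exI[of _ "(c, d)"]) auto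
      next
        case 4 then show ?thesis using s(1) unfolding s(2) carcs_sq
          by (intro exI[of _ "(d, c)"] exI[of _ "(d, a)"]) auto
      qed
    qed
    ultimately obtain p q where "{e \<in> parcs G. fst e = v} \<subseteq> {p, q}" by blast
    then have "card {e \<in> parcs G. fst e = v} \<le> card {p, q}" by (rule card_mono[rotated]) simp
    also have "\<dots> \<le> 2" by (simp add: card_insert_if)
    finally show ?thesis by (simp add: active_def out_degree_def out_arcs_def)
  qed
  let ?A = "{v \<in> Field S. active G v}"
  have eq: "?A = {x, y}" if "?A \<subseteq> {x, y}" for x y
  proof (rule card_seteq[OF _ that])
    show "card {x, y} \<le> card ?A" using two by (simp add: card_insert_if)
  qed simp
  have "\<exists>x y. x \<noteq> y \<and> ?A = {x, y} \<and> (x, y) \<notin> S"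
    using trivial_sides[OF opt[unfolded s(5)] br s(1)]
  proof
    assume "nverts (Bs b) = 1 \<and> nverts (Bs d) = 1"
    then have "?A \<subseteq> {a, c}" using inactive s(3) by auto
    moreover have "(a, c) \<notin> S" using s(1) unfolding s(2) carcs_sq by auto
    ultimately show ?thesis using eq s(1) by (intro exI[of _ a] exI[of _ c]) auto
  next
    assume "nverts (Bs a) = 1 \<and> nverts (Bs c) = 1"
    then have "?A \<subseteq> {b, d}" using inactive s(3) by auto
    moreover have "(b, d) \<notin> S" using s(1) unfolding s(2) carcs_sq by auto
    ultimately show ?thesis using eq s(1) by (intro exI[of _ b] exI[of _ d]) auto
  qed
  then show "antipodal_square G S" using S by (auto simp: antipodal_square_def multiactive_square_def)
qed

text \<open>A class closed under arcs is closed under reachability, so nothing outside can be added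
  to it, and connectedness inside makes it a full component.\<close>

lemma sccs_verts_partition:
  assumes E: "E \<subseteq> V \<times> V"
    and P: "\<Union>P = V" "{} \<notin> P"
      "\<And>S x y. S \<in> P \<Longrightarrow> x \<in> S \<Longrightarrow> y \<in> S \<Longrightarrow> (x, y) \<in> E\<^sup>*"
      "\<And>S x y. S \<in> P \<Longrightarrow> x \<in> S \<Longrightarrow> (x, y) \<in> E \<Longrightarrow> y \<in> S"
  shows "pre_digraph.sccs_verts (with_proj \<lparr>pverts = V, parcs = E\<rparr>) = P"
proof -
  let ?r = "\<lambda>x y. (x, y) \<in> rtrancl_on V E"
  have r: "?r x y \<longleftrightarrow> x \<in> V \<and> (x, y) \<in> E\<^sup>*" for x y
    using rtrancl_on_eq[OF E] in_rtrancl_on_in_F(1)[of x y V E] by blast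
  have closed: "y \<in> S" if "S \<in> P" "x \<in> S" "(x, y) \<in> E\<^sup>*" for S x y
    using that(3,2) by (induct rule: rtrancl_induct) (use P(4)[OF that(1)] in auto)
  have conv: "S \<in> pre_digraph.sccs_verts (with_proj \<lparr>pverts = V, parcs = E\<rparr>) \<longleftrightarrow>
      S \<noteq> {} \<and> (\<forall>u\<in>S. \<forall>v\<in>S. ?r u v) \<and> (\<forall>u\<in>S. \<forall>v. v \<notin> S \<longrightarrow> \<not> ?r u v \<or> \<not> ?r v u)" for S
    by (simp add: pre_digraph.sccs_verts_def reachable_def)
  show ?thesis
  proof (intro equalityI subsetI)
    fix S assume "S \<in> pre_digraph.sccs_verts (with_proj \<lparr>pverts = V, parcs = E\<rparr>)"
    then have S: "S \<noteq> {}" "\<And>u v. u \<in> S \<Longrightarrow> v \<in> S \<Longrightarrow> ?r u v"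
      "\<And>u v. u \<in> S \<Longrightarrow> v \<notin> S \<Longrightarrow> \<not> ?r u v \<or> \<not> ?r v u"
      unfolding conv by blast+
    obtain x where x: "x \<in> S" using S(1) by blast
    then have "x \<in> V" using S(2)[OF x x] r by simp
    then obtain T where T: "T \<in> P" "x \<in> T" using P(1) by blast
    have "S = T"
    proof (intro equalityI subsetI)
      fix y assume "y \<in> S"
      then show "y \<in> T" using closed[OF T] S(2)[OF x] r by simp
    next
      fix y assume y: "y \<in> T"
      then have "y \<in> V" using T P(1) by blast
      then have "?r x y" "?r y x" using P(3)[OF T(1)] T(2) y r \<open>x \<in> V\<close> by simp_all
      then show "y \<in> S" using S(3)[OF x, of y] by blast
    qed
    then show "S \<in> P" using T by simp
  next
    fix S assume S: "S \<in> P"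
    then have "S \<noteq> {}" "S \<subseteq> V" using P(1,2) by auto
    moreover have "?r x y" if "x \<in> S" "y \<in> S" for x y
      using P(3)[OF S that] r that(1) \<open>S \<subseteq> V\<close> by auto
    moreover have "\<not> ?r x y" if "x \<in> S" "y \<notin> S" for x y
      using closed[OF S that(1)] that(2) r by blast
    ultimately show "S \<in> pre_digraph.sccs_verts (with_proj \<lparr>pverts = V, parcs = E\<rparr>)"
      unfolding conv by blast
  qed
qed

lemma config_squares:
  assumes config: "config G K1 X K2 u w s"
    and tri: "\<And>C. C \<in> cycles K1 \<Longrightarrow> card (Field C) = 3" "\<And>C. C \<in> cycles K2 \<Longrightarrow> card (Field C) = 3"
  shows "squares G = cycles X" "\<And>v. squares_at G v = cyc_at X v"
proof -
  have G: "G = glue (glue K1 X) K2" and j1: "joint K1 X u" and j2: "joint (glue K1 X) K2 w"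
    and X: "\<forall>C\<in>cycles X. card (Field C) = 4"
    using config by (simp_all add: config_def sqchain_def)
  have "cycles G = cycles K1 \<union> cycles X \<union> cycles K2"
    unfolding G cycles_glue[OF j2] cycles_glue[OF j1] ..
  then show sq: "squares G = cycles X" using X tri unfolding squares_def by fastforce
  show "squares_at G v = cyc_at X v" for v unfolding squares_at_def cyc_at_def sq ..
qed

text \<open>The squares of the graph are the cycles of \<open>X\<close>, and these use up all arcs
  of \<open>X\<close>. Their deletion leaves both end pieces, and the inner vertices of the chain
  become isolated.\<close>

lemma config_components:
  assumes config: "config G K1 X K2 u w s"
    and tri: "\<And>C. C \<in> cycles K1 \<Longrightarrow> card (Field C) = 3" "\<And>C. C \<in> cycles K2 \<Longrightarrow> card (Field C) = 3"
  shows "components_wo_squares G = {pverts K1, pverts K2} \<union> (\<lambda>z. {z}) ` (pverts X - {u, w})"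
proof -
  note m = config_meet[OF config] and cg = config_cgraph[OF config]
  have G: "G = glue (glue K1 X) K2" and j1: "joint K1 X u" and j2: "joint (glue K1 X) K2 w"
    and X: "\<Union>(cycles X) = parcs X" and uw: "u \<in> pverts X" "w \<in> pverts X"
    using config by (simp_all add: config_def sqchain_def)
  let ?E = "parcs K1 \<union> parcs K2"
  have "parcs K1 \<inter> parcs X = {}" "parcs X \<inter> parcs K2 = {}"
    using parcs_disjoint[OF j1] parcs_disjoint[OF j2] unfolding parcs_glue by auto
  moreover have sq: "squares G = cycles X" by (rule config_squares(1)[OF config tri])
  ultimately have "parcs G - \<Union>(squares G) = ?E"
    unfolding sq X unfolding G parcs_glue by auto
  then have del: "del_square_edges G = \<lparr>pverts = pverts G, parcs = ?E\<rparr>"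
    by (simp add: del_square_edges_def)
  have sub: "parcs K1 \<subseteq> pverts K1 \<times> pverts K1" "parcs K2 \<subseteq> pverts K2 \<times> pverts K2"
    using cgraphD(3) cg by auto
  show ?thesis
    unfolding components_wo_squares_def del
  proof (rule sccs_verts_partition)
    show "?E \<subseteq> pverts G \<times> pverts G" using sub unfolding G pverts_glue by auto
    show "\<Union>({pverts K1, pverts K2} \<union> (\<lambda>z. {z}) ` (pverts X - {u, w})) = pverts G"
      using m(1,2) unfolding G pverts_glue by auto
    show "{} \<notin> {pverts K1, pverts K2} \<union> (\<lambda>z. {z}) ` (pverts X - {u, w})"
      using m(1,2) by auto
  next
    fix S x y assume S: "S \<in> {pverts K1, pverts K2} \<union> (\<lambda>z. {z}) ` (pverts X - {u, w})"
      and xy: "x \<in> S" "y \<in> S"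
    consider "S = pverts K1" | "S = pverts K2" | z where "S = {z}" using S by blast
    then show "(x, y) \<in> ?E\<^sup>*"
    proof cases
      case 1
      then have "(x, y) \<in> (parcs K1)\<^sup>*" using cgraphD(6)[OF cg(1)] xy by simp
      then show ?thesis by (simp add: in_rtrancl_UnI)
    next
      case 2
      then have "(x, y) \<in> (parcs K2)\<^sup>*" using cgraphD(6)[OF cg(3)] xy by simp
      then show ?thesis by (simp add: in_rtrancl_UnI)
    next
      case 3
      then show ?thesis using xy by simp
    qed
  next
    fix S x y assume S: "S \<in> {pverts K1, pverts K2} \<union> (\<lambda>z. {z}) ` (pverts X - {u, w})"
      and xy: "x \<in> S" "(x, y) \<in> ?E"
    have xy': "(x \<in> pverts K1 \<and> y \<in> pverts K1) \<or> (x \<in> pverts K2 \<and> y \<in> pverts K2)" using xy(2) sub by auto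
    consider "S = pverts K1" | "S = pverts K2" | z where "S = {z}" "z \<in> pverts X - {u, w}"
      using S by blast
    then show "y \<in> S"
    proof cases
      case 1 then show ?thesis using xy(1) xy' m(3) by auto
    next
      case 2 then show ?thesis using xy(1) xy' m(3) by auto
    next
      case 3
      then have "x \<in> pverts X" "x \<noteq> u" "x \<noteq> w" using xy(1) by auto
      then show ?thesis using xy' m(1,2) by blast
    qed
  qed
qed

text \<open>A component with more than one vertex is \<open>K1\<close> or \<open>K2\<close>. Its
  only vertex on a square is an end of the chain, which lies on exactly one square.\<close>

lemma config_square_chain:
  assumes opt: "optimal G" and config: "config G K1 X K2 u w s"
    and tri: "\<And>C. C \<in> cycles K1 \<Longrightarrow> card (Field C) = 3" "\<And>C. C \<in> cycles K2 \<Longrightarrow> card (Field C) = 3"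
  shows "square_chain G"
proof -
  note m = config_meet[OF config]
  have at: "squares_at G v = cyc_at X v" for v by (rule config_squares(2)[OF config tri])
  have comp: "components_wo_squares G = {pverts K1, pverts K2} \<union> (\<lambda>z. {z}) ` (pverts X - {u, w})"
    by (rule config_components[OF config tri])
  have x: "card (cyc_at X u) = 1" "card (cyc_at X w) = 1" "\<And>z. card (cyc_at X z) \<le> 2"
    using config by (simp_all add: config_def sqchain_def)
  have cX: "cgraph X" by (rule config_cgraph(2)[OF config])
  have inX: "v \<in> pverts X" if "cyc_at X v \<noteq> {}" for v
    using that cyclesD(5)[OF cX] unfolding cyc_at_def by auto
  have good: "good_unipath_structure G K" if K: "K \<in> unipath_structures G" for K
    unfolding good_unipath_structure_def at
  proof (intro conjI ballI impI)
    have "\<exists>e. card (cyc_at X e) = 1 \<and> K \<inter> pverts X = {e}"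
    proof -
      have c: "K \<in> {pverts K1, pverts K2} \<union> (\<lambda>z. {z}) ` (pverts X - {u, w})" "1 < card K"
        using K unfolding unipath_structures_def comp by auto
      then have "K = pverts K1 \<or> K = pverts K2" by auto
      then show ?thesis using m(1,2) x by (auto simp: Int_commute)
    qed
    then obtain e where e: "card (cyc_at X e) = 1" "K \<inter> pverts X = {e}" by blast
    have only: "v = e" if "v \<in> K" "cyc_at X v \<noteq> {}" for v using inX[OF that(2)] that(1) e(2) by blast
    show "K \<in> unipath_structures G" by (rule K)
    have "{v \<in> K. cyc_at X v \<noteq> {}} \<subseteq> {e}" using only by blast
    then have "card {v \<in> K. cyc_at X v \<noteq> {}} \<le> card {e}" by (rule card_mono[rotated]) simp
    then show "card {v \<in> K. cyc_at X v \<noteq> {}} \<le> 1" by simp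
    show "card (cyc_at X v) = 1" if "v \<in> K" "cyc_at X v \<noteq> {}" for v using only[OF that] e(1) by simp
  qed
  show ?thesis
    unfolding square_chain_def unipath_resolved_def at
    using optimal_antipodal[OF opt] good x(3) by (auto intro: le_antisym)
qed

lemma config_two_largest:
  assumes config: "config G K1 X K2 u w s"
    and tri: "\<And>C. C \<in> cycles K1 \<Longrightarrow> card (Field C) = 3" "\<And>C. C \<in> cycles K2 \<Longrightarrow> card (Field C) = 3"
    and le: "nverts K2 \<le> nverts K1"
  shows "two_largest_components G (pverts K1) (pverts K2)"
proof -
  note m = config_meet[OF config] and cg = config_cgraph[OF config]
  have comp: "components_wo_squares G = {pverts K1, pverts K2} \<union> (\<lambda>z. {z}) ` (pverts X - {u, w})"
    by (rule config_components[OF config tri])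
  have "pverts K1 \<noteq> pverts K2" using m(3) cgraphD(2)[OF cg(1)] by auto
  moreover have "1 \<le> card (pverts K2)" by (rule cgraph_card_ge_1[OF cg(3)])
  ultimately show ?thesis
    unfolding two_largest_components_def comp using le by (auto simp: nverts_def)
qed

theorem theorem13:
  fixes G :: "'a pair_pre_digraph" and n k :: nat
  assumes "k \<ge> 1" and "n > 2 * k + 1"
    and "G \<in> cactus_class n k"
    and "\<forall>G' \<in> cactus_class n k. gpn (G' :: 'a pair_pre_digraph) \<le> gpn G"
  shows "balanced_square_chain n k G"
proof -
  have opt: "optimal G" by (rule optimal_of_gpn[OF assms(3,4)])
  have nk: "nverts G = n" "ncycles G = k" using assms(3) by (simp_all add: cactus_class_def nverts_def ncycles_def)
  have sqs: "card (squares G) = (if n \<ge> 3 * k + 1 then k else n - 2 * k - 1)"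
    using optimal_squares(1)[OF opt] nk by simp
  \<comment> \<open>Both size assumptions enter here: \<open>k \<ge> 1\<close> in the first case of
    \<open>sqs\<close> and \<open>n > 2 * k + 1\<close> in the second provide a square from which
    the chain starts.\<close>
  then have "1 \<le> card (squares G)" using assms(1,2) by auto
  then have "squares G \<noteq> {}" by auto
  then obtain C where C: "C \<in> cycles G" "card (Field C) = 4" by (auto simp: squares_def)
  have "\<exists>K1 X K2 u w s. config G K1 X K2 u w s \<and> nverts K2 \<le> nverts K1 \<and>
      (\<forall>C\<in>cycles K1. card (Field C) \<noteq> 4) \<and> (\<forall>C\<in>cycles K2. card (Field C) \<noteq> 4)"
  proof -
    obtain K1 X K2 u w s where c: "config G K1 X K2 u w s"
      "\<forall>C\<in>cycles K1. card (Field C) \<noteq> 4" "\<forall>C\<in>cycles K2. card (Field C) \<noteq> 4"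
      using optimal_config[OF opt C] by blast
    show ?thesis using c config_sym[OF c(1)] by (cases "nverts K2 \<le> nverts K1") (blast, fastforce)
  qed
  then obtain K1 X K2 u w s where config: "config G K1 X K2 u w s" and le: "nverts K2 \<le> nverts K1"
    and not4: "\<forall>C\<in>cycles K1. card (Field C) \<noteq> 4" "\<forall>C\<in>cycles K2. card (Field C) \<noteq> 4"
    by blast
  have j: "joint K1 X u" "joint (glue K1 X) K2 w" "G = glue (glue K1 X) K2" using config by (simp_all add: config_def)
  have cyc: "cycles G = cycles K1 \<union> cycles X \<union> cycles K2"
    unfolding j(3) cycles_glue[OF j(2)] cycles_glue[OF j(1)] ..
  have tri1: "card (Field C) = 3" if "C \<in> cycles K1" for C
    using optimal_cycle_card[OF opt, of C] not4(1) that cyc by auto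
  have tri2: "card (Field C) = 3" if "C \<in> cycles K2" for C
    using optimal_cycle_card[OF opt, of C] not4(2) that cyc by auto
  have bal: "nverts K1 \<le> nverts K2 + 2 \<and> (cycles K1 = {} \<longrightarrow> nverts K1 \<le> nverts K2 + 1)"
    by (rule config_balance[OF opt config tri1 tri2])
  \<comment> \<open>For this range all cycles are squares, so \<open>K1\<close> contains no triangle
    and the sharper bound of \<open>bal\<close> holds.\<close>
  have none: "cycles K1 = {}" if "n \<ge> 3 * k + 1"
    using optimal_squares(2)[OF opt] that nk not4(1) cyc by auto
  have "maximal_square_chain n k G"
    unfolding maximal_square_chain_def
  proof (intro conjI ballI)
    show "square_chain G" by (rule config_square_chain[OF opt config tri1 tri2])
    fix H :: "'a pair_pre_digraph" assume "H \<in> cactus_class n k"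
    then have "cactus H" "nverts H = n" "ncycles H = k" by (simp_all add: cactus_class_def nverts_def ncycles_def)
    then show "card (squares H) \<le> card (squares G)" using squares_bound[of H] sqs by auto
  qed (use assms(3) sqs in auto)
  then show ?thesis
    unfolding balanced_square_chain_def
    using config_two_largest[OF config tri1 tri2 le] bal none
    by (intro conjI exI[of _ "pverts K1"] exI[of _ "pverts K2"]) (auto simp: nverts_def)
qed

end
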